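(* Let $n\ge1$ and let $V$ be a (strict) closed symmetric monoidal category. For any object $x\in V$ there is a natural isomorphism of $n$-operads $$End_n(x)\;\simeq\;Des_n(End(x)).$$
   Context: Permutations and symmetric operads. For $k\ge0$ let $[k]=\{1<\dots<k\}$. Every function $\sigma:[p]\to[k]$ factors uniquely as $\nu(\sigma)\circ\pi(\sigma)$ with $\nu(\sigma)$ order preserving and $\pi(\sigma)\in\Sigma_p$ order preserving on the fibres of $\sigma$. For $\theta\in\Sigma_k$, $\theta_*:x^{\otimes k}\to x^{\otimes k}$ denotes the symmetry moving the $p$-th factor to position $\theta(p)$. $V(-,-)$ is the internal hom. $End(x)$ is the usual (left) symmetric endomorphism operad, $End(x)_k=V(x^{\otimes k},x)$, with $\theta\in\Sigma_k$ acting by $V(\theta_*,x)^{-1}$ and the usual multiplication. Trees. An $n$-tree is a chain $T=([k_n]\xrightarrow{\rho_{n-1}}[k_{n-1}]\to\dots\xrightarrow{\rho_0}[k_0]=[1])$ of order preserving maps; elements of $[k_n]$ are tips, $|T|=k_n$; $U_n$ is the tree with all $[k_i]=[1]$. A morphism $\sigma:T\to S$ in $\Omega_n$ is a family of functions $\sigma_m$ between the $m$-th levels commuting with the structure maps such that $\sigma_m$ is order preserving on each $\rho_{m-1}^{-1}(j)$. The fibre $T_i$ of $\sigma$ over a tip $i$ of $S$ is the levelwise pullback along the map $U_n\to S$ picking out $i$. Put $\pi(\sigma)=\pi(\sigma_n)$. If $T,S$ agree at levels $\le l$ then $T\otimes_lS$ is the tree that agrees with them at levels $\le l$ and which, over each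 vertex of level $l$, has the part of $T$ followed by the part of $S$. $M_l^j=U_n\otimes_l\dots\otimes_lU_n$ ($j$ factors); morphisms $T\to M_l^j$ correspond to decompositions $T=T_1\otimes_l\dots\otimes_lT_j$ into their fibres. The suspension index $susp(T)$ is the largest $l$ with $[k_0]=\dots=[k_l]=[1]$. For $T\neq U_n$ with $susp(T)=l$ there is a unique decomposition $T=T_1\otimes_l\dots\otimes_lT_j$ with all $susp(T_i)>l$ (canonical decomposition), giving a morphism $T\to M_l^j$. $n$-operads. An $n$-operad in $V$ consists of objects $A_T$, a unit $e:I\to A_{U_n}$ and multiplications $m_\sigma:A_S\otimes A_{T_1}\otimes\dots\otimes A_{T_k}\to A_T$ for each $\sigma:T\to S$ in $\Omega_n$ with fibres $T_1,\dots,T_k$ over the tips of $S$ in order, associative with respect to composites in $\Omega_n$ and unital with respect to $id_T$ and $T\to U_n$. $Des_n$ sends a symmetric operad $B$ to $Des_n(B)_T=B_{|T|}$ with unit $e$ and $m_\sigma=\pi(\sigma)^{-1}\circ m$. $End_n(x)$. Put $x^T=I$ if $|T|=0$, $x^{U_n}=x$, and inductively $x^T=x^{T_1}\otimes\dots\otimes x^{T_j}$ for the canonical decomposition. For $\sigma:T\to S$ with fibres $T_1,\dots,T_k$ the isomorphism $\chi_\sigma:x^{T_1}\otimes\dots\otimes x^{T_k}\to x^T$ is given inductively: it is the identity if $S=U_n$; for $S=M_l^k$ it is the identity if $susp(T)\ge l$, while if $susp(T)=m<l$, so $T_i=T_i^1\otimes_m\dots\otimes_mT_i^j$ for each $i$,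 it is the symmetry $\bigotimes_i\bigotimes_qx^{T_i^q}\to\bigotimes_q\bigotimes_ix^{T_i^q}$ followed by $\chi_{\phi_1}\otimes\dots\otimes\chi_{\phi_j}$ with $\phi_q:T_1^q\otimes_l\dots\otimes_lT_k^q\to M_l^k$; for general $S$ with canonical decomposition $\omega:S\to M_l^j$ it is $\chi_{\omega\sigma}\circ(\chi_{\sigma_1}\otimes\dots\otimes\chi_{\sigma_j})$, where $\sigma_i$ is the restriction of $\sigma$ to the fibres over the $i$-th tip of $M_l^j$. The endomorphism $n$-operad has $End_n(x)_T=V(x^T,x)$, unit the identity of $x$, and for $\sigma:T\to S$ the multiplication $V(x^S,x)\otimes V(x^{T_1},x)\otimes\dots\otimes V(x^{T_k},x)\to V(x^S,x)\otimes V(x^{T_1}\otimes\dots\otimes x^{T_k},x^{\otimes k})\xrightarrow{1\otimes V(\chi_\sigma^{-1},x^{\otimes k})}V(x^S,x)\otimes V(x^T,x^{\otimes k})\to V(x^T,x)$, i.e. $(f;g_1,\dots,g_k)\mapsto f\circ(g_1\otimes\dots\otimes g_k)\circ\chi_\sigma^{-1}$. *)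

theory Defs
  imports "HOL-Combinatorics.Permutations"
begin

section \<open>Strict closed symmetric monoidal categories\<close>

text \<open>
  A category is given by its objects, arrows, domains and codomains; \<open>g \<cdot> f\<close> is \<open>g\<close> after
  \<open>f\<close>. \<open>IHom V a b\<close> is the internal hom \<open>V(a, b)\<close>, with evaluation
  \<open>V(a, b) \<otimes> a \<rightarrow> b\<close>.
\<close>

record ('o, 'a) smc =
  Obj :: "'o set"
  Arr :: "'a set"
  Dom :: "'a \<Rightarrow> 'o"
  Cod :: "'a \<Rightarrow> 'o"
  Idn :: "'o \<Rightarrow> 'a"
  Comp :: "'a \<Rightarrow> 'a \<Rightarrow> 'a"  (infixr \<open>\<cdot>\<index>\<close> 65)
  TenO :: "'o \<Rightarrow> 'o \<Rightarrow> 'o"  (infixr \<open>\<otimes>\<index>\<close> 75)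
  TenA :: "'a \<Rightarrow> 'a \<Rightarrow> 'a"  (infixr \<open>\<boxtimes>\<index>\<close> 75)
  Unit :: "'o"
  Braid :: "'o \<Rightarrow> 'o \<Rightarrow> 'a"
  IHom :: "'o \<Rightarrow> 'o \<Rightarrow> 'o"
  Ev :: "'o \<Rightarrow> 'o \<Rightarrow> 'a"

definition homs :: "('o, 'a) smc \<Rightarrow> 'o \<Rightarrow> 'o \<Rightarrow> 'a set" where
  "homs V a b = {f \<in> Arr V. Dom V f = a \<and> Cod V f = b}"

text \<open>
  Associativity and units of the tensor product are strict; the symmetry is not. The axiom
  that the symmetry of any object with the unit is an identity follows from the hexagon.
\<close>

locale strict_closed_smc =
  fixes V :: "('o, 'a) smc" (structure)
  assumes Dom_closed: "f \<in> Arr V \<Longrightarrow> Dom V f \<in> Obj V"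
    and Cod_closed: "f \<in> Arr V \<Longrightarrow> Cod V f \<in> Obj V"
    and Idn_in: "a \<in> Obj V \<Longrightarrow> Idn V a \<in> homs V a a"
    and Comp_in: "\<lbrakk>f \<in> homs V a b; g \<in> homs V b c\<rbrakk> \<Longrightarrow> g \<cdot> f \<in> homs V a c"
    and Comp_Idn: "f \<in> homs V a b \<Longrightarrow> f \<cdot> Idn V a = f"
    and Idn_Comp: "f \<in> homs V a b \<Longrightarrow> Idn V b \<cdot> f = f"
    and Comp_assoc: "\<lbrakk>f \<in> homs V a b; g \<in> homs V b c; h \<in> homs V c d\<rbrakk>
      \<Longrightarrow> (h \<cdot> g) \<cdot> f = h \<cdot> (g \<cdot> f)"
    and Unit_closed: "Unit V \<in> Obj V"
    and TenO_closed: "\<lbrakk>a \<in> Obj V; b \<in> Obj V\<rbrakk> \<Longrightarrow> a \<otimes> b \<in> Obj V"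
    and TenA_in: "\<lbrakk>f \<in> homs V a b; g \<in> homs V c d\<rbrakk> \<Longrightarrow> f \<boxtimes> g \<in> homs V (a \<otimes> c) (b \<otimes> d)"
    and TenA_Idn: "\<lbrakk>a \<in> Obj V; b \<in> Obj V\<rbrakk> \<Longrightarrow> Idn V a \<boxtimes> Idn V b = Idn V (a \<otimes> b)"
    and TenA_Comp: "\<lbrakk>f \<in> homs V a b; g \<in> homs V b c; f' \<in> homs V a' b'; g' \<in> homs V b' c'\<rbrakk>
      \<Longrightarrow> (g \<cdot> f) \<boxtimes> (g' \<cdot> f') = (g \<boxtimes> g') \<cdot> (f \<boxtimes> f')"
    and TenO_assoc: "\<lbrakk>a \<in> Obj V; b \<in> Obj V; c \<in> Obj V\<rbrakk> \<Longrightarrow> (a \<otimes> b) \<otimes> c = a \<otimes> (b \<otimes> c)"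
    and TenO_Unit: "a \<in> Obj V \<Longrightarrow> a \<otimes> Unit V = a"
    and Unit_TenO: "a \<in> Obj V \<Longrightarrow> Unit V \<otimes> a = a"
    and TenA_assoc: "\<lbrakk>f \<in> Arr V; g \<in> Arr V; h \<in> Arr V\<rbrakk> \<Longrightarrow> (f \<boxtimes> g) \<boxtimes> h = f \<boxtimes> (g \<boxtimes> h)"
    and TenA_Unit: "f \<in> Arr V \<Longrightarrow> f \<boxtimes> Idn V (Unit V) = f"
    and Unit_TenA: "f \<in> Arr V \<Longrightarrow> Idn V (Unit V) \<boxtimes> f = f"
    and Braid_in: "\<lbrakk>a \<in> Obj V; b \<in> Obj V\<rbrakk> \<Longrightarrow> Braid V a b \<in> homs V (a \<otimes> b) (b \<otimes> a)"
    and Braid_natural: "\<lbrakk>f \<in> homs V a b; g \<in> homs V c d\<rbrakk>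
      \<Longrightarrow> Braid V b d \<cdot> (f \<boxtimes> g) = (g \<boxtimes> f) \<cdot> Braid V a c"
    and Braid_symmetric: "\<lbrakk>a \<in> Obj V; b \<in> Obj V\<rbrakk>
      \<Longrightarrow> Braid V b a \<cdot> Braid V a b = Idn V (a \<otimes> b)"
    and Braid_hexagon: "\<lbrakk>a \<in> Obj V; b \<in> Obj V; c \<in> Obj V\<rbrakk>
      \<Longrightarrow> Braid V a (b \<otimes> c) = (Idn V b \<boxtimes> Braid V a c) \<cdot> (Braid V a b \<boxtimes> Idn V c)"
    and IHom_closed: "\<lbrakk>a \<in> Obj V; b \<in> Obj V\<rbrakk> \<Longrightarrow> IHom V a b \<in> Obj V"
    and Ev_in: "\<lbrakk>a \<in> Obj V; b \<in> Obj V\<rbrakk> \<Longrightarrow> Ev V a b \<in> homs V (IHom V a b \<otimes> a) b"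
    and Ev_universal: "\<lbrakk>a \<in> Obj V; b \<in> Obj V; c \<in> Obj V; f \<in> homs V (c \<otimes> a) b\<rbrakk>
      \<Longrightarrow> \<exists>!g. g \<in> homs V c (IHom V a b) \<and> Ev V a b \<cdot> (g \<boxtimes> Idn V a) = f"

definition iso_arr :: "('o, 'a) smc \<Rightarrow> 'a \<Rightarrow> bool" where
  "iso_arr V f \<longleftrightarrow> f \<in> Arr V \<and> (\<exists>g \<in> homs V (Cod V f) (Dom V f).
     g \<cdot>\<^bsub>V\<^esub> f = Idn V (Dom V f) \<and> f \<cdot>\<^bsub>V\<^esub> g = Idn V (Cod V f))"

definition inv_arr :: "('o, 'a) smc \<Rightarrow> 'a \<Rightarrow> 'a" where
  "inv_arr V f = (THE g. g \<in> homs V (Cod V f) (Dom V f) \<and>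
     g \<cdot>\<^bsub>V\<^esub> f = Idn V (Dom V f) \<and> f \<cdot>\<^bsub>V\<^esub> g = Idn V (Cod V f))"

definition tensO :: "('o, 'a) smc \<Rightarrow> 'o list \<Rightarrow> 'o" where
  "tensO V xs = foldr (TenO V) xs (Unit V)"

definition tensA :: "('o, 'a) smc \<Rightarrow> 'a list \<Rightarrow> 'a" where
  "tensA V fs = foldr (TenA V) fs (Idn V (Unit V))"

text \<open>
  All symmetries of multiple tensor products are written as stable sortings: a list of pairs
  (key, object) gives the symmetry from the tensor product of the objects in the given order
  to their tensor product sorted by key, objects with equal keys staying in order. It is the
  insertion sort: the first object is moved past the sorted remaining objects of smaller key.
\<close>

fun sort_sym :: "('o, 'a) smc \<Rightarrow> (nat \<times> 'o) list \<Rightarrow> 'a" where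
  "sort_sym V [] = Idn V (Unit V)"
| "sort_sym V ((k, a) # r) =
    (Braid V a (tensO V (map snd (filter (\<lambda>p. fst p < k) (sort_key fst r)))) \<boxtimes>\<^bsub>V\<^esub>
      Idn V (tensO V (map snd (filter (\<lambda>p. \<not> fst p < k) (sort_key fst r)))))
    \<cdot>\<^bsub>V\<^esub> (Idn V a \<boxtimes>\<^bsub>V\<^esub> sort_sym V r)"

definition curry_arr :: "('o, 'a) smc \<Rightarrow> 'o \<Rightarrow> 'o \<Rightarrow> 'o \<Rightarrow> 'a \<Rightarrow> 'a" where
  "curry_arr V c a b f =
    (THE g. g \<in> homs V c (IHom V a b) \<and> Ev V a b \<cdot>\<^bsub>V\<^esub> (g \<boxtimes>\<^bsub>V\<^esub> Idn V a) = f)"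

text \<open>The functor \<open>V(h, f) : V(a, b) \<rightarrow> V(a', b')\<close> for \<open>h : a' \<rightarrow> a\<close> and \<open>f : b \<rightarrow> b'\<close>.\<close>

definition ihom_map :: "('o, 'a) smc \<Rightarrow> 'a \<Rightarrow> 'a \<Rightarrow> 'a" where
  "ihom_map V h f = (let a = Cod V h; a' = Dom V h; b = Dom V f; b' = Cod V f in
     curry_arr V (IHom V a b) a' b'
       (f \<cdot>\<^bsub>V\<^esub> Ev V a b \<cdot>\<^bsub>V\<^esub> (Idn V (IHom V a b) \<boxtimes>\<^bsub>V\<^esub> h)))"

text \<open>Composition \<open>V(b, c) \<otimes> V(a, b) \<rightarrow> V(a, c)\<close>.\<close>

definition ihom_comp :: "('o, 'a) smc \<Rightarrow> 'o \<Rightarrow> 'o \<Rightarrow> 'o \<Rightarrow> 'a" where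
  "ihom_comp V a b c = curry_arr V (IHom V b c \<otimes>\<^bsub>V\<^esub> IHom V a b) a c
     (Ev V b c \<cdot>\<^bsub>V\<^esub> (Idn V (IHom V b c) \<boxtimes>\<^bsub>V\<^esub> Ev V a b))"

text \<open>
  The map \<open>V(a\<^sub>1, b\<^sub>1) \<otimes> \<dots> \<otimes> V(a\<^sub>k, b\<^sub>k) \<rightarrow> V(a\<^sub>1 \<otimes> \<dots> \<otimes> a\<^sub>k, b\<^sub>1 \<otimes> \<dots> \<otimes> b\<^sub>k)\<close>. Its adjunct
  interleaves the homs with the \<open>a\<^sub>i\<close> and then evaluates.
\<close>

definition ihom_tens :: "('o, 'a) smc \<Rightarrow> 'o list \<Rightarrow> 'o list \<Rightarrow> 'a" where
  "ihom_tens V as bs = (let hs = map2 (IHom V) as bs in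
     curry_arr V (tensO V hs) (tensO V as) (tensO V bs)
       (tensA V (map2 (Ev V) as bs) \<cdot>\<^bsub>V\<^esub> sort_sym V (enumerate 0 hs @ enumerate 0 as)))"


section \<open>Permutations and symmetric operads\<close>

text \<open>
  Positions are counted from 0: the ordered set \<open>[k]\<close> is \<open>{..<k}\<close>, and a function
  \<open>\<sigma> : [p] \<rightarrow> [k]\<close> is the list of its \<open>p\<close> values. The following is \<open>\<pi>(\<sigma>)\<close>.
\<close>

definition perm_part :: "nat list \<Rightarrow> nat \<Rightarrow> nat" where
  "perm_part s = (THE \<pi>. \<pi> permutes {..<length s} \<and>
     (\<forall>i j. i < j \<and> j < length s \<and> s ! i = s ! j \<longrightarrow> \<pi> i < \<pi> j) \<and>
     (\<exists>\<nu>. mono_on {..<length s} \<nu> \<and> (\<forall>i<length s. s ! i = \<nu> (\<pi> i))))"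

text \<open>The symmetry \<open>\<theta>\<^sub>*\<close> of \<open>x\<^sup>\<otimes>\<^sup>k\<close> moving the \<open>p\<close>-th factor to position \<open>\<theta> p\<close>.\<close>

definition perm_sym :: "('o, 'a) smc \<Rightarrow> 'o \<Rightarrow> nat \<Rightarrow> (nat \<Rightarrow> nat) \<Rightarrow> 'a" where
  "perm_sym V x k \<theta> = sort_sym V (map (\<lambda>p. (\<theta> p, x)) [0..<k])"

text \<open>
  \<open>SAct B k \<theta>\<close> is the action of \<open>\<theta> \<in> \<Sigma>\<^sub>k\<close> on \<open>B\<^sub>k\<close>, and \<open>SMul B [p\<^sub>1, \<dots>, p\<^sub>k]\<close> is the
  multiplication \<open>B\<^sub>k \<otimes> B\<^bsub>p\<^sub>1\<^esub> \<otimes> \<dots> \<otimes> B\<^bsub>p\<^sub>k\<^esub> \<rightarrow> B\<^bsub>p\<^sub>1 + \<dots> + p\<^sub>k\<^esub>\<close>.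
\<close>

record ('o, 'a) sym_operad =
  SOb :: "nat \<Rightarrow> 'o"
  SAct :: "nat \<Rightarrow> (nat \<Rightarrow> nat) \<Rightarrow> 'a"
  SUnit :: "'a"
  SMul :: "nat list \<Rightarrow> 'a"

definition End_sym :: "('o, 'a) smc \<Rightarrow> 'o \<Rightarrow> ('o, 'a) sym_operad" where
  "End_sym V x = (let pow = (\<lambda>k. tensO V (replicate k x)) in
    \<lparr>SOb = (\<lambda>k. IHom V (pow k) x),
     SAct = (\<lambda>k \<theta>. inv_arr V (ihom_map V (perm_sym V x k \<theta>) (Idn V x))),
     SUnit = curry_arr V (Unit V) x x (Idn V x),
     SMul = (\<lambda>ps. ihom_comp V (pow (sum_list ps)) (pow (length ps)) x \<cdot>\<^bsub>V\<^esub>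
       (Idn V (IHom V (pow (length ps)) x) \<boxtimes>\<^bsub>V\<^esub>
         ihom_tens V (map pow ps) (replicate (length ps) x)))\<rparr>)"


section \<open>Trees\<close>

text \<open>
  An \<open>n\<close>-tree is the list \<open>[\<rho>\<^sub>0, \<dots>, \<rho>\<^bsub>n-1\<^esub>]\<close> of its structure maps, each map
  \<open>\<rho>\<^sub>m : [k\<^bsub>m+1\<^esub>] \<rightarrow> [k\<^sub>m]\<close> being the list of its values. So \<open>k\<^bsub>m+1\<^esub>\<close> is the length of
  \<open>\<rho>\<^sub>m\<close>, and equality of lists is equality of trees.
\<close>

type_synonym tree = "nat list list"

definition width :: "tree \<Rightarrow> nat \<Rightarrow> nat" where
  "width T m = (case m of 0 \<Rightarrow> 1 | Suc m' \<Rightarrow> length (T ! m'))"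

definition is_tree :: "nat \<Rightarrow> tree \<Rightarrow> bool" where
  "is_tree n T \<longleftrightarrow> length T = n \<and> (\<forall>m<n. sorted (T ! m) \<and> set (T ! m) \<subseteq> {..<width T m})"

definition tips :: "tree \<Rightarrow> nat" where
  "tips T = width T (length T)"

definition U_tree :: "nat \<Rightarrow> tree" where
  "U_tree n = replicate n [0]"

text \<open>\<open>anc T l m v\<close> is the ancestor at level \<open>l\<close> of the vertex \<open>v\<close> of level \<open>m \<ge> l\<close>.\<close>

primrec anc :: "tree \<Rightarrow> nat \<Rightarrow> nat \<Rightarrow> nat \<Rightarrow> nat" where
  "anc T l 0 v = v"
| "anc T l (Suc m) v = (if Suc m \<le> l then v else anc T l m (T ! m ! v))"

text \<open>A morphism of \<open>n\<close>-trees is the list \<open>[\<sigma>\<^sub>0, \<dots>, \<sigma>\<^sub>n]\<close> of its components.\<close>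

type_synonym tmor = "nat list list"

definition is_tmor :: "nat \<Rightarrow> tree \<Rightarrow> tree \<Rightarrow> tmor \<Rightarrow> bool" where
  "is_tmor n T S \<sigma> \<longleftrightarrow> is_tree n T \<and> is_tree n S \<and> length \<sigma> = Suc n \<and>
     (\<forall>m\<le>n. length (\<sigma> ! m) = width T m \<and> set (\<sigma> ! m) \<subseteq> {..<width S m}) \<and>
     (\<forall>m<n. \<forall>v<width T (Suc m). \<sigma> ! m ! (T ! m ! v) = S ! m ! (\<sigma> ! Suc m ! v)) \<and>
     (\<forall>m<n. \<forall>w<width T (Suc m). \<forall>v<w. T ! m ! v = T ! m ! w \<longrightarrow> \<sigma> ! Suc m ! v \<le> \<sigma> ! Suc m ! w)"

definition id_tmor :: "tree \<Rightarrow> tmor" where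
  "id_tmor T = map (\<lambda>m. [0..<width T m]) [0..<Suc (length T)]"

definition to_U :: "tree \<Rightarrow> tmor" where
  "to_U T = map (\<lambda>m. replicate (width T m) 0) [0..<Suc (length T)]"

definition comp_tmor :: "tmor \<Rightarrow> tmor \<Rightarrow> tmor" where
  "comp_tmor \<omega> \<sigma> = map2 (\<lambda>t s. map ((!) t) s) \<omega> \<sigma>"

text \<open>
  The map \<open>U\<^sub>n \<rightarrow> S\<close> picking out the tip \<open>i\<close> selects at each level the ancestor of \<open>i\<close>.
  \<open>fibre_level S \<sigma> i m\<close> is the increasing list of the level \<open>m\<close> vertices lying over it; the
  fibre is the pullback tree, its vertices renumbered by their position in that list.
\<close>

definition fibre_level :: "tree \<Rightarrow> tmor \<Rightarrow> nat \<Rightarrow> nat \<Rightarrow> nat list" where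
  "fibre_level S \<sigma> i m = filter (\<lambda>v. \<sigma> ! m ! v = anc S m (length S) i) [0..<length (\<sigma> ! m)]"

definition pos :: "nat list \<Rightarrow> nat \<Rightarrow> nat" where
  "pos A v = length (filter (\<lambda>w. w < v) A)"

definition fibre :: "tree \<Rightarrow> tree \<Rightarrow> tmor \<Rightarrow> nat \<Rightarrow> tree" where
  "fibre T S \<sigma> i =
    map (\<lambda>m. map (\<lambda>v. pos (fibre_level S \<sigma> i m) (T ! m ! v)) (fibre_level S \<sigma> i (Suc m)))
      [0..<length T]"

definition fibres :: "tree \<Rightarrow> tree \<Rightarrow> tmor \<Rightarrow> tree list" where
  "fibres T S \<sigma> = map (fibre T S \<sigma>) [0..<tips S]"

text \<open>
  For \<open>\<sigma> : T \<rightarrow> S\<close> and \<open>\<omega> : S \<rightarrow> R\<close>, the restriction of \<open>\<sigma>\<close> to a morphism from the fibre of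
  \<open>\<omega>\<sigma>\<close> to the fibre of \<open>\<omega>\<close> over the tip \<open>i\<close> of \<open>R\<close>.
\<close>

definition fibre_tmor :: "tree \<Rightarrow> tmor \<Rightarrow> tmor \<Rightarrow> nat \<Rightarrow> tmor" where
  "fibre_tmor R \<omega> \<sigma> i =
    map (\<lambda>m. map (\<lambda>v. pos (fibre_level R \<omega> i m) (\<sigma> ! m ! v))
        (fibre_level R (comp_tmor \<omega> \<sigma>) i m)) [0..<length \<sigma>]"

text \<open>\<open>M\<^sub>l\<^sup>j\<close> has width 1 up to level \<open>l\<close> and width \<open>j\<close>, with identity maps, above.\<close>

definition M_tree :: "nat \<Rightarrow> nat \<Rightarrow> nat \<Rightarrow> tree" where
  "M_tree n l j =
    map (\<lambda>m. if m < l then [0] else if m = l then replicate j 0 else [0..<j]) [0..<n]"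

definition susp :: "tree \<Rightarrow> nat" where
  "susp T = (GREATEST l. l \<le> length T \<and> (\<forall>m\<le>l. width T m = 1))"

text \<open>
  A decomposition of \<open>T\<close> into \<open>j\<close> factors at level \<open>l\<close> is encoded by the corresponding morphism
  \<open>T \<rightarrow> M\<^sub>l\<^sup>j\<close>, the factors being its fibres. In the canonical decomposition the factors are the
  parts of \<open>T\<close> over the single vertices of level \<open>l + 1\<close>, where \<open>l = susp T\<close>.
\<close>

definition can_width :: "tree \<Rightarrow> nat" where
  "can_width T = width T (Suc (susp T))"

definition can_tree :: "tree \<Rightarrow> tree" where
  "can_tree T = M_tree (length T) (susp T) (can_width T)"

definition can_tmor :: "tree \<Rightarrow> tmor" where
  "can_tmor T =
    map (\<lambda>m. if m \<le> susp T then replicate (width T m) 0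
             else map (anc T (Suc (susp T)) m) [0..<width T m]) [0..<Suc (length T)]"

definition can_factor :: "tree \<Rightarrow> nat \<Rightarrow> tree" where
  "can_factor T q = fibre T (can_tree T) (can_tmor T) q"

definition can_factors :: "tree \<Rightarrow> tree list" where
  "can_factors T = map (can_factor T) [0..<can_width T]"

text \<open>The restriction of a morphism out of \<open>T\<close> to the \<open>q\<close>-th canonical factor of \<open>T\<close>.\<close>

definition can_restrict :: "tree \<Rightarrow> tmor \<Rightarrow> nat \<Rightarrow> tmor" where
  "can_restrict T \<sigma> q =
    map (\<lambda>m. map ((!) (\<sigma> ! m)) (fibre_level (can_tree T) (can_tmor T) q m)) [0..<length \<sigma>]"

lemma width_0 [simp]: "width T 0 = 1"
  and width_Suc [simp]: "width T (Suc m) = length (T ! m)"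
  by (simp_all add: width_def)

lemma susp_props:
  shows susp_le: "susp T \<le> length T"
    and susp_width: "m \<le> susp T \<Longrightarrow> width T m = 1"
    and susp_greatest: "\<lbrakk>l \<le> length T; \<And>m. m \<le> l \<Longrightarrow> width T m = 1\<rbrakk> \<Longrightarrow> l \<le> susp T"
proof -
  let ?P = "\<lambda>l. l \<le> length T \<and> (\<forall>m\<le>l. width T m = 1)"
  have "?P (susp T)"
    unfolding susp_def by (rule GreatestI_nat[where k = 0 and b = "length T"]) auto
  then show "susp T \<le> length T" and "m \<le> susp T \<Longrightarrow> width T m = 1"
    by auto
  show "l \<le> susp T" if "l \<le> length T" "\<And>m. m \<le> l \<Longrightarrow> width T m = 1"
    unfolding susp_def by (rule Greatest_le_nat[where b = "length T"]) (use that in auto)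
qed

lemma susp_less:
  assumes "is_tree n T" "T \<noteq> U_tree n"
  shows "susp T < n"
proof (rule ccontr)
  assume "\<not> susp T < n"
  with assms(1) have *: "length T = n" "\<And>m. m \<le> n \<Longrightarrow> width T m = 1"
    using susp_width[of _ T] by (auto simp: is_tree_def)
  have "T ! m = [0]" if "m < n" for m
  proof -
    have "length (T ! m) = 1" "width T m = 1"
      using *(2)[of "Suc m"] *(2)[of m] that by auto
    moreover have "set (T ! m) \<subseteq> {..<width T m}"
      using assms(1) that by (simp add: is_tree_def)
    ultimately show ?thesis
      by (cases "T ! m") auto
  qed
  with * have "T = U_tree n"
    by (auto simp: U_tree_def intro!: nth_equalityI)
  with assms(2) show False by simp
qed

lemma can_width_neq_1: "susp T < length T \<Longrightarrow> can_width T \<noteq> 1"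
  using susp_greatest[of "Suc (susp T)" T] susp_width[of _ T]
  by (force simp: can_width_def le_Suc_eq)

lemma length_fibre [simp]: "length (fibre T S \<sigma> i) = length T"
  by (simp add: fibre_def)

lemma width_fibre:
  assumes "m < length T"
  shows "width (fibre T S \<sigma> i) (Suc m) = length (fibre_level S \<sigma> i (Suc m))"
  using assms by (simp add: fibre_def)

lemma anc_M_tree:
  assumes "l < n" "i < j" "m \<le> k" "k \<le> n"
  shows "anc (M_tree n l j) m k (if k \<le> l then 0 else i) = (if m \<le> l then 0 else i)"
  using assms(3,4)
proof (induction k)
  case (Suc k)
  show ?case
  proof (cases "m = Suc k")
    case False
    moreover have "M_tree n l j ! k ! (if Suc k \<le> l then 0 else i) = (if k \<le> l then 0 else i)"
      using Suc.prems assms by (auto simp: M_tree_def)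
    ultimately show ?thesis
      using Suc by simp
  qed auto
qed auto

lemma fibre_level_can:
  assumes "susp T < length T" "i < can_width T" "m \<le> Suc (susp T)"
  shows "fibre_level (can_tree T) (can_tmor T) i m = (if m \<le> susp T then [0] else [i])"
proof -
  have anc: "anc (can_tree T) m (length (can_tree T)) i = (if m \<le> susp T then 0 else i)"
    using anc_M_tree[OF assms(1,2), of m "length T"] assms
    by (simp add: can_tree_def M_tree_def)
  show ?thesis
  proof (cases "m \<le> susp T")
    case True
    then have "can_tmor T ! m = [0]"
      using susp_width[of m T] susp_le[of T] by (simp add: can_tmor_def del: upt_Suc)
    with True anc show ?thesis
      by (simp add: fibre_level_def)
  next
    case False
    with assms have m: "m = Suc (susp T)" by simp
    have "can_tmor T ! m = map (anc T m m) [0..<can_width T]"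
      using m assms by (simp add: can_tmor_def can_width_def del: upt_Suc)
    also have "\<dots> = [0..<can_width T]"
      using m by (intro nth_equalityI) auto
    finally have "fibre_level (can_tree T) (can_tmor T) i m
        = filter (\<lambda>v. v = i) [0..<can_width T]"
      unfolding fibre_level_def anc using False by (auto intro!: filter_cong)
    moreover have "filter (\<lambda>v. v = i) [0..<k] = (if i < k then [i] else [])" for k
      by (induction k) auto
    ultimately show ?thesis
      using assms(2) False by simp
  qed
qed

lemma susp_can_factor:
  assumes "susp T < length T" "i < can_width T"
  shows "susp T < susp (can_factor T i)"
proof -
  have "width (can_factor T i) m = 1" if "m \<le> Suc (susp T)" for m
  proof (cases m)
    case (Suc k)
    then show ?thesis
      using fibre_level_can[OF assms that] that assms
      by (subst Suc, subst can_factor_def, subst width_fibre) auto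
  qed simp
  then have "Suc (susp T) \<le> susp (can_factor T i)"
    using assms by (intro susp_greatest) (auto simp: can_factor_def)
  then show ?thesis by simp
qed

lemma susp_M_tree:
  assumes "l < n" "j \<noteq> 1"
  shows "susp (M_tree n l j) = l"
proof (rule antisym)
  have len: "length (M_tree n l j) = n"
    by (simp add: M_tree_def)
  show "susp (M_tree n l j) \<le> l"
  proof (rule ccontr)
    assume "\<not> susp (M_tree n l j) \<le> l"
    then have "width (M_tree n l j) (Suc l) = 1"
      by (intro susp_width) simp
    with assms show False
      by (simp add: M_tree_def)
  qed
  have "width (M_tree n l j) m = 1" if "m \<le> l" for m
    using that assms by (cases m) (auto simp: M_tree_def)
  then show "l \<le> susp (M_tree n l j)"
    using assms len by (intro susp_greatest) auto
qed

lemma tips_M_tree: "l < n \<Longrightarrow> tips (M_tree n l j) = j"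
  by (cases n) (auto simp: tips_def M_tree_def simp del: upt_Suc)


section \<open>n-operads\<close>

text \<open>\<open>NMul A T S \<sigma>\<close> is the multiplication \<open>m\<^sub>\<sigma>\<close> for \<open>\<sigma> : T \<rightarrow> S\<close>.\<close>

record ('o, 'a) n_operad =
  NOb :: "tree \<Rightarrow> 'o"
  NUnit :: "'a"
  NMul :: "tree \<Rightarrow> tree \<Rightarrow> tmor \<Rightarrow> 'a"

text \<open>
  Associativity for \<open>\<sigma> : T \<rightarrow> S\<close> and \<open>\<omega> : S \<rightarrow> R\<close> compares two maps out of
  \<open>A\<^sub>R \<otimes> (\<Otimes>i. A\<^bsub>S_i\<^esub>) \<otimes> (\<Otimes>s. A\<^bsub>T_s\<^esub>)\<close>, with \<open>i\<close> ranging over the tips of \<open>R\<close> and \<open>s\<close> over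
  those of \<open>S\<close>. The sorting moves each \<open>A\<^bsub>T_s\<^esub>\<close> behind the \<open>A\<^bsub>S_i\<^esub>\<close> with \<open>i = \<omega>(s)\<close>; the
  fibres \<open>T\<^sub>s\<close> of \<open>\<sigma>\<close> with \<open>\<omega>(s) = i\<close> are those of the restriction of \<open>\<sigma>\<close> over \<open>i\<close>.
\<close>

definition n_operad_assoc :: "('o, 'a) smc \<Rightarrow> ('o, 'a) n_operad \<Rightarrow>
    tree \<Rightarrow> tree \<Rightarrow> tree \<Rightarrow> tmor \<Rightarrow> tmor \<Rightarrow> bool" where
  "n_operad_assoc V A T S R \<sigma> \<omega> \<longleftrightarrow>
    NMul A T S \<sigma> \<cdot>\<^bsub>V\<^esub>
      (NMul A S R \<omega> \<boxtimes>\<^bsub>V\<^esub> Idn V (tensO V (map (NOb A) (fibres T S \<sigma>))))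
    = NMul A T R (comp_tmor \<omega> \<sigma>) \<cdot>\<^bsub>V\<^esub>
      (Idn V (NOb A R) \<boxtimes>\<^bsub>V\<^esub>
        tensA V (map (\<lambda>i. NMul A (fibre T R (comp_tmor \<omega> \<sigma>) i) (fibre S R \<omega> i)
          (fibre_tmor R \<omega> \<sigma> i)) [0..<tips R])) \<cdot>\<^bsub>V\<^esub>
      sort_sym V ([(0, NOb A R)] @
        map (\<lambda>i. (Suc i, NOb A (fibre S R \<omega> i))) [0..<tips R] @
        map (\<lambda>s. (Suc (last \<omega> ! s), NOb A (fibre T S \<sigma> s))) [0..<tips S])"

definition is_n_operad :: "nat \<Rightarrow> ('o, 'a) smc \<Rightarrow> ('o, 'a) n_operad \<Rightarrow> bool" where
  "is_n_operad n V A \<longleftrightarrow>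
    (\<forall>T. is_tree n T \<longrightarrow> NOb A T \<in> Obj V) \<and>
    NUnit A \<in> homs V (Unit V) (NOb A (U_tree n)) \<and>
    (\<forall>T S \<sigma>. is_tmor n T S \<sigma> \<longrightarrow>
      NMul A T S \<sigma> \<in> homs V (NOb A S \<otimes>\<^bsub>V\<^esub> tensO V (map (NOb A) (fibres T S \<sigma>))) (NOb A T)) \<and>
    (\<forall>T S R \<sigma> \<omega>. is_tmor n T S \<sigma> \<and> is_tmor n S R \<omega> \<longrightarrow> n_operad_assoc V A T S R \<sigma> \<omega>) \<and>
    (\<forall>T. is_tree n T \<longrightarrow>
      NMul A T T (id_tmor T) \<cdot>\<^bsub>V\<^esub>
        (Idn V (NOb A T) \<boxtimes>\<^bsub>V\<^esub> tensA V (replicate (tips T) (NUnit A))) = Idn V (NOb A T)) \<and>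
    (\<forall>T. is_tree n T \<longrightarrow>
      NMul A T (U_tree n) (to_U T) \<cdot>\<^bsub>V\<^esub> (NUnit A \<boxtimes>\<^bsub>V\<^esub> Idn V (NOb A T)) = Idn V (NOb A T))"

definition is_n_operad_iso :: "nat \<Rightarrow> ('o, 'a) smc \<Rightarrow> ('o, 'a) n_operad \<Rightarrow> ('o, 'a) n_operad \<Rightarrow>
    (tree \<Rightarrow> 'a) \<Rightarrow> bool" where
  "is_n_operad_iso n V A B \<phi> \<longleftrightarrow> is_n_operad n V A \<and> is_n_operad n V B \<and>
    (\<forall>T. is_tree n T \<longrightarrow> \<phi> T \<in> homs V (NOb A T) (NOb B T) \<and> iso_arr V (\<phi> T)) \<and>
    \<phi> (U_tree n) \<cdot>\<^bsub>V\<^esub> NUnit A = NUnit B \<and>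
    (\<forall>T S \<sigma>. is_tmor n T S \<sigma> \<longrightarrow>
      \<phi> T \<cdot>\<^bsub>V\<^esub> NMul A T S \<sigma> =
      NMul B T S \<sigma> \<cdot>\<^bsub>V\<^esub> (\<phi> S \<boxtimes>\<^bsub>V\<^esub> tensA V (map \<phi> (fibres T S \<sigma>))))"

text \<open>The last component of \<open>\<sigma>\<close> is its map on tips. The number \<open>n\<close> enters only
  as the height of the trees, here and in \<open>End\<^sub>n(x)\<close>.\<close>

definition Des :: "('o, 'a) smc \<Rightarrow> ('o, 'a) sym_operad \<Rightarrow> ('o, 'a) n_operad" where
  "Des V B =
    \<lparr>NOb = (\<lambda>T. SOb B (tips T)),
     NUnit = SUnit B,
     NMul = (\<lambda>T S \<sigma>. SAct B (tips T) (inv (perm_part (last \<sigma>))) \<cdot>\<^bsub>V\<^esub>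
       SMul B (map tips (fibres T S \<sigma>)))\<rparr>"


section \<open>The endomorphism n-operad\<close>

text \<open>
  The power \<open>x\<^sup>T\<close>, formed with an arbitrary unit and multiplication, so that it applies both to
  objects and to arrows. The value at lists which are not trees is irrelevant.
\<close>

function (sequential) tree_power :: "'b \<Rightarrow> ('b \<Rightarrow> 'b \<Rightarrow> 'b) \<Rightarrow> 'b \<Rightarrow> tree \<Rightarrow> 'b" where
  "tree_power e mul x T =
    (if \<not> is_tree (length T) T \<or> tips T = 0 then e
     else if T = U_tree (length T) then x
     else foldr mul (map (tree_power e mul x) (can_factors T)) e)"
  by pat_completeness auto
termination
proof (relation "measure (\<lambda>(e, mul, x, T). length T - susp T)")
  fix e :: 'b and mul x T S
  assume *: "\<not> (\<not> is_tree (length T) T \<or> tips T = 0)" "T \<noteq> U_tree (length T)"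
    "S \<in> set (can_factors T)"
  then obtain q where "q < can_width T" "S = can_factor T q"
    by (auto simp: can_factors_def)
  moreover have "susp T < length T"
    using * susp_less by blast
  ultimately show "((e, mul, x, S), e, mul, x, T) \<in> measure (\<lambda>(e, mul, x, T). length T - susp T)"
    using susp_can_factor[of T q] by (simp add: can_factor_def diff_less_mono2)
qed auto

declare tree_power.simps [simp del]

definition tpow :: "('o, 'a) smc \<Rightarrow> 'o \<Rightarrow> tree \<Rightarrow> 'o" where
  "tpow V x = tree_power (Unit V) (TenO V) x"

definition tpow_arr :: "('o, 'a) smc \<Rightarrow> 'a \<Rightarrow> tree \<Rightarrow> 'a" where
  "tpow_arr V f = tree_power (Idn V (Unit V)) (TenA V) f"

text \<open>
  The isomorphism \<open>\<chi>\<^sub>\<sigma>\<close>. The second case is \<open>S = M\<^sub>l\<^sup>k\<close> with \<open>k \<noteq> 1\<close>, where necessarily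
  \<open>l = susp S\<close> and \<open>k = tips S\<close>. In it, with \<open>m = susp T < l\<close>, the factor \<open>T\<^sub>i\<^sup>q\<close> is the \<open>q\<close>-th
  canonical factor of the fibre \<open>T\<^sub>i\<close>; the symmetry reorders the \<open>x\<^bsup>T_i^q\<^esup>\<close> by \<open>q\<close>; and
  \<open>\<phi>\<^sub>q\<close> is the restriction of \<open>\<sigma>\<close> to the \<open>q\<close>-th canonical factor of \<open>T\<close>, which is the product
  of the \<open>T\<^sub>i\<^sup>q\<close> over \<open>i\<close> at level \<open>l\<close>. The value when \<open>\<sigma>\<close> is not a morphism is irrelevant.
\<close>

function (sequential) chi :: "('o, 'a) smc \<Rightarrow> 'o \<Rightarrow> tree \<Rightarrow> tree \<Rightarrow> tmor \<Rightarrow> 'a" where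
  "chi V x T S \<sigma> =
    (if \<not> is_tmor (length T) T S \<sigma> \<or> S = U_tree (length S) then Idn V (tpow V x T)
     else if S = M_tree (length S) (susp S) (tips S) then
       (if susp S \<le> susp T then Idn V (tpow V x T)
        else tensA V (map (\<lambda>q. chi V x (can_factor T q) S (can_restrict T \<sigma> q))
               [0..<can_width T]) \<cdot>\<^bsub>V\<^esub>
             sort_sym V (concat (map (\<lambda>T'. enumerate 0 (map (tpow V x) (can_factors T')))
               (fibres T S \<sigma>))))
     else
       chi V x T (can_tree S) (comp_tmor (can_tmor S) \<sigma>) \<cdot>\<^bsub>V\<^esub>
       tensA V (map (\<lambda>i. chi V x (fibre T (can_tree S) (comp_tmor (can_tmor S) \<sigma>) i)
           (can_factor S i) (fibre_tmor (can_tree S) (can_tmor S) \<sigma> i)) [0..<can_width S]))"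
  by pat_completeness auto
termination
proof (relation "measures [\<lambda>(V, x, T, S, \<sigma>). length S - susp S,
      \<lambda>(V, x, T, S, \<sigma>). if S = M_tree (length S) (susp S) (tips S) then 0 else 1,
      \<lambda>(V, x, T, S, \<sigma>). length T - susp T]", goal_cases)
  case (2 V x T S \<sigma> q)
  then have "susp T < length T" "q < can_width T"
    using susp_le[of S] by (auto simp: is_tmor_def is_tree_def)
  then show ?case
    using susp_can_factor[of T q] by (simp add: can_factor_def diff_less_mono2)
next
  case (3 V x T S \<sigma>)
  then have l: "susp S < length S"
    using susp_less[of "length S" S] by (auto simp: is_tmor_def is_tree_def)
  have "length (can_tree S) = length S" "susp (can_tree S) = susp S"
    "tips (can_tree S) = can_width S"
    using l can_width_neq_1[OF l]
    by (simp_all add: can_tree_def susp_M_tree tips_M_tree) (simp add: M_tree_def)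
  with 3 show ?case
    by (auto simp: can_tree_def)
next
  case (4 V x T S \<sigma> i)
  then have "susp S < length S" "i < can_width S"
    using susp_less[of "length S" S] by (auto simp: is_tmor_def is_tree_def)
  then show ?case
    using susp_can_factor[of S i] by (simp add: can_factor_def diff_less_mono2)
qed auto

declare chi.simps [simp del]

definition End_n :: "('o, 'a) smc \<Rightarrow> 'o \<Rightarrow> ('o, 'a) n_operad" where
  "End_n V x =
    \<lparr>NOb = (\<lambda>T. IHom V (tpow V x T) x),
     NUnit = curry_arr V (Unit V) x x (Idn V x),
     NMul = (\<lambda>T S \<sigma>. let xk = tensO V (replicate (tips S) x) in
       ihom_comp V (tpow V x T) xk x \<cdot>\<^bsub>V\<^esub>
       (Idn V (IHom V (tpow V x S) x) \<boxtimes>\<^bsub>V\<^esub> ihom_map V (inv_arr V (chi V x T S \<sigma>)) (Idn V xk)) \<cdot>\<^bsub>V\<^esub>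
       (Idn V (IHom V (tpow V x S) x) \<boxtimes>\<^bsub>V\<^esub>
         ihom_tens V (map (tpow V x) (fibres T S \<sigma>)) (replicate (tips S) x)))\<rparr>"

end

theory Submission
  imports Defs
begin

text \<open>
  The tensor product is strictly associative and unital, so \<open>x\<^sup>T\<close> depends on the tree \<open>T\<close> only
  through its number of tips: the bracketing by canonical decompositions disappears and
  \<open>x\<^sup>T = x\<^sup>\<otimes>\<^sup>|\<^sup>T\<^sup>|\<close> (\<open>tpow_eq\<close>). The two \<open>n\<close>-operads therefore have the same objects and the
  same unit, and the isomorphism is the identity. What has to be shown is that their
  multiplications agree, and that they do form an \<open>n\<close>-operad.

  The multiplications differ only in the symmetry of \<open>x\<^sup>\<otimes>\<^sup>|\<^sup>T\<^sup>|\<close> that they use: the inverse of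
  \<open>\<chi>\<^sub>\<sigma>\<close> for \<open>End\<^sub>n(x)\<close>, and the symmetry of \<open>\<pi>(\<sigma>)\<close> for \<open>Des\<^sub>n(End(x))\<close>. Both regroup the tips of \<open>T\<close> by
  the fibres of \<open>\<sigma>\<close>. For \<open>\<pi>(\<sigma>)\<close> this is its defining property (\<open>perm_part_sorts\<close>); for \<open>\<chi>\<^sub>\<sigma>\<close> it is
  an induction along its recursive definition (\<open>chi_eq_reorder\<close>), in which each clause composes
  two regroupings into one. For these compositions a coherence theorem is needed, in the
  following form. For lists \<open>xs\<close> and \<open>ys\<close> of the same distinct labels there is a symmetry
  \<open>reorder\<close> from the tensor product in the order \<open>xs\<close> to the tensor product in the order \<open>ys\<close>;
  these symmetries compose as their sources and targets suggest (\<open>reorder_comp\<close>), are natural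
  (\<open>reorder_natural\<close>) and allow a label to be expanded into a block of labels (\<open>reorder_blocks\<close>).
  An equation between symmetries then reduces to an equation between two lists.

  The operad axioms do not involve trees any more, only the maps on tips: the common
  multiplication \<open>op_mul\<close> is defined for every function \<open>[p] \<rightarrow> [k]\<close>. By the universal property of
  the internal hom, associativity may be checked on adjuncts. There both sides first permute
  all homs and all copies of \<open>x\<close>, then evaluate the inner operations and finally the outer ones,
  and the two permutations have the same source and target (\<open>op_mul_assoc\<close>).
\<close>

section \<open>Calculus of arrows\<close>

context strict_closed_smc
begin

lemma homs_iff: "f \<in> homs V a b \<longleftrightarrow> f \<in> Arr V \<and> Dom V f = a \<and> Cod V f = b"
  by (simp add: homs_def)

lemmas obj_simps [simp] = Dom_closed Cod_closed Unit_closed TenO_closed TenO_assoc TenO_Unit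
  Unit_TenO IHom_closed

lemma Idn_simps [simp]:
  assumes "a \<in> Obj V"
  shows "Idn V a \<in> Arr V" "Dom V (Idn V a) = a" "Cod V (Idn V a) = a"
  using Idn_in[OF assms] by (auto simp: homs_iff)

lemma comp_simps [simp]:
  assumes "f \<in> Arr V" "g \<in> Arr V" "Dom V g = Cod V f"
  shows "g \<cdot> f \<in> Arr V" "Dom V (g \<cdot> f) = Dom V f" "Cod V (g \<cdot> f) = Cod V g"
  using Comp_in[of f "Dom V f" "Cod V f" g "Cod V g"] assms by (auto simp: homs_iff)

lemma ten_simps [simp]:
  assumes "f \<in> Arr V" "g \<in> Arr V"
  shows "f \<boxtimes> g \<in> Arr V" "Dom V (f \<boxtimes> g) = Dom V f \<otimes> Dom V g" "Cod V (f \<boxtimes> g) = Cod V f \<otimes> Cod V g"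
  using TenA_in[of f "Dom V f" "Cod V f" g "Dom V g" "Cod V g"] assms by (auto simp: homs_iff)

lemma Braid_simps [simp]:
  assumes "a \<in> Obj V" "b \<in> Obj V"
  shows "Braid V a b \<in> Arr V" "Dom V (Braid V a b) = a \<otimes> b" "Cod V (Braid V a b) = b \<otimes> a"
  using Braid_in[OF assms] by (auto simp: homs_iff)

lemma Ev_simps [simp]:
  assumes "a \<in> Obj V" "b \<in> Obj V"
  shows "Ev V a b \<in> Arr V" "Dom V (Ev V a b) = IHom V a b \<otimes> a" "Cod V (Ev V a b) = b"
  using Ev_in[OF assms] by (auto simp: homs_iff)

lemma comp_Idn [simp]: "\<lbrakk>f \<in> Arr V; Dom V f = a\<rbrakk> \<Longrightarrow> f \<cdot> Idn V a = f"
  using Comp_Idn[of f "Dom V f" "Cod V f"] by (auto simp: homs_iff)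

lemma Idn_comp [simp]: "\<lbrakk>f \<in> Arr V; Cod V f = a\<rbrakk> \<Longrightarrow> Idn V a \<cdot> f = f"
  using Idn_Comp[of f "Dom V f" "Cod V f"] by (auto simp: homs_iff)

lemma comp_assoc:
  assumes "f \<in> Arr V" "g \<in> Arr V" "h \<in> Arr V" "Dom V g = Cod V f" "Dom V h = Cod V g"
  shows "(h \<cdot> g) \<cdot> f = h \<cdot> (g \<cdot> f)"
  using Comp_assoc[of f "Dom V f" "Cod V f" g "Cod V g" h "Cod V h"] assms by (auto simp: homs_iff)

lemmas ten_assoc [simp] = TenA_assoc
lemmas ten_unit [simp] = TenA_Unit Unit_TenA
lemmas ten_Idn = TenA_Idn

lemma interchange:
  assumes "f \<in> Arr V" "g \<in> Arr V" "Dom V g = Cod V f"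
    "f' \<in> Arr V" "g' \<in> Arr V" "Dom V g' = Cod V f'"
  shows "(g \<boxtimes> g') \<cdot> (f \<boxtimes> f') = (g \<cdot> f) \<boxtimes> (g' \<cdot> f')"
  using TenA_Comp[of f "Dom V f" "Cod V f" g "Cod V g" f' "Dom V f'" "Cod V f'" g' "Cod V g'"] assms
  by (auto simp: homs_iff)

lemma whisker:
  assumes "f \<in> Arr V" "g \<in> Arr V" "Dom V g = Cod V f" "a \<in> Obj V"
  shows "Idn V a \<boxtimes> (g \<cdot> f) = (Idn V a \<boxtimes> g) \<cdot> (Idn V a \<boxtimes> f)"
    "(g \<cdot> f) \<boxtimes> Idn V a = (g \<boxtimes> Idn V a) \<cdot> (f \<boxtimes> Idn V a)"
  using assms by (simp_all add: interchange)

lemma braid_natural: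
  assumes "f \<in> Arr V" "g \<in> Arr V" "Cod V f = b" "Cod V g = d"
  shows "Braid V b d \<cdot> (f \<boxtimes> g) = (g \<boxtimes> f) \<cdot> Braid V (Dom V f) (Dom V g)"
  using Braid_natural[of f "Dom V f" b g "Dom V g" d] assms by (auto simp: homs_iff)

lemma braid_unit_right [simp]:
  assumes a: "a \<in> Obj V"
  shows "Braid V a (Unit V) = Idn V a"
proof -
  let ?b = "Braid V a (Unit V)"
  \<comment> \<open>By the hexagon for two unit objects this symmetry is idempotent; it is also invertible.\<close>
  have "?b = ?b \<cdot> ?b"
    using Braid_hexagon[of a "Unit V" "Unit V"] a by simp
  moreover have "Braid V (Unit V) a \<cdot> ?b = Idn V a"
    using Braid_symmetric[of a "Unit V"] a by simp
  ultimately show ?thesis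
    using comp_assoc[of ?b ?b "Braid V (Unit V) a"] a by simp
qed

lemma braid_unit_left [simp]:
  assumes a: "a \<in> Obj V"
  shows "Braid V (Unit V) a = Idn V a"
  using Braid_symmetric[of a "Unit V"] a by simp

lemma tensO_simps [simp]: "tensO V [] = Unit V" "tensO V (a # as) = a \<otimes> tensO V as"
  by (simp_all add: tensO_def)

lemma tensA_simps [simp]: "tensA V [] = Idn V (Unit V)" "tensA V (f # fs) = f \<boxtimes> tensA V fs"
  by (simp_all add: tensA_def)

lemma tensO_obj [simp]: "set as \<subseteq> Obj V \<Longrightarrow> tensO V as \<in> Obj V"
  by (induction as) auto

lemma tensO_append [simp]:
  "\<lbrakk>set as \<subseteq> Obj V; set bs \<subseteq> Obj V\<rbrakk> \<Longrightarrow> tensO V (as @ bs) = tensO V as \<otimes> tensO V bs"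
  by (induction as) auto

lemma tensA_arr [simp]:
  assumes "set fs \<subseteq> Arr V"
  shows "tensA V fs \<in> Arr V" "Dom V (tensA V fs) = tensO V (map (Dom V) fs)"
    "Cod V (tensA V fs) = tensO V (map (Cod V) fs)"
  using assms by (induction fs) auto

lemma tensA_append [simp]:
  "\<lbrakk>set fs \<subseteq> Arr V; set gs \<subseteq> Arr V\<rbrakk> \<Longrightarrow> tensA V (fs @ gs) = tensA V fs \<boxtimes> tensA V gs"
  by (induction fs) auto

lemma tensO_concat:
  "(\<And>i. i \<in> set xs \<Longrightarrow> set (f i) \<subseteq> Obj V) \<Longrightarrow>
    tensO V (concat (map f xs)) = tensO V (map (\<lambda>i. tensO V (f i)) xs)"
proof (induction xs)
  case (Cons a xs)
  then have "set (concat (map f xs)) \<subseteq> Obj V" by auto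
  with Cons show ?case by simp
qed auto

lemma tensA_concat:
  "(\<And>i. i \<in> set xs \<Longrightarrow> set (f i) \<subseteq> Arr V) \<Longrightarrow>
    tensA V (concat (map f xs)) = tensA V (map (\<lambda>i. tensA V (f i)) xs)"
proof (induction xs)
  case (Cons a xs)
  then have "set (concat (map f xs)) \<subseteq> Arr V" by auto
  with Cons show ?case by simp
qed auto

lemma tensA_map:
  assumes "\<And>i. i \<in> set xs \<Longrightarrow> F i \<in> Arr V \<and> Dom V (F i) = a i \<and> Cod V (F i) = b i"
  shows "tensA V (map F xs) \<in> Arr V" "Dom V (tensA V (map F xs)) = tensO V (map a xs)"
    "Cod V (tensA V (map F xs)) = tensO V (map b xs)"
  using assms by (induction xs) auto

lemma tensA_Idn: "(\<And>i. i \<in> set xs \<Longrightarrow> ob i \<in> Obj V) \<Longrightarrow>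
    tensA V (map (\<lambda>i. Idn V (ob i)) xs) = Idn V (tensO V (map ob xs))"
  by (induction xs) (auto simp: ten_Idn image_subset_iff)

lemma tensA_comp:
  "(\<And>i. i \<in> set xs \<Longrightarrow> f i \<in> Arr V \<and> g i \<in> Arr V \<and> Dom V (g i) = Cod V (f i)) \<Longrightarrow>
    tensA V (map g xs) \<cdot> tensA V (map f xs) = tensA V (map (\<lambda>i. g i \<cdot> f i) xs)"
proof (induction xs)
  case (Cons a xs)
  have *: "set (map f xs) \<subseteq> Arr V" "set (map g xs) \<subseteq> Arr V" using Cons.prems by auto
  have "map (Dom V) (map g xs) = map (Cod V) (map f xs)" using Cons.prems by auto
  then show ?case using Cons * by (simp add: interchange del: map_map)
qed auto

text \<open>
  The two sides are inverse to the two sides of the other hexagon.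
\<close>

lemma Braid_hexagon_left:
  assumes [simp]: "a \<in> Obj V" "b \<in> Obj V" "c \<in> Obj V"
  shows "Braid V (a \<otimes> b) c = (Braid V a c \<boxtimes> Idn V b) \<cdot> (Idn V a \<boxtimes> Braid V b c)"
proof -
  let ?s = "(Braid V a c \<boxtimes> Idn V b) \<cdot> (Idn V a \<boxtimes> Braid V b c)"
  let ?h = "Braid V c (a \<otimes> b)"
  have h: "?h = (Idn V a \<boxtimes> Braid V c b) \<cdot> (Braid V c a \<boxtimes> Idn V b)"
    by (simp add: Braid_hexagon)
  have i: "(Idn V a \<boxtimes> Braid V b c) \<cdot> (Idn V a \<boxtimes> Braid V c b) = Idn V (a \<otimes> c \<otimes> b)"
    by (simp add: interchange Braid_symmetric ten_Idn)
  have "?s \<cdot> ?h = (Braid V a c \<boxtimes> Idn V b) \<cdot>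
      (((Idn V a \<boxtimes> Braid V b c) \<cdot> (Idn V a \<boxtimes> Braid V c b)) \<cdot> (Braid V c a \<boxtimes> Idn V b))"
    by (simp add: h comp_assoc)
  also have "\<dots> = Idn V (c \<otimes> a \<otimes> b)"
    by (simp add: i interchange Braid_symmetric ten_Idn)
  finally have "?s \<cdot> (?h \<cdot> Braid V (a \<otimes> b) c) = Braid V (a \<otimes> b) c"
    by (simp add: comp_assoc[symmetric])
  then show ?thesis
    by (simp add: Braid_symmetric)
qed

end

section \<open>Coherence for symmetries\<close>

text \<open>
  The symmetry that takes the tensor product in the order \<open>xs\<close> to that in the order \<open>ys\<close>, by the
  insertion sort of \<open>sort_sym\<close>: the first label is moved into its place among the others, which
  have already been put into the target order. Giving the target order as a list, instead of by
  keys, makes source and target of the arrow explicit, so that composites can be formed without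
  computing with permutations.
\<close>

primrec reorder :: "('o, 'a) smc \<Rightarrow> ('i \<Rightarrow> 'o) \<Rightarrow> 'i list \<Rightarrow> 'i list \<Rightarrow> 'a" where
  "reorder V ob [] ys = Idn V (Unit V)"
| "reorder V ob (a # r) ys =
    (Braid V (ob a) (tensO V (map ob (takeWhile (\<lambda>j. j \<noteq> a) ys))) \<boxtimes>\<^bsub>V\<^esub>
      Idn V (tensO V (map ob (tl (dropWhile (\<lambda>j. j \<noteq> a) ys)))))
    \<cdot>\<^bsub>V\<^esub> (Idn V (ob a) \<boxtimes>\<^bsub>V\<^esub> reorder V ob r (remove1 a ys))"

definition reorderable :: "'i list \<Rightarrow> 'i list \<Rightarrow> bool" where
  "reorderable xs ys \<longleftrightarrow> distinct xs \<and> distinct ys \<and> set xs = set ys"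

lemma reorderable_Cons:
  assumes "reorderable (a # r) ys"
  obtains us vs where "ys = us @ a # vs" "a \<notin> set us" "a \<notin> set vs" "reorderable r (us @ vs)"
proof -
  from assms have "a \<in> set ys" by (auto simp: reorderable_def)
  then obtain us vs where "ys = us @ a # vs" by (meson split_list)
  with assms show thesis by (intro that[of us vs]) (auto simp: reorderable_def)
qed

lemma reorderable_iff_mset: "reorderable xs ys \<longleftrightarrow> distinct xs \<and> mset xs = mset ys"
  unfolding reorderable_def by (metis mset_eq_imp_distinct_iff mset_eq_setD set_eq_iff_mset_eq_distinct)

lemma reorderable_concat:
  assumes "\<And>i. i \<in> set is \<Longrightarrow> reorderable (f i) (g i)" "distinct (concat (map f is))"
  shows "reorderable (concat (map f is)) (concat (map g is))"
proof -
  have "mset (concat (map f is)) = mset (concat (map g is))"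
    using assms(1) by (induction "is") (auto simp: reorderable_iff_mset)
  then show ?thesis using assms(2) by (simp add: reorderable_iff_mset)
qed

lemma reorderable_blocks:
  assumes "reorderable xs ys" "distinct (concat (map blk xs))"
  shows "reorderable (concat (map blk xs)) (concat (map blk ys))"
proof -
  have "mset (concat (map blk zs)) = (\<Sum>z\<in>#mset zs. mset (blk z))" for zs
    by (induction zs) auto
  with assms show ?thesis by (simp add: reorderable_iff_mset)
qed

context strict_closed_smc
begin

lemma reorder_Cons:
  assumes "a \<notin> set us"
  shows "reorder V ob (a # r) (us @ a # vs) =
    (Braid V (ob a) (tensO V (map ob us)) \<boxtimes> Idn V (tensO V (map ob vs)))
    \<cdot> (Idn V (ob a) \<boxtimes> reorder V ob r (us @ vs))"
proof -
  have "takeWhile (\<lambda>j. j \<noteq> a) (us @ a # vs) = us" "dropWhile (\<lambda>j. j \<noteq> a) (us @ a # vs) = a # vs"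
    using assms by (induction us) auto
  then show ?thesis using assms by (simp add: remove1_append)
qed

declare reorder.simps(2) [simp del]

lemma reorder_arr:
  assumes "reorderable xs ys" "ob ` set xs \<subseteq> Obj V"
  shows "reorder V ob xs ys \<in> Arr V \<and> Dom V (reorder V ob xs ys) = tensO V (map ob xs) \<and>
    Cod V (reorder V ob xs ys) = tensO V (map ob ys)"
  using assms
proof (induction xs arbitrary: ys)
  case Nil
  then show ?case by (simp add: reorderable_def)
next
  case (Cons a r)
  from Cons.prems(1) obtain us vs where ys: "ys = us @ a # vs" "a \<notin> set us" "a \<notin> set vs"
    and r: "reorderable r (us @ vs)" by (rule reorderable_Cons)
  have "ob a \<in> Obj V" "set us \<union> set vs = set r"
    using Cons.prems(2) r by (simp, simp add: reorderable_def)
  then have [simp]: "ob a \<in> Obj V" "ob ` set us \<subseteq> Obj V" "ob ` set vs \<subseteq> Obj V"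
    using Cons.prems(2) by auto
  have "ob ` set r \<subseteq> Obj V" using Cons.prems by simp
  from Cons.IH[OF r this] show ?case
    by (simp add: ys reorder_Cons)
qed

lemma reorder_refl: "\<lbrakk>distinct xs; ob ` set xs \<subseteq> Obj V\<rbrakk> \<Longrightarrow>
    reorder V ob xs xs = Idn V (tensO V (map ob xs))"
proof (induction xs)
  case (Cons a r)
  then show ?case using reorder_Cons[of a "[]" ob r r] by (simp add: ten_Idn)
qed auto

text \<open>
  Here the target has \<open>b\<close> before \<open>a\<close>. The two sides insert \<open>a\<close> and \<open>b\<close> into the sorted rest in
  opposite orders; that this makes no difference is naturality of the symmetry of \<open>a\<close> with
  respect to the symmetry that moves \<open>b\<close>, together with the hexagon.
\<close>

lemma reorder_swap_crossed:
  assumes r: "reorderable (a # b # r) (us @ b # ms @ a # ws)"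
    and ob: "ob ` set (a # b # r) \<subseteq> Obj V"
  shows "reorder V ob (b # a # r) (us @ b # ms @ a # ws) \<cdot>
      (Braid V (ob a) (ob b) \<boxtimes> Idn V (tensO V (map ob r))) =
    reorder V ob (a # b # r) (us @ b # ms @ a # ws)"
proof -
  have d: "a \<notin> set (us @ b # ms)" "b \<notin> set us" "b \<notin> set (us @ ms)" "reorderable r (us @ ms @ ws)"
    using r by (auto simp: reorderable_def)
  define A B U M W R Q where "A = ob a" and "B = ob b" and "U = tensO V (map ob us)"
    and "M = tensO V (map ob ms)" and "W = tensO V (map ob ws)" and "R = tensO V (map ob r)"
    and "Q = reorder V ob r (us @ ms @ ws)"
  have sets: "ob ` set us \<subseteq> Obj V" "ob ` set ms \<subseteq> Obj V" "ob ` set ws \<subseteq> Obj V" "ob ` set r \<subseteq> Obj V"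
    using ob d by (auto simp: reorderable_def)
  then have [simp]: "A \<in> Obj V" "B \<in> Obj V" "U \<in> Obj V" "M \<in> Obj V" "W \<in> Obj V" "R \<in> Obj V"
    using ob by (auto simp: A_def B_def U_def M_def W_def R_def)
  have [simp]: "Q \<in> Arr V" "Dom V Q = R" "Cod V Q = U \<otimes> M \<otimes> W"
    using reorder_arr[OF d(4) sets(4)] sets by (auto simp: Q_def R_def U_def M_def W_def)
  have obs: "ob a \<in> Obj V" "ob b \<in> Obj V" using ob by auto
  have 1: "reorder V ob (a # b # r) (us @ b # ms @ a # ws) =
      (Braid V A (U \<otimes> B \<otimes> M) \<boxtimes> Idn V W) \<cdot> (Idn V A \<boxtimes> ((Braid V B U \<boxtimes> Idn V (M \<otimes> W)) \<cdot> (Idn V B \<boxtimes> Q)))"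
    using reorder_Cons[of a "us @ b # ms" ob "b # r" ws] reorder_Cons[of b us ob r "ms @ ws"] d sets obs
    by (simp add: A_def B_def U_def M_def W_def Q_def)
  have 2: "reorder V ob (b # a # r) (us @ b # ms @ a # ws) =
      (Braid V B U \<boxtimes> Idn V (M \<otimes> A \<otimes> W)) \<cdot> (Idn V B \<boxtimes> ((Braid V A (U \<otimes> M) \<boxtimes> Idn V W) \<cdot> (Idn V A \<boxtimes> Q)))"
    using reorder_Cons[of b us ob "a # r" "ms @ a # ws"] reorder_Cons[of a "us @ ms" ob r ws] d sets obs
    by (simp add: A_def B_def U_def M_def W_def Q_def)
  have 3: "(Braid V B U \<boxtimes> Idn V (M \<otimes> A)) \<cdot> (Idn V B \<boxtimes> Braid V A (U \<otimes> M)) \<cdot> (Braid V A B \<boxtimes> Idn V (U \<otimes> M)) =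
      Braid V A (U \<otimes> B \<otimes> M) \<cdot> (Idn V A \<boxtimes> Braid V B U \<boxtimes> Idn V M)"
    using braid_natural[of "Idn V A" "Braid V B U \<boxtimes> Idn V M" A "U \<otimes> B \<otimes> M"]
    by (simp add: ten_Idn Braid_hexagon[of A B "U \<otimes> M"])
  have Q: "(Idn V (B \<otimes> A) \<boxtimes> Q) \<cdot> (Braid V A B \<boxtimes> Idn V R) =
      (Braid V A B \<boxtimes> Idn V (U \<otimes> M \<otimes> W)) \<cdot> (Idn V (A \<otimes> B) \<boxtimes> Q)"
    by (simp add: interchange)
  have "reorder V ob (b # a # r) (us @ b # ms @ a # ws) \<cdot> (Braid V A B \<boxtimes> Idn V R) =
      ((Braid V B U \<boxtimes> Idn V (M \<otimes> A)) \<boxtimes> Idn V W) \<cdot> ((Idn V B \<boxtimes> Braid V A (U \<otimes> M)) \<boxtimes> Idn V W) \<cdot>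
        (Idn V (B \<otimes> A) \<boxtimes> Q) \<cdot> (Braid V A B \<boxtimes> Idn V R)"
    unfolding 2 by (simp add: comp_assoc ten_Idn[symmetric] whisker)
  also have "\<dots> = (((Braid V B U \<boxtimes> Idn V (M \<otimes> A)) \<cdot> (Idn V B \<boxtimes> Braid V A (U \<otimes> M)) \<cdot> (Braid V A B \<boxtimes> Idn V (U \<otimes> M)))
      \<boxtimes> Idn V W) \<cdot> (Idn V (A \<otimes> B) \<boxtimes> Q)"
    unfolding Q
    by (simp add: comp_assoc ten_Idn[symmetric] whisker)
  also have "\<dots> = reorder V ob (a # b # r) (us @ b # ms @ a # ws)"
    unfolding 1 3
    by (simp add: comp_assoc ten_Idn[symmetric] whisker)
  finally show ?thesis by (simp add: A_def B_def R_def)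
qed

text \<open>
  If the target has \<open>a\<close> before \<open>b\<close>, the previous lemma applies with \<open>a\<close> and \<open>b\<close> exchanged, and the
  symmetry of \<open>a\<close> and \<open>b\<close> can be inverted.
\<close>

lemma reorder_swap:
  assumes r: "reorderable (a # b # r) zs" and ob: "ob ` set (a # b # r) \<subseteq> Obj V"
  shows "reorder V ob (b # a # r) zs \<cdot> (Braid V (ob a) (ob b) \<boxtimes> Idn V (tensO V (map ob r))) =
    reorder V ob (a # b # r) zs"
proof -
  obtain us vs where zs: "zs = us @ a # vs" "a \<notin> set us" "reorderable (b # r) (us @ vs)"
    using r by (rule reorderable_Cons)
  have ab: "a \<noteq> b" "b \<in> set us \<or> b \<in> set vs"
    using zs r by (auto simp: reorderable_def)
  from ab(2) show ?thesis
  proof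
    assume "b \<in> set us"
    then obtain us' ms where "us = us' @ b # ms" by (meson split_list)
    then show ?thesis
      using reorder_swap_crossed[of a b r us' ms vs ob] r ob zs(1) by simp
  next
    assume "b \<in> set vs"
    then obtain ms ws where vs: "vs = ms @ b # ws" by (meson split_list)
    have [simp]: "ob a \<in> Obj V" "ob b \<in> Obj V" "tensO V (map ob r) \<in> Obj V"
      using ob by auto
    have r': "reorderable (b # a # r) zs" "ob ` set (b # a # r) \<subseteq> Obj V"
      using r ob by (auto simp: reorderable_def)
    have "reorder V ob (a # b # r) zs \<cdot> (Braid V (ob b) (ob a) \<boxtimes> Idn V (tensO V (map ob r))) =
        reorder V ob (b # a # r) zs"
      using reorder_swap_crossed[of b a r us ms ws ob] r' zs(1) vs by simp
    then have "reorder V ob (b # a # r) zs \<cdot> (Braid V (ob a) (ob b) \<boxtimes> Idn V (tensO V (map ob r))) =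
        reorder V ob (a # b # r) zs \<cdot> ((Braid V (ob b) (ob a) \<boxtimes> Idn V (tensO V (map ob r))) \<cdot>
          (Braid V (ob a) (ob b) \<boxtimes> Idn V (tensO V (map ob r))))"
      using reorder_arr[OF r ob] by (simp add: comp_assoc[symmetric])
    also have "\<dots> = reorder V ob (a # b # r) zs"
      using reorder_arr[OF r ob] by (simp add: interchange Braid_symmetric ten_Idn)
    finally show ?thesis .
  qed
qed

text \<open>
  By the hexagon, moving \<open>a\<close> past \<open>us\<close> is a succession of exchanges of neighbours.
\<close>

lemma reorder_move:
  assumes "reorderable (a # us @ vs) zs" "ob ` set (a # us @ vs) \<subseteq> Obj V"
  shows "reorder V ob (us @ a # vs) zs \<cdot>
      (Braid V (ob a) (tensO V (map ob us)) \<boxtimes> Idn V (tensO V (map ob vs))) =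
    reorder V ob (a # us @ vs) zs"
  using assms
proof (induction us arbitrary: zs)
  case Nil
  then show ?case using reorder_arr[OF Nil] by (simp add: ten_Idn)
next
  case (Cons u us)
  let ?T = "\<lambda>xs. tensO V (map ob xs)"
  have r: "reorderable (u # us @ a # vs) zs" "reorderable (u # a # us @ vs) zs"
    using Cons.prems(1) by (auto simp: reorderable_def)
  obtain bs cs where zs: "zs = bs @ u # cs" "u \<notin> set bs" "reorderable (us @ a # vs) (bs @ cs)"
    using r(1) by (rule reorderable_Cons)
  have r2: "reorderable (a # us @ vs) (bs @ cs)"
    using zs(3) by (auto simp: reorderable_def)
  have bc: "set (bs @ cs) = set (us @ a # vs)"
    using zs(3) by (auto simp: reorderable_def)
  have ob: "ob ` set (us @ a # vs) \<subseteq> Obj V" "ob ` set (a # us @ vs) \<subseteq> Obj V"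
    and [simp]: "ob u \<in> Obj V" "ob a \<in> Obj V"
    "ob ` set us \<subseteq> Obj V" "ob ` set vs \<subseteq> Obj V"
    using Cons.prems(2) by auto
  have "ob ` set (bs @ cs) \<subseteq> Obj V"
    using bc ob by simp
  then have [simp]: "ob ` set bs \<subseteq> Obj V" "ob ` set cs \<subseteq> Obj V"
    by (auto simp: image_Un)
  note arr [simp] = reorder_arr[OF zs(3) ob(1), THEN conjunct1]
    reorder_arr[OF zs(3) ob(1), THEN conjunct2, THEN conjunct1]
    reorder_arr[OF zs(3) ob(1), THEN conjunct2, THEN conjunct2]
  let ?B = "Braid V (ob u) (?T bs) \<boxtimes> Idn V (?T cs)"
  have "reorder V ob ((u # us) @ a # vs) zs \<cdot> (Braid V (ob a) (?T (u # us)) \<boxtimes> Idn V (?T vs)) =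
      ?B \<cdot> (Idn V (ob u) \<boxtimes> (reorder V ob (us @ a # vs) (bs @ cs) \<cdot>
        (Braid V (ob a) (?T us) \<boxtimes> Idn V (?T vs)))) \<cdot> (Braid V (ob a) (ob u) \<boxtimes> Idn V (?T (us @ vs)))"
    using zs(1,2)
    by (simp add: reorder_Cons comp_assoc whisker Braid_hexagon ten_Idn[symmetric])
  also have "\<dots> = reorder V ob (u # a # us @ vs) zs \<cdot> (Braid V (ob a) (ob u) \<boxtimes> Idn V (?T (us @ vs)))"
    using zs(1,2) reorder_arr[OF r2 ob(2)]
    by (subst Cons.IH[OF r2 ob(2)]) (simp add: reorder_Cons comp_assoc)
  also have "\<dots> = reorder V ob (a # u # us @ vs) zs"
    using Cons.prems by (intro reorder_swap) auto
  finally show ?case by simp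
qed

text \<open>
  This is the coherence theorem. The symmetry to \<open>ys\<close> ends by inserting the first label \<open>a\<close>; by
  \<open>reorder_move\<close> this insertion is absorbed when the symmetry to \<open>zs\<close> is formed with \<open>a\<close> in front,
  so that both symmetries insert \<open>a\<close> last and the induction hypothesis applies to the rest.
\<close>

lemma reorder_comp:
  assumes "reorderable xs ys" "reorderable ys zs" "ob ` set xs \<subseteq> Obj V"
  shows "reorder V ob ys zs \<cdot> reorder V ob xs ys = reorder V ob xs zs"
  using assms
proof (induction xs arbitrary: ys zs)
  case Nil
  then have "ys = []" "zs = []" by (auto simp: reorderable_def)
  then show ?case by simp
next
  case (Cons a r)
  let ?T = "\<lambda>xs. tensO V (map ob xs)"
  obtain us vs where ys: "ys = us @ a # vs" "a \<notin> set us" "reorderable r (us @ vs)"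
    using Cons.prems(1) by (rule reorderable_Cons)
  have r: "reorderable (a # us @ vs) zs" "reorderable (a # r) zs"
    using Cons.prems(1,2) ys by (auto simp: reorderable_def)
  obtain bs cs where zs: "zs = bs @ a # cs" "a \<notin> set bs" "reorderable (us @ vs) (bs @ cs)"
    using r(1) by (rule reorderable_Cons)
  have uv: "set us \<union> set vs = set r" "set bs \<union> set cs = set r"
    using ys zs by (auto simp: reorderable_def)
  have ob': "ob ` set r \<subseteq> Obj V" "ob ` set (us @ vs) \<subseteq> Obj V"
    using Cons.prems(3) uv by (auto simp del: Un_iff)
  have "ob ` (set us \<union> set vs) \<subseteq> Obj V" "ob ` (set bs \<union> set cs) \<subseteq> Obj V"
    using Cons.prems(3) uv by auto
  then have [simp]: "ob a \<in> Obj V" "ob ` set us \<subseteq> Obj V" "ob ` set vs \<subseteq> Obj V"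
    "ob ` set bs \<subseteq> Obj V" "ob ` set cs \<subseteq> Obj V"
    using Cons.prems(3) by (auto simp: image_Un)
  have ob: "ob ` set (a # us @ vs) \<subseteq> Obj V" by (simp add: image_Un)
  have rys: "reorderable ys zs" "ob ` set ys \<subseteq> Obj V"
    using Cons.prems ys by (auto simp: image_Un)
  have IH: "reorder V ob (us @ vs) (bs @ cs) \<cdot> reorder V ob r (us @ vs) = reorder V ob r (bs @ cs)"
    using Cons.IH ys(3) zs(3) ob'(1) by blast
  have "reorder V ob ys zs \<cdot> reorder V ob (a # r) ys =
      (reorder V ob ys zs \<cdot> (Braid V (ob a) (?T us) \<boxtimes> Idn V (?T vs))) \<cdot>
        (Idn V (ob a) \<boxtimes> reorder V ob r (us @ vs))"
    using reorder_arr[OF rys] reorder_arr[OF ys(3) ob'(1)] ys(1,2)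
    by (simp add: reorder_Cons comp_assoc)
  also have "\<dots> = reorder V ob (a # us @ vs) zs \<cdot> (Idn V (ob a) \<boxtimes> reorder V ob r (us @ vs))"
    using reorder_move[OF r(1) ob] ys(1) by simp
  also have "\<dots> = (Braid V (ob a) (?T bs) \<boxtimes> Idn V (?T cs)) \<cdot> (Idn V (ob a) \<boxtimes>
      (reorder V ob (us @ vs) (bs @ cs) \<cdot> reorder V ob r (us @ vs)))"
    using reorder_arr[OF zs(3) ob'(2)] reorder_arr[OF ys(3) ob'(1)] zs(1,2)
    by (simp add: reorder_Cons comp_assoc whisker)
  also have "\<dots> = reorder V ob (a # r) zs"
    unfolding IH using zs(1,2) by (simp add: reorder_Cons)
  finally show ?case .
qed

lemma reorder_append:
  assumes "reorderable xs ys" "reorderable xs' ys'" "ob ` set (xs @ xs') \<subseteq> Obj V"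
    "set xs \<inter> set xs' = {}"
  shows "reorder V ob (xs @ xs') (ys @ ys') = reorder V ob xs ys \<boxtimes> reorder V ob xs' ys'"
  using assms
proof (induction xs arbitrary: ys)
  case Nil
  then show ?case using reorder_arr[of xs' ys' ob] by (simp add: reorderable_def)
next
  case (Cons a r)
  let ?T = "\<lambda>xs. tensO V (map ob xs)"
  obtain us vs where ys: "ys = us @ a # vs" "a \<notin> set us" "reorderable r (us @ vs)"
    using Cons.prems(1) by (rule reorderable_Cons)
  have uv: "set us \<union> set vs = set r" "set ys' = set xs'"
    using ys Cons.prems(2) by (auto simp: reorderable_def)
  have "ob ` (set us \<union> set vs) \<subseteq> Obj V"
    using Cons.prems(3) uv by auto
  then have [simp]: "ob a \<in> Obj V" "ob ` set us \<subseteq> Obj V" "ob ` set vs \<subseteq> Obj V"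
    "ob ` set ys' \<subseteq> Obj V"
    using Cons.prems(3) uv(2) by (auto simp: image_Un)
  have ob: "ob ` set r \<subseteq> Obj V" "ob ` set xs' \<subseteq> Obj V" "ob ` set (r @ xs') \<subseteq> Obj V"
    using Cons.prems(3) by (auto simp: image_Un)
  have IH: "reorder V ob (r @ xs') ((us @ vs) @ ys') = reorder V ob r (us @ vs) \<boxtimes> reorder V ob xs' ys'"
    using Cons.prems by (intro Cons.IH ys(3) ob) auto
  have "reorder V ob ((a # r) @ xs') (ys @ ys') =
      (Braid V (ob a) (?T us) \<boxtimes> Idn V (?T vs \<otimes> ?T ys')) \<cdot>
      (Idn V (ob a) \<boxtimes> reorder V ob r (us @ vs) \<boxtimes> reorder V ob xs' ys')"
    using IH ys(1,2) by (simp add: reorder_Cons)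
  also have "\<dots> = ((Braid V (ob a) (?T us) \<boxtimes> Idn V (?T vs)) \<boxtimes> Idn V (?T ys')) \<cdot>
      ((Idn V (ob a) \<boxtimes> reorder V ob r (us @ vs)) \<boxtimes> reorder V ob xs' ys')"
    using reorder_arr[OF ys(3) ob(1)] reorder_arr[OF Cons.prems(2) ob(2)]
    by (simp add: ten_Idn)
  also have "\<dots> = reorder V ob (a # r) ys \<boxtimes> reorder V ob xs' ys'"
    using reorder_arr[OF ys(3) ob(1)] reorder_arr[OF Cons.prems(2) ob(2)] ys(1,2)
    by (subst interchange) (simp_all add: reorder_Cons)
  finally show ?case .
qed

lemma reorder_concat:
  assumes "\<And>i. i \<in> set is \<Longrightarrow> reorderable (f i) (g i)" "distinct (concat (map f is))"
    "ob ` set (concat (map f is)) \<subseteq> Obj V"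
  shows "reorder V ob (concat (map f is)) (concat (map g is)) =
    tensA V (map (\<lambda>i. reorder V ob (f i) (g i)) is)"
  using assms
proof (induction "is")
  case (Cons i "is")
  have "reorderable (concat (map f is)) (concat (map g is))"
    using Cons.prems by (intro reorderable_concat) auto
  then have "reorder V ob (f i @ concat (map f is)) (g i @ concat (map g is)) =
      reorder V ob (f i) (g i) \<boxtimes> reorder V ob (concat (map f is)) (concat (map g is))"
    using Cons.prems by (intro reorder_append) auto
  with Cons show ?case by (simp add: image_Un)
qed auto

lemma reorder_natural:
  assumes "reorderable xs ys"
    and "\<And>i. i \<in> set xs \<Longrightarrow> F i \<in> Arr V \<and> Dom V (F i) = ob i \<and> Cod V (F i) = ob' i"
  shows "reorder V ob' xs ys \<cdot> tensA V (map F xs) = tensA V (map F ys) \<cdot> reorder V ob xs ys"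
  using assms
proof (induction xs arbitrary: ys)
  case Nil
  then show ?case by (auto simp: reorderable_def)
next
  case (Cons a r)
  let ?T = "\<lambda>ob xs. tensO V (map ob xs)"
  obtain us vs where ys: "ys = us @ a # vs" "a \<notin> set us" "reorderable r (us @ vs)"
    using Cons.prems(1) by (rule reorderable_Cons)
  have F: "F i \<in> Arr V" "Dom V (F i) = ob i" "Cod V (F i) = ob' i" "ob i \<in> Obj V" "ob' i \<in> Obj V"
    if "i \<in> {a} \<union> set r \<union> set us \<union> set vs" for i
  proof -
    have "i \<in> set (a # r)" using that ys(3) by (auto simp: reorderable_def)
    with Cons.prems(2)[of i] show "F i \<in> Arr V" "Dom V (F i) = ob i" "Cod V (F i) = ob' i"
      "ob i \<in> Obj V" "ob' i \<in> Obj V"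
      using Dom_closed[of "F i"] Cod_closed[of "F i"] by auto
  qed
  then have [simp]: "ob ` set us \<subseteq> Obj V" "ob ` set vs \<subseteq> Obj V" "F ` set us \<subseteq> Arr V" "F ` set vs \<subseteq> Arr V"
    "ob' ` set us \<subseteq> Obj V" "ob' ` set vs \<subseteq> Obj V" "F ` set r \<subseteq> Arr V"
    "ob a \<in> Obj V" "ob' a \<in> Obj V" "F a \<in> Arr V" "Dom V (F a) = ob a" "Cod V (F a) = ob' a"
    by auto
  have ob: "ob ` set r \<subseteq> Obj V" "ob' ` set r \<subseteq> Obj V"
    using F by auto
  have m: "map (Dom V \<circ> F) us = map ob us" "map (Dom V \<circ> F) vs = map ob vs"
    "map (Cod V \<circ> F) us = map ob' us" "map (Cod V \<circ> F) vs = map ob' vs"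
    "map (Dom V \<circ> F) r = map ob r" "map (Cod V \<circ> F) r = map ob' r"
    using F by auto
  let ?U = "tensA V (map F us)" and ?W = "tensA V (map F vs)" and ?R = "tensA V (map F r)"
  have [simp]: "Dom V ?U = ?T ob us" "Dom V ?W = ?T ob vs" "Cod V ?U = ?T ob' us" "Cod V ?W = ?T ob' vs"
    "Dom V ?R = ?T ob r" "Cod V ?R = ?T ob' r"
    by (simp_all add: m)
  note ra = reorder_arr[OF ys(3) ob(1)] reorder_arr[OF ys(3) ob(2)]
  have IH: "reorder V ob' r (us @ vs) \<cdot> ?R = (?U \<boxtimes> ?W) \<cdot> reorder V ob r (us @ vs)"
    using Cons.IH[OF ys(3)] Cons.prems(2) by simp
  have "reorder V ob' (a # r) ys \<cdot> (F a \<boxtimes> ?R) =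
      (Braid V (ob' a) (?T ob' us) \<boxtimes> Idn V (?T ob' vs)) \<cdot>
        (Idn V (ob' a) \<boxtimes> reorder V ob' r (us @ vs)) \<cdot> (F a \<boxtimes> ?R)"
    using ra ys(1,2) by (simp add: reorder_Cons comp_assoc)
  also have "(Idn V (ob' a) \<boxtimes> reorder V ob' r (us @ vs)) \<cdot> (F a \<boxtimes> ?R) =
      ((F a \<boxtimes> ?U) \<boxtimes> ?W) \<cdot> (Idn V (ob a) \<boxtimes> reorder V ob r (us @ vs))"
    using ra IH by (simp add: interchange)
  also have "(Braid V (ob' a) (?T ob' us) \<boxtimes> Idn V (?T ob' vs)) \<cdot> \<dots> =
      ((Braid V (ob' a) (?T ob' us) \<cdot> (F a \<boxtimes> ?U)) \<boxtimes> ?W) \<cdot> (Idn V (ob a) \<boxtimes> reorder V ob r (us @ vs))"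
    using ra by (simp add: comp_assoc[symmetric] interchange del: ten_assoc)
  also have "Braid V (ob' a) (?T ob' us) \<cdot> (F a \<boxtimes> ?U) = (?U \<boxtimes> F a) \<cdot> Braid V (ob a) (?T ob us)"
    by (subst braid_natural) simp_all
  also have "(((?U \<boxtimes> F a) \<cdot> Braid V (ob a) (?T ob us)) \<boxtimes> ?W) =
      (?U \<boxtimes> F a \<boxtimes> ?W) \<cdot> (Braid V (ob a) (?T ob us) \<boxtimes> Idn V (?T ob vs))"
    using interchange[of "Braid V (ob a) (?T ob us)" "?U \<boxtimes> F a" "Idn V (?T ob vs)" ?W] by simp
  also have "\<dots> \<cdot> (Idn V (ob a) \<boxtimes> reorder V ob r (us @ vs)) =
      (?U \<boxtimes> F a \<boxtimes> ?W) \<cdot> reorder V ob (a # r) ys"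
    using ra ys(1,2) by (simp add: reorder_Cons comp_assoc)
  finally show ?case using ys(1) by simp
qed

lemma reorder_braid:
  assumes "distinct (xs @ us)" "ob ` set (xs @ us) \<subseteq> Obj V"
  shows "reorder V ob (xs @ us) (us @ xs) = Braid V (tensO V (map ob xs)) (tensO V (map ob us))"
  using assms
proof (induction xs)
  case Nil
  then show ?case by (simp add: reorder_refl)
next
  case (Cons a xs)
  then have [simp]: "ob a \<in> Obj V" "ob ` set xs \<subseteq> Obj V" "ob ` set us \<subseteq> Obj V" by auto
  have "reorder V ob (xs @ us) (us @ xs) = Braid V (tensO V (map ob xs)) (tensO V (map ob us))"
    using Cons by auto
  then show ?case
    using Cons.prems reorder_Cons[of a us ob "xs @ us" xs] by (simp add: Braid_hexagon_left)
qed

text \<open>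
  A label may stand for a whole block of labels. Together with \<open>reorder_comp\<close>, this turns symmetries
  between tensor products of composite objects into symmetries of their elementary factors.
\<close>

lemma reorder_blocks:
  assumes "reorderable xs ys" "distinct (concat (map blk xs))"
    "ob' ` set (concat (map blk xs)) \<subseteq> Obj V"
    "\<And>i. i \<in> set xs \<Longrightarrow> ob i = tensO V (map ob' (blk i))"
  shows "reorder V ob xs ys = reorder V ob' (concat (map blk xs)) (concat (map blk ys))"
  using assms
proof (induction xs arbitrary: ys)
  case Nil
  then show ?case by (auto simp: reorderable_def)
next
  case (Cons a r)
  let ?T = "\<lambda>xs. tensO V (map ob' xs)"
  obtain us vs where ys: "ys = us @ a # vs" "a \<notin> set us" "reorderable r (us @ vs)"
    using Cons.prems(1) by (rule reorderable_Cons)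
  define A R U W where "A = blk a" and "R = concat (map blk r)"
    and "U = concat (map blk us)" and "W = concat (map blk vs)"
  have d: "distinct (A @ R)" "ob' ` set (A @ R) \<subseteq> Obj V"
    using Cons.prems by (auto simp: A_def R_def)
  have RUW: "reorderable R (U @ W)"
    using reorderable_blocks[OF ys(3), of blk] d by (simp add: R_def U_def W_def)
  then have sets: "set R = set U \<union> set W" "distinct (U @ W)" "distinct R"
    by (auto simp: reorderable_def)
  have "ob' ` (set U \<union> set W) \<subseteq> Obj V"
    using d(2) by (auto simp flip: sets(1))
  then have [simp]: "ob' ` set U \<subseteq> Obj V" "ob' ` set W \<subseteq> Obj V" "ob' ` set A \<subseteq> Obj V"
    using d(2) by auto
  have ob: "ob i = ?T (blk i)" if "i \<in> {a} \<union> set r \<union> set us \<union> set vs" for i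
    using that Cons.prems(4) ys(3) by (auto simp: reorderable_def)
  have blkob: "set (map ob' (blk i)) \<subseteq> Obj V" if "i \<in> {a} \<union> set r \<union> set us \<union> set vs" for i
    using that Cons.prems(3) ys(3) by (auto simp: reorderable_def)
  have T: "tensO V (map ob zs) = ?T (concat (map blk zs))"
    if "set zs \<subseteq> {a} \<union> set r \<union> set us \<union> set vs" for zs
  proof -
    have "tensO V (map ob zs) = tensO V (map (\<lambda>i. tensO V (map ob' (blk i))) zs)"
      using that ob by (intro arg_cong[where f = "tensO V"]) auto
    also have "\<dots> = tensO V (concat (map (\<lambda>i. map ob' (blk i)) zs))"
      using that blkob by (subst tensO_concat) auto
    finally show ?thesis by (simp add: map_concat comp_def)
  qed
  have uvs: "set us \<subseteq> {a} \<union> set r \<union> set us \<union> set vs" "set vs \<subseteq> {a} \<union> set r \<union> set us \<union> set vs"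
    by auto
  have IH: "reorder V ob r (us @ vs) = reorder V ob' R (U @ W)"
    unfolding R_def U_def W_def using Cons.prems ys(3) by (subst Cons.IH) auto
  have 1: "reorderable (A @ R) (A @ U @ W)" "reorderable (A @ U @ W) (U @ A @ W)"
    "reorderable A A" "reorderable (A @ U) (U @ A)" "reorderable W W" "distinct (A @ U)"
    using d sets by (auto simp: reorderable_def)
  have "reorder V ob' (A @ R) (U @ A @ W) =
      reorder V ob' ((A @ U) @ W) ((U @ A) @ W) \<cdot> reorder V ob' (A @ R) (A @ U @ W)"
    using reorder_comp[OF 1(1,2) d(2)] by simp
  also have "reorder V ob' (A @ R) (A @ U @ W) = Idn V (?T A) \<boxtimes> reorder V ob' R (U @ W)"
    using d 1 by (subst reorder_append[OF _ RUW]) (auto simp: reorder_refl)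
  also have "reorder V ob' ((A @ U) @ W) ((U @ A) @ W) = Braid V (?T A) (?T U) \<boxtimes> Idn V (?T W)"
    using d 1 sets
    by (subst reorder_append) (auto simp: reorder_refl reorder_braid image_Un)
  also have "(Braid V (?T A) (?T U) \<boxtimes> Idn V (?T W)) \<cdot> (Idn V (?T A) \<boxtimes> reorder V ob' R (U @ W)) =
      reorder V ob (a # r) ys"
    using ys ob[of a] T[OF uvs(1)] T[OF uvs(2)] IH
    by (simp add: reorder_Cons A_def U_def W_def)
  finally show ?case
    by (simp add: A_def R_def U_def W_def ys(1))
qed

text \<open>
  The case of blocks of length one.
\<close>

lemma reorder_relabel:
  assumes r: "reorderable xs ys" and inj: "inj_on h (set xs)" and ob: "ob ` h ` set xs \<subseteq> Obj V"
    and eq: "\<And>i. i \<in> set xs \<Longrightarrow> ob' i = ob (h i)"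
  shows "reorder V ob (map h xs) (map h ys) = reorder V ob' xs ys"
proof -
  have [simp]: "concat (map (\<lambda>i. [h i]) zs) = map h zs" for zs
    by (induction zs) auto
  have "distinct (map h xs)"
    using r inj by (simp add: reorderable_def distinct_map)
  moreover have "ob' i = tensO V (map ob [h i])" if "i \<in> set xs" for i
  proof -
    have "ob (h i) \<in> Obj V" using ob that by blast
    then show ?thesis using eq[OF that] by simp
  qed
  ultimately show ?thesis
    using reorder_blocks[OF r, of "\<lambda>i. [h i]" ob ob'] ob by (simp del: map_eq_conv)
qed

text \<open>
  \<open>sort_sym\<close> splits the sorted rest by keys, \<open>reorder\<close> by position in the target; for the stably
  sorted target the two splittings coincide.
\<close>

lemma sort_sym_eq_reorder:
  assumes "distinct xs"
  shows "sort_sym V (map (\<lambda>i. (\<kappa> i, ob i)) xs) = reorder V ob xs (sort_key \<kappa> xs)"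
  using assms
proof (induction xs)
  case (Cons a r)
  let ?s = "sort_key \<kappa> r"
  let ?u = "filter (\<lambda>i. \<kappa> i < \<kappa> a) ?s" and ?v = "filter (\<lambda>i. \<not> \<kappa> i < \<kappa> a) ?s"
  have ins: "insort_key \<kappa> a zs = filter (\<lambda>i. \<kappa> i < \<kappa> a) zs @ a # filter (\<lambda>i. \<not> \<kappa> i < \<kappa> a) zs"
    and cat: "filter (\<lambda>i. \<kappa> i < \<kappa> a) zs @ filter (\<lambda>i. \<not> \<kappa> i < \<kappa> a) zs = zs"
    if "sorted (map \<kappa> zs)" for zs
  proof -
    have "insort_key \<kappa> a zs = filter (\<lambda>i. \<kappa> i < \<kappa> a) zs @ a # filter (\<lambda>i. \<not> \<kappa> i < \<kappa> a) zs \<and>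
        filter (\<lambda>i. \<kappa> i < \<kappa> a) zs @ filter (\<lambda>i. \<not> \<kappa> i < \<kappa> a) zs = zs"
      using that
    proof (induction zs)
      case (Cons z zs)
      have "filter (\<lambda>i. \<kappa> i < \<kappa> a) zs = []" "filter (\<lambda>i. \<not> \<kappa> i < \<kappa> a) zs = zs"
        if "\<kappa> a \<le> \<kappa> z"
        using that Cons.prems by (auto simp: filter_empty_conv filter_id_conv)
      with Cons show ?case by auto
    qed simp
    then show "insort_key \<kappa> a zs = filter (\<lambda>i. \<kappa> i < \<kappa> a) zs @ a # filter (\<lambda>i. \<not> \<kappa> i < \<kappa> a) zs"
      "filter (\<lambda>i. \<kappa> i < \<kappa> a) zs @ filter (\<lambda>i. \<not> \<kappa> i < \<kappa> a) zs = zs"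
      by blast+
  qed
  have "insort_key fst (\<kappa> a, ob a) (map (\<lambda>i. (\<kappa> i, ob i)) zs) =
      map (\<lambda>i. (\<kappa> i, ob i)) (insort_key \<kappa> a zs)" for a zs
    by (induction zs) auto
  then have sk: "sort_key fst (map (\<lambda>i. (\<kappa> i, ob i)) zs) = map (\<lambda>i. (\<kappa> i, ob i)) (sort_key \<kappa> zs)" for zs
    by (induction zs) auto
  have "reorder V ob (a # r) (?u @ a # ?v) = (Braid V (ob a) (tensO V (map ob ?u)) \<boxtimes> Idn V (tensO V (map ob ?v)))
    \<cdot> (Idn V (ob a) \<boxtimes> reorder V ob r ?s)"
    using Cons.prems by (subst reorder_Cons) (auto simp: cat)
  then show ?case
    using Cons by (simp add: ins sk filter_map comp_def)
qed simp

end

section \<open>Functions between finite ordinals and their fibres\<close>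

text \<open>
  For the list \<open>s\<close> of values of a function \<open>[p] \<rightarrow> [k]\<close>, \<open>fib s i\<close> is its fibre over \<open>i\<close> in increasing
  order, and \<open>grp s k\<close> is the domain listed fibre by fibre, which is the order produced by
  the permutation \<open>\<pi>(s)\<close>.
\<close>

definition fib :: "nat list \<Rightarrow> nat \<Rightarrow> nat list" where
  "fib s i = filter (\<lambda>v. s ! v = i) [0..<length s]"

abbreviation arity :: "nat list \<Rightarrow> nat \<Rightarrow> nat" where
  "arity s i \<equiv> length (fib s i)"

definition grp :: "nat list \<Rightarrow> nat \<Rightarrow> nat list" where
  "grp s k = concat (map (fib s) [0..<k])"

lemma filter_eq_upt: "filter (\<lambda>j. j = i) [0..<k] = (if i < k then [i] else [])"
  by (induction k) auto

lemma sort_key_by_value: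
  fixes \<kappa> :: "'i \<Rightarrow> nat"
  assumes "\<And>z. z \<in> set xs \<Longrightarrow> \<kappa> z < k"
  shows "sort_key \<kappa> xs = concat (map (\<lambda>c. filter (\<lambda>z. \<kappa> z = c) xs) [0..<k])"
proof (rule properties_for_sort_key)
  let ?g = "\<lambda>k. concat (map (\<lambda>c. filter (\<lambda>z. \<kappa> z = c) xs) [0..<k])"
  have "mset (?g k) = filter_mset (\<lambda>z. \<kappa> z < k) (mset xs)" for k
    by (induction k) (auto simp: less_Suc_eq filter_mset_eq_conv multiset_eq_iff)
  also have "filter_mset (\<lambda>z. \<kappa> z < k) (mset xs) = mset xs"
    using assms by (simp add: filter_mset_eq_conv)
  finally show "mset (?g k) = mset xs" .
  have "sorted (map \<kappa> (filter (\<lambda>z. \<kappa> z = c) xs))" for c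
    by (induction xs) auto
  then show "sorted (map \<kappa> (?g k))"
    by (induction k) (auto simp: sorted_append)
  fix a assume "a \<in> set (?g k)"
  then have "\<kappa> a < k" using assms by auto
  moreover have "filter (\<lambda>x. \<kappa> a = \<kappa> x) (?g k) = (if \<kappa> a < k then filter (\<lambda>x. \<kappa> a = \<kappa> x) xs else [])" for k
  proof (induction k)
    case (Suc k)
    have "filter (\<lambda>x. \<kappa> a = \<kappa> x) (filter (\<lambda>z. \<kappa> z = k) xs) =
        (if \<kappa> a = k then filter (\<lambda>x. \<kappa> a = \<kappa> x) xs else [])"
      by (auto simp: filter_empty_conv intro: filter_cong)
    with Suc show ?case by auto
  qed simp
  ultimately show "filter (\<lambda>x. \<kappa> a = \<kappa> x) (?g k) = filter (\<lambda>x. \<kappa> a = \<kappa> x) xs" by simp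
qed

lemma grp_eq_sort_key:
  assumes "set s \<subseteq> {..<k}"
  shows "grp s k = sort_key ((!) s) [0..<length s]"
proof -
  have "s ! z < k" if "z \<in> set [0..<length s]" for z
    using that assms nth_mem[of z s] by (auto simp del: nth_mem)
  from sort_key_by_value[of "[0..<length s]" "(!) s" k, OF this] show ?thesis
    by (simp add: grp_def fib_def[abs_def])
qed

lemma sort_key_stable_id: "sorted (map \<kappa> xs) \<Longrightarrow> sort_key \<kappa> xs = xs"
  by (rule properties_for_sort_key) auto

lemma grp_of_sorted: "\<lbrakk>sorted s; set s \<subseteq> {..<k}\<rbrakk> \<Longrightarrow> grp s k = [0..<length s]"
  by (simp add: grp_eq_sort_key sort_key_stable_id map_nth)

lemma fib_simps [simp]:
  "set (fib s i) = {v. v < length s \<and> s ! v = i}" "distinct (fib s i)" "sorted_wrt (<) (fib s i)"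
  by (auto simp: fib_def sorted_wrt_filter)

lemma grp_simps:
  assumes "set s \<subseteq> {..<k}"
  shows "set (grp s k) = {..<length s}" "distinct (grp s k)" "length (grp s k) = length s"
  using assms by (auto simp: grp_eq_sort_key)

lemma sum_length_fib:
  assumes "set s \<subseteq> {..<k}"
  shows "sum_list (map (\<lambda>i. arity s i) [0..<k]) = length s"
  using grp_simps(3)[OF assms] by (simp add: grp_def length_concat comp_def)

lemma pos_nth:
  assumes "sorted_wrt (<) A" "j < length A"
  shows "pos A (A ! j) = j"
proof -
  have "A ! i < A ! j \<longleftrightarrow> i < j" if "i < length A" for i
    using assms that sorted_wrt_nth_less[OF assms(1)] by (metis linorder_neqE_nat order_less_asym)
  then have "{i. i < length A \<and> A ! i < A ! j} = {..<j}"
    using assms(2) by auto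
  then show ?thesis by (simp add: pos_def length_filter_conv_card)
qed

lemma pos_mem:
  assumes "sorted_wrt (<) A" "v \<in> set A"
  shows "pos A v < length A" "A ! pos A v = v"
  using assms pos_nth by (metis in_set_conv_nth)+

lemma pos_mono: "v \<le> w \<Longrightarrow> pos A v \<le> pos A w"
  unfolding pos_def by (induction A) auto

lemma pos_eq_iff: "\<lbrakk>sorted_wrt (<) A; v \<in> set A; w \<in> set A\<rbrakk> \<Longrightarrow> pos A v = pos A w \<longleftrightarrow> v = w"
  by (metis pos_mem(2))

lemma pos_upt: "v < k \<Longrightarrow> pos [0..<k] v = v"
  using pos_nth[of "[0..<k]" v] by simp

section \<open>Subtrees and fibres\<close>

text \<open>
  A subtree is given by increasing lists of vertices, one for each level, closed under passing to
  the parent. Fibres of a morphism, and in particular canonical factors, are subtrees; so it is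
  enough to check once that renumbering the vertices by position gives a tree, and that a morphism
  restricted to subtrees is a morphism.
\<close>

definition sub_levels :: "tree \<Rightarrow> (nat \<Rightarrow> nat list) \<Rightarrow> bool" where
  "sub_levels T A \<longleftrightarrow> A 0 = [0] \<and>
    (\<forall>m\<le>length T. sorted_wrt (<) (A m) \<and> set (A m) \<subseteq> {..<width T m}) \<and>
    (\<forall>m<length T. \<forall>v\<in>set (A (Suc m)). T ! m ! v \<in> set (A m))"

definition sub_tree :: "tree \<Rightarrow> (nat \<Rightarrow> nat list) \<Rightarrow> tree" where
  "sub_tree T A = map (\<lambda>m. map (\<lambda>v. pos (A m) (T ! m ! v)) (A (Suc m))) [0..<length T]"

lemma sub_levelsD:
  assumes "sub_levels T A"
  shows "A 0 = [0]" "m \<le> length T \<Longrightarrow> sorted_wrt (<) (A m)"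
    "m \<le> length T \<Longrightarrow> v \<in> set (A m) \<Longrightarrow> v < width T m"
    "m < length T \<Longrightarrow> v \<in> set (A (Suc m)) \<Longrightarrow> T ! m ! v \<in> set (A m)"
  using assms unfolding sub_levels_def by blast+

lemma width_sub_tree:
  assumes "sub_levels T A" "m \<le> length T"
  shows "width (sub_tree T A) m = length (A m)"
  using assms by (cases m) (auto simp: sub_levels_def sub_tree_def)

lemma is_tree_sub_tree:
  assumes T: "is_tree n T" and A: "sub_levels T A"
  shows "is_tree n (sub_tree T A)"
  unfolding is_tree_def
proof (intro conjI allI impI)
  have n: "length T = n" using T by (simp add: is_tree_def)
  then show "length (sub_tree T A) = n" by (simp add: sub_tree_def)
  fix m assume m: "m < n"
  then have eq: "sub_tree T A ! m = map (\<lambda>v. pos (A m) (T ! m ! v)) (A (Suc m))"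
    using n by (simp add: sub_tree_def)
  have "T ! m ! v \<le> T ! m ! w" if "v < w" "w \<in> set (A (Suc m))" for v w
    using that T m sub_levelsD(3)[OF A, of "Suc m" w] n by (simp add: is_tree_def sorted_nth_mono)
  then have "sorted_wrt (\<lambda>v w. pos (A m) (T ! m ! v) \<le> pos (A m) (T ! m ! w)) (A (Suc m))"
    using sub_levelsD(2)[OF A, of "Suc m"] m n by (auto intro!: pos_mono elim!: sorted_wrt_mono_rel[rotated])
  then show "sorted (sub_tree T A ! m)" by (simp add: eq sorted_map)
  show "set (sub_tree T A ! m) \<subseteq> {..<width (sub_tree T A) m}"
    using m n width_sub_tree[OF A, of m] pos_mem(1)[OF sub_levelsD(2)[OF A]] sub_levelsD(4)[OF A]
    by (auto simp: eq)
qed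

lemma is_tmorD:
  assumes "is_tmor n T S \<sigma>"
  shows "is_tree n T" "is_tree n S" "length T = n" "length S = n" "length \<sigma> = Suc n"
    "m \<le> n \<Longrightarrow> length (\<sigma> ! m) = width T m"
    "m \<le> n \<Longrightarrow> v < width T m \<Longrightarrow> \<sigma> ! m ! v < width S m"
    "m < n \<Longrightarrow> v < width T (Suc m) \<Longrightarrow> \<sigma> ! m ! (T ! m ! v) = S ! m ! (\<sigma> ! Suc m ! v)"
    "m < n \<Longrightarrow> w < width T (Suc m) \<Longrightarrow> v < w \<Longrightarrow> T ! m ! v = T ! m ! w \<Longrightarrow>
      \<sigma> ! Suc m ! v \<le> \<sigma> ! Suc m ! w"
proof -
  show "m \<le> n \<Longrightarrow> v < width T m \<Longrightarrow> \<sigma> ! m ! v < width S m"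
    using assms nth_mem[of v "\<sigma> ! m"] unfolding is_tmor_def
    by (metis lessThan_iff subset_iff)
qed (use assms in \<open>auto simp: is_tmor_def is_tree_def\<close>)

lemma is_tree_parent:
  assumes "is_tree n T" "m < n" "v < width T (Suc m)"
  shows "T ! m ! v < width T m"
  using assms nth_mem[of v "T ! m"] unfolding is_tree_def width_Suc by (metis lessThan_iff subset_iff)

lemma last_tmor: "is_tmor n T S \<sigma> \<Longrightarrow> last \<sigma> = \<sigma> ! n"
  using is_tmorD(5) by (metis diff_Suc_1 last_conv_nth length_0_conv nat.distinct(1))

lemma tips_tree: "is_tree n T \<Longrightarrow> tips T = width T n"
  by (simp add: tips_def is_tree_def)

lemma last_tmor_range:
  assumes "is_tmor n T S \<sigma>"
  shows "length (last \<sigma>) = tips T" "set (last \<sigma>) \<subseteq> {..<tips S}"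
  using assms by (simp_all add: last_tmor[OF assms] tips_tree[OF is_tmorD(1)[OF assms]]
      tips_tree[OF is_tmorD(2)[OF assms]]) (simp_all add: is_tmor_def)

text \<open>
  Both \<open>fibre_tmor\<close> and \<open>can_restrict\<close> are instances, the latter with the whole target as \<open>B\<close>.
\<close>

lemma is_tmor_sub_tree:
  assumes \<sigma>: "is_tmor n T S \<sigma>" and A: "sub_levels T A" and B: "sub_levels S B"
    and AB: "\<And>m v. \<lbrakk>m \<le> n; v \<in> set (A m)\<rbrakk> \<Longrightarrow> \<sigma> ! m ! v \<in> set (B m)"
  shows "is_tmor n (sub_tree T A) (sub_tree S B)
    (map (\<lambda>m. map (\<lambda>v. pos (B m) (\<sigma> ! m ! v)) (A m)) [0..<length \<sigma>])"
    (is "is_tmor n ?T ?S ?\<sigma>")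
proof -
  note [simp] = is_tmorD(3,4,5)[OF \<sigma>]
  have T: "is_tree n ?T" "is_tree n ?S"
    using is_tree_sub_tree is_tmorD(1,2)[OF \<sigma>] A B by auto
  have w [simp]: "width ?T m = length (A m)" "width ?S m = length (B m)" if "m \<le> n" for m
    using that width_sub_tree A B by auto
  have s [simp]: "?\<sigma> ! m = map (\<lambda>v. pos (B m) (\<sigma> ! m ! v)) (A m)" if "m \<le> n" for m
    using that by (simp del: upt_Suc)
  have Tn: "?T ! m ! a = pos (A m) (T ! m ! (A (Suc m) ! a))" if "m < n" "a < length (A (Suc m))" for m a
    using that by (simp add: sub_tree_def)
  have Sn: "?S ! m ! a = pos (B m) (S ! m ! (B (Suc m) ! a))" if "m < n" "a < length (B (Suc m))" for m a
    using that by (simp add: sub_tree_def)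
  have As: "sorted_wrt (<) (A m)" "sorted_wrt (<) (B m)" if "m \<le> n" for m
    using that sub_levelsD(2) A B by auto
  show ?thesis
    unfolding is_tmor_def
  proof (intro conjI allI impI T)
    show "length ?\<sigma> = Suc n" by simp
    fix m assume m: "m \<le> n"
    show "length (?\<sigma> ! m) = width ?T m" using m by (simp del: upt_Suc)
    show "set (?\<sigma> ! m) \<subseteq> {..<width ?S m}"
      unfolding s[OF m] w[OF m] using m pos_mem(1)[OF As(2)] AB by auto
  next
    fix m a assume m: "m < n" and a: "a < width ?T (Suc m)"
    define v where "v = A (Suc m) ! a"
    have a': "a < length (A (Suc m))" using a m w(1)[of "Suc m"] by simp
    then have v: "v \<in> set (A (Suc m))" by (simp add: v_def)
    have p: "T ! m ! v \<in> set (A m)" using sub_levelsD(4)[OF A] m v by simp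
    have q: "\<sigma> ! Suc m ! v \<in> set (B (Suc m))" using AB m v by simp
    have "v < width T (Suc m)" using sub_levelsD(3)[OF A, of "Suc m" v] m v by simp
    then have c: "\<sigma> ! m ! (T ! m ! v) = S ! m ! (\<sigma> ! Suc m ! v)"
      using is_tmorD(8)[OF \<sigma> m] by simp
    have "?\<sigma> ! m ! (?T ! m ! a) = pos (B m) (\<sigma> ! m ! (T ! m ! v))"
      unfolding Tn[OF m a'] using m p pos_mem[OF As(1) p] s[of m] by (simp add: v_def)
    moreover have "?S ! m ! (?\<sigma> ! Suc m ! a) = pos (B m) (S ! m ! (\<sigma> ! Suc m ! v))"
      using m a' q pos_mem[OF As(2) q] s[of "Suc m"] by (simp add: v_def Sn del: upt_Suc)
    ultimately show "?\<sigma> ! m ! (?T ! m ! a) = ?S ! m ! (?\<sigma> ! Suc m ! a)"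
      using c by simp
  next
    fix m a b assume m: "m < n" and b: "b < width ?T (Suc m)" and ab: "a < b"
      and eq: "?T ! m ! a = ?T ! m ! b"
    define v w where "v = A (Suc m) ! a" and "w = A (Suc m) ! b"
    have ab': "a < length (A (Suc m))" "b < length (A (Suc m))" using ab b m w(1)[of "Suc m"] by simp_all
    then have v: "v \<in> set (A (Suc m))" "w \<in> set (A (Suc m))" by (simp_all add: v_def w_def)
    have "v < w" unfolding v_def w_def using sorted_wrt_nth_less[OF As(1), of "Suc m"] m ab ab' by simp
    moreover have "T ! m ! v = T ! m ! w"
      using eq unfolding Tn[OF m ab'(1)] Tn[OF m ab'(2)] v_def[symmetric] w_def[symmetric]
      using pos_eq_iff[OF As(1)] sub_levelsD(4)[OF A] m v by simp
    moreover have "w < width T (Suc m)" using sub_levelsD(3)[OF A, of "Suc m"] m v by simp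
    ultimately have "\<sigma> ! Suc m ! v \<le> \<sigma> ! Suc m ! w"
      using is_tmorD(9)[OF \<sigma> m] by blast
    then show "?\<sigma> ! Suc m ! a \<le> ?\<sigma> ! Suc m ! b"
      using m ab' s[of "Suc m"] by (simp add: v_def w_def pos_mono del: upt_Suc)
  qed
qed

lemma anc_less:
  assumes "is_tree n T" "m \<le> n" "v < width T m" "l \<le> m"
  shows "anc T l m v < width T l"
  using assms(2-4)
proof (induction m arbitrary: v)
  case (Suc m)
  show ?case
  proof (cases "l = Suc m")
    case False
    then show ?thesis using Suc is_tree_parent[OF assms(1), of m v] by simp
  qed (use Suc.prems in simp)
qed simp

lemma anc_refl [simp]: "anc T m m v = v"
  by (cases m) auto

lemma anc_parent: "l < m \<Longrightarrow> T ! l ! anc T (Suc l) m v = anc T l m v"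
proof (induction m arbitrary: v)
  case (Suc m)
  then show ?case by (cases "l = m") auto
qed simp

lemma tmor_level_0: "is_tmor n T S \<sigma> \<Longrightarrow> \<sigma> ! 0 = [0]"
  using is_tmorD(6)[of n T S \<sigma> 0] is_tmorD(7)[of n T S \<sigma> 0 0]
  by (cases "\<sigma> ! 0") auto

lemma fibre_level_iff:
  assumes "is_tmor n T S \<sigma>" "m \<le> n"
  shows "v \<in> set (fibre_level S \<sigma> i m) \<longleftrightarrow> v < width T m \<and> \<sigma> ! m ! v = anc S m n i"
  using assms by (auto simp: fibre_level_def is_tmorD(4,6))

lemma fibre_eq_sub_tree: "fibre T S \<sigma> i = sub_tree T (fibre_level S \<sigma> i)"
  by (simp add: fibre_def sub_tree_def)

lemma sub_levels_fibre:
  assumes \<sigma>: "is_tmor n T S \<sigma>" and i: "i < tips S"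
  shows "sub_levels T (fibre_level S \<sigma> i)"
  unfolding sub_levels_def
proof (intro conjI allI impI ballI)
  have S: "is_tree n S" "length T = n" "i < width S n"
    using is_tmorD(2,3)[OF \<sigma>] i tips_tree[of n S] by auto
  have "anc S 0 n i = 0"
    using anc_less[OF S(1) _ S(3), of 0] by simp
  then show "fibre_level S \<sigma> i 0 = [0]"
    using tmor_level_0[OF \<sigma>] is_tmorD(4)[OF \<sigma>] by (simp add: fibre_level_def)
  show "sorted_wrt (<) (fibre_level S \<sigma> i m)" for m
    by (simp add: fibre_level_def sorted_wrt_filter)
  show "set (fibre_level S \<sigma> i m) \<subseteq> {..<width T m}" if "m \<le> length T" for m
    using that fibre_level_iff[OF \<sigma>] S by auto
  fix m v assume m: "m < length T" and v: "v \<in> set (fibre_level S \<sigma> i (Suc m))"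
  then have v': "v < width T (Suc m)" "\<sigma> ! Suc m ! v = anc S (Suc m) n i"
    using fibre_level_iff[OF \<sigma>] S by auto
  then have "\<sigma> ! m ! (T ! m ! v) = anc S m n i"
    using is_tmorD(8)[OF \<sigma>, of m v] anc_parent[of m n S i] m S by simp
  moreover have "T ! m ! v < width T m"
    using is_tree_parent[OF is_tmorD(1)[OF \<sigma>]] m S v' by simp
  ultimately show "T ! m ! v \<in> set (fibre_level S \<sigma> i m)"
    using fibre_level_iff[OF \<sigma>] m S by simp
qed

lemma is_tree_fibre: "\<lbrakk>is_tmor n T S \<sigma>; i < tips S\<rbrakk> \<Longrightarrow> is_tree n (fibre T S \<sigma> i)"
  unfolding fibre_eq_sub_tree using is_tree_sub_tree sub_levels_fibre is_tmorD(1) by blast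

lemma fibre_level_tips:
  assumes "is_tmor n T S \<sigma>"
  shows "fibre_level S \<sigma> i n = fib (last \<sigma>) i"
  using assms by (simp add: fibre_level_def fib_def last_tmor is_tmorD(4))

lemma tips_fibre:
  assumes "is_tmor n T S \<sigma>" "i < tips S"
  shows "tips (fibre T S \<sigma> i) = arity (last \<sigma>) i"
  using assms tips_tree[OF is_tree_fibre[OF assms]] width_sub_tree[OF sub_levels_fibre[OF assms], of n]
  by (simp add: fibre_eq_sub_tree fibre_level_tips is_tmorD(3))

lemma comp_tmor_nth:
  assumes "is_tmor n T S \<sigma>" "is_tmor n S R \<omega>" "m \<le> n"
  shows "comp_tmor \<omega> \<sigma> ! m = map ((!) (\<omega> ! m)) (\<sigma> ! m)"
  using assms by (simp add: comp_tmor_def is_tmorD(5))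

lemma is_tmor_comp:
  assumes \<sigma>: "is_tmor n T S \<sigma>" and \<omega>: "is_tmor n S R \<omega>"
  shows "is_tmor n T R (comp_tmor \<omega> \<sigma>)"
proof -
  note nth = comp_tmor_nth[OF \<sigma> \<omega>]
  have c: "comp_tmor \<omega> \<sigma> ! m ! v = \<omega> ! m ! (\<sigma> ! m ! v)" if "m \<le> n" "v < width T m" for m v
    using that nth[of m] is_tmorD(6)[OF \<sigma>, of m] by simp
  show ?thesis
    unfolding is_tmor_def
  proof (intro conjI allI impI)
    show "is_tree n T" "is_tree n R" using is_tmorD(1,2) \<sigma> \<omega> by blast+
    show "length (comp_tmor \<omega> \<sigma>) = Suc n"
      using is_tmorD(5) \<sigma> \<omega> by (simp add: comp_tmor_def)
    fix m assume m: "m \<le> n"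
    show "length (comp_tmor \<omega> \<sigma> ! m) = width T m"
      using nth[OF m] is_tmorD(6)[OF \<sigma> m] by simp
    show "set (comp_tmor \<omega> \<sigma> ! m) \<subseteq> {..<width R m}"
      using nth[OF m] is_tmorD(6,7)[OF \<sigma> m] is_tmorD(7)[OF \<omega> m] by (auto simp: in_set_conv_nth)
  next
    fix m v assume m: "m < n" and v: "v < width T (Suc m)"
    have "T ! m ! v < width T m" "\<sigma> ! Suc m ! v < width S (Suc m)"
      using is_tree_parent is_tmorD(1)[OF \<sigma>] is_tmorD(7)[OF \<sigma>, of "Suc m"] m v by auto
    then show "comp_tmor \<omega> \<sigma> ! m ! (T ! m ! v) = R ! m ! (comp_tmor \<omega> \<sigma> ! Suc m ! v)"
      using m v is_tmorD(8)[OF \<sigma> m v] is_tmorD(8)[OF \<omega> m, of "\<sigma> ! Suc m ! v"]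
      by (simp add: c)
  next
    fix m w v assume m: "m < n" and w: "w < width T (Suc m)" and vw: "v < w" "T ! m ! v = T ! m ! w"
    have le: "\<sigma> ! Suc m ! v \<le> \<sigma> ! Suc m ! w"
      using is_tmorD(9)[OF \<sigma> m w vw] .
    have s: "\<sigma> ! Suc m ! w < width S (Suc m)"
      using is_tmorD(7)[OF \<sigma>, of "Suc m"] m w by auto
    have "S ! m ! (\<sigma> ! Suc m ! v) = S ! m ! (\<sigma> ! Suc m ! w)"
      using is_tmorD(8)[OF \<sigma> m, of v] is_tmorD(8)[OF \<sigma> m, of w] w vw by simp
    then have "\<omega> ! Suc m ! (\<sigma> ! Suc m ! v) \<le> \<omega> ! Suc m ! (\<sigma> ! Suc m ! w)"
      using is_tmorD(9)[OF \<omega> m s] le by (cases "\<sigma> ! Suc m ! v = \<sigma> ! Suc m ! w") auto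
    then show "comp_tmor \<omega> \<sigma> ! Suc m ! v \<le> comp_tmor \<omega> \<sigma> ! Suc m ! w"
      using m w vw by (simp add: c)
  qed
qed

lemma last_comp_tmor:
  assumes "is_tmor n T S \<sigma>" "is_tmor n S R \<omega>"
  shows "last (comp_tmor \<omega> \<sigma>) = map ((!) (last \<omega>)) (last \<sigma>)"
  using last_tmor[OF is_tmor_comp[OF assms]] comp_tmor_nth[OF assms, of n]
    last_tmor[OF assms(1)] last_tmor[OF assms(2)] by simp

lemma is_tmor_fibre_tmor:
  assumes \<sigma>: "is_tmor n T S \<sigma>" and \<omega>: "is_tmor n S R \<omega>" and i: "i < tips R"
  shows "is_tmor n (fibre T R (comp_tmor \<omega> \<sigma>) i) (fibre S R \<omega> i) (fibre_tmor R \<omega> \<sigma> i)"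
  unfolding fibre_eq_sub_tree fibre_tmor_def
proof (rule is_tmor_sub_tree[OF \<sigma>])
  note \<omega>\<sigma> = is_tmor_comp[OF \<sigma> \<omega>]
  show "sub_levels T (fibre_level R (comp_tmor \<omega> \<sigma>) i)" "sub_levels S (fibre_level R \<omega> i)"
    using sub_levels_fibre[OF \<omega>\<sigma> i] sub_levels_fibre[OF \<omega> i] .
  fix m v assume m: "m \<le> n" and v: "v \<in> set (fibre_level R (comp_tmor \<omega> \<sigma>) i m)"
  then show "\<sigma> ! m ! v \<in> set (fibre_level R \<omega> i m)"
    using fibre_level_iff[OF \<omega>\<sigma> m] fibre_level_iff[OF \<omega> m] is_tmorD(6,7)[OF \<sigma> m]
    by (auto simp: comp_tmor_nth[OF \<sigma> \<omega> m])
qed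

lemma last_fibre_tmor:
  assumes "is_tmor n T S \<sigma>" "is_tmor n S R \<omega>"
  shows "last (fibre_tmor R \<omega> \<sigma> i) =
    map (\<lambda>v. pos (fib (last \<omega>) i) (last \<sigma> ! v)) (fib (last (comp_tmor \<omega> \<sigma>)) i)"
proof -
  have "last (fibre_tmor R \<omega> \<sigma> i) = map (\<lambda>v. pos (fibre_level R \<omega> i n) (\<sigma> ! n ! v))
        (fibre_level R (comp_tmor \<omega> \<sigma>) i n)"
    by (simp add: fibre_tmor_def is_tmorD(5)[OF assms(1)])
  then show ?thesis
    by (simp add: fibre_level_tips[OF assms(2)] fibre_level_tips[OF is_tmor_comp[OF assms]]
        last_tmor[OF assms(1)])
qed

lemma is_tmor_id: "is_tree n T \<Longrightarrow> is_tmor n T T (id_tmor T)"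
  using is_tree_parent[of n T]
  unfolding is_tmor_def id_tmor_def
  by (auto simp: is_tree_def simp del: upt_Suc)

lemma is_tree_U: "is_tree n (U_tree n)"
  by (auto simp: is_tree_def U_tree_def width_def split: nat.split)

lemma width_U: "m \<le> n \<Longrightarrow> width (U_tree n) m = 1"
  by (cases m) (auto simp: U_tree_def)

lemma tips_U: "tips (U_tree n) = 1"
  using tips_tree[OF is_tree_U] width_U[of n n] by simp

lemma is_tmor_to_U:
  assumes "is_tree n T"
  shows "is_tmor n T (U_tree n) (to_U T)"
  using assms is_tree_parent[of n T] is_tree_U[of n] width_U[of _ n]
  unfolding is_tmor_def to_U_def
  by (auto simp: is_tree_def U_tree_def simp del: upt_Suc)

section \<open>Canonical decompositions\<close>

lemma width_M_tree: "m \<le> n \<Longrightarrow> width (M_tree n l j) m = (if m \<le> l then 1 else j)"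
  by (cases m) (auto simp: M_tree_def)

lemma is_tree_M: "is_tree n (M_tree n l j)"
proof -
  have "length (M_tree n l j) = n" by (simp add: M_tree_def)
  moreover have "sorted (M_tree n l j ! m) \<and> set (M_tree n l j ! m) \<subseteq> {..<width (M_tree n l j) m}"
    if "m < n" for m
    using that by (simp add: width_M_tree) (auto simp: M_tree_def)
  ultimately show ?thesis by (simp add: is_tree_def)
qed

lemma width_pos_below_susp: "m \<le> susp T \<Longrightarrow> v < width T m \<Longrightarrow> v = 0"
  using susp_width[of m T] by simp

lemma is_tmor_can:
  assumes T: "is_tree n T" and l: "susp T < n"
  shows "is_tmor n T (can_tree T) (can_tmor T)"
proof -
  let ?l = "susp T" and ?M = "can_tree T"
  have n [simp]: "length T = n" using T by (simp add: is_tree_def)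
  have M: "is_tree n ?M" "\<And>m. m \<le> n \<Longrightarrow> width ?M m = (if m \<le> ?l then 1 else can_width T)"
    by (simp_all add: can_tree_def is_tree_M width_M_tree)
  have c: "can_tmor T ! m = (if m \<le> ?l then replicate (width T m) 0
      else map (anc T (Suc ?l) m) [0..<width T m])" if "m \<le> n" for m
    using that by (simp add: can_tmor_def del: upt_Suc)
  have cn: "can_tmor T ! m ! v = (if m \<le> ?l then 0 else anc T (Suc ?l) m v)"
    if "m \<le> n" "v < width T m" for m v
    using that by (simp add: c)
  have a: "anc T (Suc ?l) m v < can_width T" if "m \<le> n" "v < width T m" "?l < m" for m v
    using anc_less[OF T that(1,2), of "Suc ?l"] that by (simp add: can_width_def)
  show ?thesis
    unfolding is_tmor_def
  proof (intro conjI allI impI)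
    show "is_tree n T" "is_tree n ?M" by fact+
    show "length (can_tmor T) = Suc n" by (simp add: can_tmor_def)
    fix m assume m: "m \<le> n"
    show "length (can_tmor T ! m) = width T m" by (simp add: c[OF m])
    show "set (can_tmor T ! m) \<subseteq> {..<width ?M m}"
      using a[OF m] by (auto simp: c[OF m] M(2)[OF m])
  next
    fix m v assume m: "m < n" and v: "v < width T (Suc m)"
    have p: "T ! m ! v < width T m" using is_tree_parent[OF T m v] .
    have "can_tmor T ! m ! (T ! m ! v) = (if m \<le> ?l then 0 else anc T (Suc ?l) m (T ! m ! v))"
      using m p by (simp add: cn)
    moreover have "can_tmor T ! Suc m ! v = (if Suc m \<le> ?l then 0 else anc T (Suc ?l) (Suc m) v)"
      using m v by (simp add: cn del: anc.simps)
    ultimately show "can_tmor T ! m ! (T ! m ! v) = ?M ! m ! (can_tmor T ! Suc m ! v)"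
      using m a[of "Suc m" v] v by (auto simp: can_tree_def M_tree_def)
  next
    fix m w v assume m: "m < n" and w: "w < width T (Suc m)" and vw: "v < w" "T ! m ! v = T ! m ! w"
    show "can_tmor T ! Suc m ! v \<le> can_tmor T ! Suc m ! w"
      using m w vw by (simp add: cn)
  qed
qed

lemma sorted_last_can_tmor:
  assumes T: "is_tree n T" and l: "susp T < n"
  shows "sorted (last (can_tmor T))"
proof -
  have "anc T l m v \<le> anc T l m w" if "v \<le> w" "w < width T m" "m \<le> n" for l m v w
    using that
  proof (induction m arbitrary: v w)
    case (Suc m)
    have "T ! m ! v \<le> T ! m ! w" "T ! m ! w < width T m"
      using Suc.prems T is_tree_parent[OF T, of m w] by (auto simp: is_tree_def sorted_nth_mono)
    with Suc show ?case by simp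
  qed simp
  moreover have "last (can_tmor T) = map (anc T (Suc (susp T)) n) [0..<width T n]"
    using last_tmor[OF is_tmor_can[OF assms]] T l by (simp add: can_tmor_def is_tree_def del: upt_Suc)
  ultimately show ?thesis by (auto simp: sorted_iff_nth_mono)
qed

lemma last_can_tmor:
  assumes T: "is_tree n T" and l: "susp T < n"
  shows "last (can_tmor T) = map (anc T (Suc (susp T)) n) [0..<tips T]"
  using last_tmor[OF is_tmor_can[OF assms]] T l tips_tree[OF T]
  by (simp add: can_tmor_def is_tree_def del: upt_Suc)

lemma tips_can_tree: "\<lbrakk>is_tree n T; susp T < n\<rbrakk> \<Longrightarrow> tips (can_tree T) = can_width T"
  by (simp add: can_tree_def tips_M_tree is_tree_def)

lemma is_tree_can_factor:
  "\<lbrakk>is_tree n T; susp T < n; q < can_width T\<rbrakk> \<Longrightarrow> is_tree n (can_factor T q)"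
  unfolding can_factor_def by (rule is_tree_fibre[OF is_tmor_can]) (simp_all add: tips_can_tree)

lemma tips_can_factor:
  "\<lbrakk>is_tree n T; susp T < n; q < can_width T\<rbrakk> \<Longrightarrow>
    tips (can_factor T q) = length (fib (last (can_tmor T)) q)"
  unfolding can_factor_def by (rule tips_fibre[OF is_tmor_can]) (simp_all add: tips_can_tree)

lemma grp_can_tmor:
  assumes "is_tree n T" "susp T < n"
  shows "grp (last (can_tmor T)) (can_width T) = [0..<tips T]"
  using grp_of_sorted[OF sorted_last_can_tmor[OF assms], of "can_width T"]
    last_tmor_range[OF is_tmor_can[OF assms]] tips_can_tree[OF assms] by simp

lemma sub_tree_whole: 
  assumes "is_tree n S"
  shows "sub_tree S (\<lambda>m. [0..<width S m]) = S" "sub_levels S (\<lambda>m. [0..<width S m])"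
proof -
  have "map (\<lambda>v. pos [0..<width S m] (S ! m ! v)) [0..<width S (Suc m)] = S ! m" if "m < n" for m
    using is_tree_parent[OF assms that] by (intro nth_equalityI) (auto simp: pos_upt)
  then show "sub_tree S (\<lambda>m. [0..<width S m]) = S"
    using assms by (auto simp: sub_tree_def is_tree_def intro!: nth_equalityI)
  show "sub_levels S (\<lambda>m. [0..<width S m])"
    using assms is_tree_parent[OF assms] by (auto simp: sub_levels_def is_tree_def)
qed

lemma is_tmor_can_restrict:
  assumes \<sigma>: "is_tmor n T S \<sigma>" and l: "susp T < n" and q: "q < can_width T"
  shows "is_tmor n (can_factor T q) S (can_restrict T \<sigma> q)"
proof -
  note T = is_tmorD(1)[OF \<sigma>] and S = is_tmorD(2)[OF \<sigma>]
  let ?A = "fibre_level (can_tree T) (can_tmor T) q"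
  have A: "sub_levels T ?A"
    using sub_levels_fibre[OF is_tmor_can[OF T l]] q tips_can_tree[OF T l] by simp
  have r: "\<sigma> ! m ! v < width S m" if "m \<le> n" "v \<in> set (?A m)" for m v
    using that is_tmorD(3)[OF \<sigma>] is_tmorD(7)[OF \<sigma>] sub_levelsD(3)[OF A] by simp
  have "is_tmor n (can_factor T q) S (map (\<lambda>m. map (\<lambda>v. pos [0..<width S m] (\<sigma> ! m ! v)) (?A m)) [0..<length \<sigma>])"
    using is_tmor_sub_tree[OF \<sigma> A sub_tree_whole(2)[OF S]] sub_tree_whole(1)[OF S] r
    by (simp add: can_factor_def fibre_eq_sub_tree del: upt_Suc)
  also have "map (\<lambda>m. map (\<lambda>v. pos [0..<width S m] (\<sigma> ! m ! v)) (?A m)) [0..<length \<sigma>] = can_restrict T \<sigma> q"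
    using r is_tmorD(5)[OF \<sigma>] by (auto simp: can_restrict_def pos_upt simp del: upt_Suc)
  finally show ?thesis .
qed

lemma last_can_restrict:
  assumes \<sigma>: "is_tmor n T S \<sigma>" and l: "susp T < n"
  shows "last (can_restrict T \<sigma> q) = map ((!) (last \<sigma>)) (fib (last (can_tmor T)) q)"
  using fibre_level_tips[OF is_tmor_can[OF is_tmorD(1)[OF \<sigma>] l]] last_tmor[OF \<sigma>] is_tmorD(5)[OF \<sigma>]
  by (simp add: can_restrict_def)

text \<open>
  All vertices of level \<open>l + 1\<close> have the same parent, so the map is order preserving there; the
  structure maps of \<open>M\<^sub>l\<^sup>k\<close> above that level are identities, so the map at each higher level is
  the one on level \<open>l + 1\<close> composed with structure maps of \<open>T\<close>.
\<close>

lemma sorted_last_tmor_M: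
  assumes \<sigma>: "is_tmor n T (M_tree n l k) \<sigma>" and l: "l < n" "l \<le> susp T"
  shows "sorted (last \<sigma>)"
proof -
  have T: "is_tree n T" using is_tmorD(1)[OF \<sigma>] .
  have "\<sigma> ! m ! v \<le> \<sigma> ! m ! w" if "v \<le> w" "w < width T m" "l < m" "m \<le> n" for m v w
    using that
  proof (induction m arbitrary: v w)
    case (Suc m)
    show ?case
    proof (cases "m = l")
      case True
      have "T ! m ! v < width T m" "T ! m ! w < width T m"
        using Suc.prems is_tree_parent[OF T, of m] by auto
      then have "T ! m ! v = T ! m ! w"
        using width_pos_below_susp[of m T] True l by metis
      then show ?thesis
        using is_tmorD(9)[OF \<sigma>, of m w v] Suc.prems by (cases "v = w") auto
    next
      case False
      have p: "T ! m ! v \<le> T ! m ! w" "T ! m ! w < width T m"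
        using Suc.prems T is_tree_parent[OF T, of m w] by (auto simp: is_tree_def sorted_nth_mono)
      have "\<sigma> ! m ! (T ! m ! u) = \<sigma> ! Suc m ! u" if "u \<le> w" for u
        using is_tmorD(8)[OF \<sigma>, of m u] is_tmorD(7)[OF \<sigma>, of "Suc m" u] that Suc.prems False
        by (simp add: M_tree_def)
      moreover have "\<sigma> ! m ! (T ! m ! v) \<le> \<sigma> ! m ! (T ! m ! w)"
        using Suc.IH[OF p] Suc.prems False by simp
      ultimately show ?thesis using Suc.prems(1) by (metis order_refl)
    qed
  qed simp
  then show ?thesis
    using last_tmor[OF \<sigma>] is_tmorD(6)[OF \<sigma>, of n] l
    by (auto simp: sorted_iff_nth_mono)
qed

lemma anc_sub_tree:
  assumes T: "is_tree n T" and A: "sub_levels T A" and "m \<le> n" "l \<le> m" "a < length (A m)"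
  shows "A l ! anc (sub_tree T A) l m a = anc T l m (A m ! a) \<and> anc T l m (A m ! a) \<in> set (A l)"
  using assms(3-5)
proof (induction m arbitrary: a)
  case (Suc m)
  have n: "length T = n" using T by (simp add: is_tree_def)
  show ?case
  proof (cases "l = Suc m")
    case False
    have p: "T ! m ! (A (Suc m) ! a) \<in> set (A m)"
      using sub_levelsD(4)[OF A, of m] Suc.prems n by simp
    note pm = pos_mem[OF sub_levelsD(2)[OF A] p]
    show ?thesis
      using Suc.IH[of "pos (A m) (T ! m ! (A (Suc m) ! a))"] Suc.prems False pm n
      by (simp add: sub_tree_def)
  qed (use Suc.prems in simp)
qed simp

lemma fibre_level_below_susp:
  assumes \<sigma>: "is_tmor n T S \<sigma>" and i: "i < tips S" and m: "m \<le> susp S"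
  shows "fibre_level S \<sigma> i m = [0..<width T m]"
proof -
  have S: "is_tree n S" using is_tmorD(2)[OF \<sigma>] .
  have mn: "m \<le> n" using m susp_le[of S] S by (simp add: is_tree_def)
  have "anc S m n i < width S m" using anc_less[OF S] i tips_tree[OF S] mn by simp
  then have "anc S m n i = 0" by (rule width_pos_below_susp[OF m])
  moreover have "\<sigma> ! m ! v = 0" if "v < width T m" for v
    using width_pos_below_susp[OF m is_tmorD(7)[OF \<sigma> mn that]] .
  ultimately show ?thesis
    using is_tmorD(4,6)[OF \<sigma>] mn by (auto simp: fibre_level_def filter_id_conv)
qed

text \<open>
  Up to level \<open>susp S\<close> the fibre contains every vertex of \<open>T\<close>, and the canonical decomposition of
  \<open>T\<close> is determined by the levels up to \<open>susp T + 1\<close>.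
\<close>

lemma susp_fibre:
  assumes \<sigma>: "is_tmor n T S \<sigma>" and i: "i < tips S" and l: "susp T < susp S"
  shows "susp (fibre T S \<sigma> i) = susp T" "can_width (fibre T S \<sigma> i) = can_width T"
proof -
  have n: "length T = n" "susp S \<le> n"
    using is_tmorD(3,4)[OF \<sigma>] susp_le[of S] by auto
  have w: "width (fibre T S \<sigma> i) m = width T m" if "m \<le> susp S" for m
    using width_sub_tree[OF sub_levels_fibre[OF \<sigma> i], of m] fibre_level_below_susp[OF \<sigma> i that] that n
    by (simp add: fibre_eq_sub_tree)
  show s: "susp (fibre T S \<sigma> i) = susp T"
  proof (rule antisym)
    show "susp T \<le> susp (fibre T S \<sigma> i)"
      using n l susp_width[of _ T] w by (intro susp_greatest) auto
    show "susp (fibre T S \<sigma> i) \<le> susp T"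
    proof (rule ccontr)
      assume "\<not> ?thesis"
      then have "width (fibre T S \<sigma> i) (Suc (susp T)) = 1"
        by (intro susp_width) simp
      then show False
        using w[of "Suc (susp T)"] l n can_width_neq_1[of T] by (simp add: can_width_def)
    qed
  qed
  show "can_width (fibre T S \<sigma> i) = can_width T"
    using w[of "Suc (susp T)"] l by (simp only: can_width_def s)
qed

text \<open>
  A tip of the fibre has the same ancestor at level \<open>susp T + 1\<close> as the corresponding tip of \<open>T\<close>.
  So the \<open>q\<close>-th canonical factor of the fibre over \<open>i\<close> consists of the tips of the \<open>q\<close>-th canonical
  factor of \<open>T\<close> that lie over \<open>i\<close>.
\<close>

lemma tips_can_factor_fibre:
  assumes \<sigma>: "is_tmor n T S \<sigma>" and i: "i < tips S" and l: "susp T < susp S" and q: "q < can_width T"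
  shows "tips (can_factor (fibre T S \<sigma> i) q) =
    length (filter (\<lambda>v. last \<sigma> ! v = i) (fib (last (can_tmor T)) q))"
proof -
  let ?F = "fibre T S \<sigma> i" and ?A = "fibre_level S \<sigma> i"
  have T: "is_tree n T" and n: "length T = n" using is_tmorD(1,3)[OF \<sigma>] by auto
  have ln: "susp T < n" using l susp_le[of S] is_tmorD(4)[OF \<sigma>] by simp
  note F = is_tree_fibre[OF \<sigma> i] and sF = susp_fibre[OF \<sigma> i l] and A = sub_levels_fibre[OF \<sigma> i]
  let ?a = "anc T (Suc (susp T)) n"
  have An: "?A n = fib (last \<sigma>) i" using fibre_level_tips[OF \<sigma>] .
  have tF: "tips ?F = length (?A n)" using tips_fibre[OF \<sigma> i] An by simp
  have full: "?A (Suc (susp T)) = [0..<width T (Suc (susp T))]"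
    using fibre_level_below_susp[OF \<sigma> i] l by simp
  have wF: "width ?F (Suc (susp T)) = width T (Suc (susp T))"
    using sF by (simp only: can_width_def)
  have "anc ?F (Suc (susp T)) n a = ?a (?A n ! a)" if "a < length (?A n)" for a
  proof -
    have "anc ?F (Suc (susp T)) n a < width T (Suc (susp T))"
      using anc_less[OF F, of n a "Suc (susp T)"] that tF tips_tree[OF F] ln wF by simp
    then show ?thesis
      using anc_sub_tree[OF T A, of n "Suc (susp T)" a] that ln full
      by (simp add: fibre_eq_sub_tree)
  qed
  then have "last (can_tmor ?F) = map ?a (?A n)"
    using last_can_tmor[OF F] sF ln tF by (auto intro!: nth_equalityI)
  then have "length (fib (last (can_tmor ?F)) q) = length (filter (\<lambda>v. ?a v = q) (?A n))"
    by (simp add: fib_def length_filter_conv_card) (auto intro!: arg_cong[where f = card])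
  also have "filter (\<lambda>v. ?a v = q) (?A n) = filter (\<lambda>v. last \<sigma> ! v = i) (fib (last (can_tmor T)) q)"
    using last_can_tmor[OF T ln] last_tmor_range(1)[OF \<sigma>]
    by (auto simp: An fib_def intro!: filter_cong)
  finally show ?thesis
    using tips_can_factor[OF F] sF ln q by simp
qed

section \<open>Tree powers and the isomorphism chi\<close>

lemma map_nth_filter: "map ((!) xs) (filter (\<lambda>a. P (xs ! a)) [0..<length xs]) = filter P xs"
proof -
  have "filter P xs = filter P (map ((!) xs) [0..<length xs])"
    by (simp only: map_nth)
  then show ?thesis by (simp only: filter_map comp_def)
qed

lemma grp_relabel:
  "map ((!) xs) (grp (map f xs) k) = concat (map (\<lambda>i. filter (\<lambda>v. f v = i) xs) [0..<k])"
proof -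
  have "map ((!) xs) (fib (map f xs) i) = filter (\<lambda>v. f v = i) xs" for i
  proof -
    have "fib (map f xs) i = filter (\<lambda>a. f (xs ! a) = i) [0..<length xs]"
      by (auto simp: fib_def intro: filter_cong)
    then show ?thesis using map_nth_filter[of xs "\<lambda>v. f v = i"] by simp
  qed
  then show ?thesis by (simp add: grp_def map_concat comp_def)
qed

lemma reorderable_grp: "set s \<subseteq> {..<k} \<Longrightarrow> reorderable (grp s k) [0..<length s]"
  using grp_simps[of s k] by (auto simp: reorderable_def)

lemma reorderable_sym: "reorderable xs ys \<Longrightarrow> reorderable ys xs"
  by (auto simp: reorderable_def)

lemma fib_map: "fib (map g s) i = filter (\<lambda>v. g (s ! v) = i) [0..<length s]"
  by (auto simp: fib_def intro: filter_cong)

text \<open>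
  The list of values on the left is that of the restriction of \<open>s\<close> over \<open>i\<close>, with domain and codomain
  renumbered by position. Undoing the renumbering of the domain gives back fibres of \<open>s\<close> itself.
\<close>

lemma fib_fibre_relabel:
  assumes s: "set s \<subseteq> {..<length w}" and a: "a < arity w i"
  shows "map ((!) (fib (map ((!) w) s) i)) (fib (map (\<lambda>v. pos (fib w i) (s ! v)) (fib (map ((!) w) s) i)) a) =
    fib s (fib w i ! a)"
proof -
  let ?G = "fib (map ((!) w) s) i"
  have t: "fib w i ! a \<in> set (fib w i)" using a by (rule nth_mem)
  have "map ((!) ?G) (fib (map (\<lambda>v. pos (fib w i) (s ! v)) ?G) a) = filter (\<lambda>v. pos (fib w i) (s ! v) = a) ?G"
    using map_nth_filter[of ?G "\<lambda>v. pos (fib w i) (s ! v) = a"] by (simp add: fib_map)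
  also have "\<dots> = filter (\<lambda>v. s ! v = fib w i ! a) ?G"
  proof (rule filter_cong[OF refl])
    fix v assume "v \<in> set ?G"
    then have "v < length s" "w ! (s ! v) = i" by auto
    moreover from this have "s ! v < length w" using s nth_mem[of v s] by (auto simp del: nth_mem)
    ultimately have "s ! v \<in> set (fib w i)" by simp
    then show "pos (fib w i) (s ! v) = a \<longleftrightarrow> s ! v = fib w i ! a"
      using pos_mem[OF fib_simps(3), of "s ! v" w i] pos_nth[OF fib_simps(3) a] by auto
  qed
  also have "\<dots> = fib s (fib w i ! a)"
    using t by (auto simp: fib_map fib_def[of s] intro!: filter_cong)
  finally show ?thesis .
qed

lemma grp_fibre_relabel:
  assumes "set s \<subseteq> {..<length w}"
  shows "map ((!) (fib (map ((!) w) s) i))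
      (grp (map (\<lambda>v. pos (fib w i) (s ! v)) (fib (map ((!) w) s) i)) (arity w i)) =
    concat (map (fib s) (fib w i))"
proof -
  have "map (fib s) (fib w i) = map (\<lambda>a. fib s (fib w i ! a)) [0..<arity w i]"
    by (rule nth_equalityI) auto
  then show ?thesis
    using fib_fibre_relabel[OF assms]
    by (auto simp: grp_def map_concat intro!: arg_cong[where f = concat])
qed

lemma concat_of_concat: "concat (concat xss) = concat (map concat xss)"
  by (induction xss) auto

lemma foldr_powers:
  assumes C: "e \<in> C" "x \<in> C" "\<And>a b. \<lbrakk>a \<in> C; b \<in> C\<rbrakk> \<Longrightarrow> mul a b \<in> C"
    and assoc: "\<And>a b c. \<lbrakk>a \<in> C; b \<in> C; c \<in> C\<rbrakk> \<Longrightarrow> mul (mul a b) c = mul a (mul b c)"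
    and unit: "\<And>a. a \<in> C \<Longrightarrow> mul e a = a"
  shows "foldr mul (map (\<lambda>k. foldr mul (replicate k x) e) ks) e = foldr mul (replicate (sum_list ks) x) e"
proof (induction ks)
  case (Cons k ks)
  have pw: "foldr mul (replicate k x) e \<in> C" for k
    using C by (induction k) (auto simp del: foldr_replicate)
  have "foldr mul (replicate k x) c = mul (foldr mul (replicate k x) e) c" if "c \<in> C" for c
    using that by (induction k) (auto simp: unit assoc C pw simp del: foldr_replicate)
  with Cons pw show ?case by (simp add: replicate_add del: foldr_replicate)
qed simp

text \<open>
  By associativity, a product of powers depends only on the sum of the exponents, and the tips of \<open>T\<close>
  are distributed among its canonical factors.
\<close>

lemma tree_power_eq:
  assumes C: "e \<in> C" "x \<in> C" "\<And>a b. \<lbrakk>a \<in> C; b \<in> C\<rbrakk> \<Longrightarrow> mul a b \<in> C"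
    and assoc: "\<And>a b c. \<lbrakk>a \<in> C; b \<in> C; c \<in> C\<rbrakk> \<Longrightarrow> mul (mul a b) c = mul a (mul b c)"
    and unit: "\<And>a. a \<in> C \<Longrightarrow> mul e a = a" "\<And>a. a \<in> C \<Longrightarrow> mul a e = a"
    and T: "is_tree n T"
  shows "tree_power e mul x T = foldr mul (replicate (tips T) x) e"
  using T
proof (induction "n - susp T" arbitrary: T rule: less_induct)
  case less
  note T = less.prems
  have n [simp]: "length T = n" using T by (simp add: is_tree_def)
  show ?case
  proof (cases "tips T = 0 \<or> T = U_tree n")
    case True
    then show ?thesis
      using T unit(2) C(2) by (auto simp: tree_power.simps tips_U)
  next
    case False
    then have l: "susp T < n" using susp_less[OF T] by simp
    have "tree_power e mul x (can_factor T q) = foldr mul (replicate (tips (can_factor T q)) x) e"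
      if "q < can_width T" for q
      using susp_can_factor[of T q] that l is_tree_can_factor[OF T l that]
      by (intro less.hyps) (auto intro: diff_less_mono2)
    then have "map (tree_power e mul x) (can_factors T) =
        map (\<lambda>k. foldr mul (replicate k x) e) (map (\<lambda>q. length (fib (last (can_tmor T)) q)) [0..<can_width T])"
      using tips_can_factor[OF T l] by (auto simp: can_factors_def)
    moreover have "sum_list (map (\<lambda>q. length (fib (last (can_tmor T)) q)) [0..<can_width T]) = tips T"
      using sum_length_fib[of "last (can_tmor T)" "can_width T"]
        last_tmor_range[OF is_tmor_can[OF T l]] tips_can_tree[OF T l] by simp
    ultimately have "foldr mul (map (tree_power e mul x) (can_factors T)) e = foldr mul (replicate (tips T) x) e"
      using foldr_powers[of e C x mul, OF C assoc unit(1)] by (simp del: map_map)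
    then show ?thesis
      using False T by (simp add: tree_power.simps)
  qed
qed

context strict_closed_smc
begin

lemma tpow_eq: "\<lbrakk>is_tree n T; x \<in> Obj V\<rbrakk> \<Longrightarrow> tpow V x T = tensO V (replicate (tips T) x)"
  unfolding tpow_def tensO_def by (rule tree_power_eq[where C = "Obj V"]) auto

lemma tpow_arr_eq: "\<lbrakk>is_tree n T; f \<in> Arr V\<rbrakk> \<Longrightarrow> tpow_arr V f T = tensA V (replicate (tips T) f)"
  unfolding tpow_arr_def tensA_def by (rule tree_power_eq[where C = "Arr V"]) auto

lemma reorder_const_relabel:
  assumes "reorderable xs ys" "inj_on h (set xs)" "x \<in> Obj V"
  shows "reorder V (\<lambda>_. x) (map h xs) (map h ys) = reorder V (\<lambda>_. x) xs ys"
  using assms by (intro reorder_relabel) auto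

lemma reorder_const_nth:
  assumes "set s \<subseteq> {..<k}" "distinct xs" "length xs = length s" "x \<in> Obj V"
  shows "reorder V (\<lambda>_. x) (map ((!) xs) (grp s k)) xs = reorder V (\<lambda>_. x) (grp s k) [0..<length s]"
proof -
  have "reorder V (\<lambda>_. x) (map ((!) xs) (grp s k)) (map ((!) xs) [0..<length s]) =
      reorder V (\<lambda>_. x) (grp s k) [0..<length s]"
    using assms grp_simps(1)[OF assms(1)]
    by (intro reorder_const_relabel reorderable_grp) (auto intro!: inj_on_nth)
  then show ?thesis using assms(3) map_nth[of xs] by simp
qed

text \<open>
  This is the symmetry in the clause of \<open>\<chi>\<close> for \<open>M\<^sub>l\<^sup>k\<close>, where \<open>s\<close> is the map on tips and \<open>c\<close> sends a
  tip to the index of its canonical factor. The object with indices \<open>i\<close> and \<open>q\<close> is expanded into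
  the block of those tips in the \<open>q\<close>-th factor that lie over \<open>i\<close>.
\<close>

lemma sort_sym_blocks:
  assumes s: "set s \<subseteq> {..<k}" and c: "set c \<subseteq> {..<j}" "length c = length s"
    "grp c j = [0..<length s]" and x: "x \<in> Obj V"
  shows "sort_sym V (concat (map (\<lambda>i. map (\<lambda>q. (q, tensO V (replicate
      (length (filter (\<lambda>v. s ! v = i) (fib c q))) x))) [0..<j]) [0..<k])) =
    reorder V (\<lambda>_. x) (grp s k) (concat (map (\<lambda>q. concat (map (\<lambda>i. filter (\<lambda>v. s ! v = i) (fib c q)) [0..<k])) [0..<j]))"
proof -
  define blk where "blk z = filter (\<lambda>v. s ! v = fst z) (fib c (snd z))" for z
  define PL where "PL = concat (map (\<lambda>i. map (Pair i) [0..<j]) [0..<k])"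
  define ob where "ob z = tensO V (map (\<lambda>_. x) (blk z))" for z
  have PL: "PL = List.product [0..<k] [0..<j]"
    by (simp add: PL_def product_concat_map)
  then have d: "distinct PL" by (simp add: distinct_product)
  have f: "filter (\<lambda>z. snd z = q) PL = map (\<lambda>i. (i, q)) [0..<k]" if "q < j" for q
    using that by (simp add: PL_def filter_concat comp_def filter_map concat_map_singleton filter_eq_upt)
  have sorted: "sort_key snd PL = concat (map (\<lambda>q. map (\<lambda>i. (i, q)) [0..<k]) [0..<j])"
    using sort_key_by_value[of PL snd j] f by (auto simp: PL intro!: arg_cong[where f = concat])
  have 1: "concat (map blk PL) = grp s k"
  proof -
    have "concat (map (\<lambda>q. filter (\<lambda>v. s ! v = i) (fib c q)) [0..<j]) = fib s i" for i
    proof -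
      have "concat (map (\<lambda>q. filter (\<lambda>v. s ! v = i) (fib c q)) [0..<j]) = filter (\<lambda>v. s ! v = i) (grp c j)"
        by (simp add: grp_def filter_concat comp_def)
      then show ?thesis using c(3) by (simp add: fib_def)
    qed
    then show ?thesis by (simp add: PL_def grp_def map_concat comp_def blk_def concat_of_concat)
  qed
  have "concat (map (\<lambda>i. map (\<lambda>q. (q, tensO V (replicate
      (length (filter (\<lambda>v. s ! v = i) (fib c q))) x))) [0..<j]) [0..<k]) = map (\<lambda>z. (snd z, ob z)) PL"
    by (simp add: PL_def map_concat comp_def ob_def blk_def map_replicate_const)
  then have "sort_sym V (concat (map (\<lambda>i. map (\<lambda>q. (q, tensO V (replicate
      (length (filter (\<lambda>v. s ! v = i) (fib c q))) x))) [0..<j]) [0..<k])) = reorder V ob PL (sort_key snd PL)"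
    using sort_sym_eq_reorder[OF d, of snd ob] by simp
  also have "\<dots> = reorder V (\<lambda>_. x) (concat (map blk PL)) (concat (map blk (sort_key snd PL)))"
    using grp_simps(2)[OF s] x d
    by (intro reorder_blocks) (auto simp: 1 reorderable_def ob_def)
  finally show ?thesis
    unfolding 1 by (simp add: sorted map_concat comp_def blk_def concat_of_concat)
qed

end

lemma enumerate_map_upt: "enumerate 0 (map f [0..<j]) = map (\<lambda>q. (q, f q)) [0..<j]"
  by (simp add: enumerate_eq_zip zip_map2 zip_same_conv_map)

lemma length_U: "length (U_tree n) = n"
  by (simp add: U_tree_def)

text \<open>
  In the second clause with \<open>susp T < susp S\<close>, the symmetry sorts the tips first by canonical
  factor of \<open>T\<close> and inside each factor by fibre, and the maps \<open>\<chi>\<close> of the factors restore the order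
  inside each factor. In the third clause, sorting by \<open>\<sigma>\<close> refines sorting by \<open>\<omega>\<sigma>\<close>, because \<open>\<omega>\<close> is
  monotone on tips; the inner maps \<open>\<chi>\<close> undo the refinement and the outer one the coarser sorting.
  In all other cases the map on tips is monotone and there is nothing to sort.
\<close>

lemma chi_eq_reorder:
  assumes "strict_closed_smc V" "x \<in> Obj V" "is_tmor (length T) T S \<sigma>"
  shows "chi V x T S \<sigma> = reorder V (\<lambda>_. x) (grp (last \<sigma>) (tips S)) [0..<tips T]"
  using assms
proof (induction V x T S \<sigma> rule: chi.induct)
  case (1 V x T S \<sigma>)
  interpret strict_closed_smc V by fact
  define n where "n = length T"
  have x: "x \<in> Obj V" and \<sigma>: "is_tmor n T S \<sigma>" using 1 by (simp_all add: n_def)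
  note T = is_tmorD(1)[OF \<sigma>] and S = is_tmorD(2)[OF \<sigma>]
  have [simp]: "length T = n" "length S = n" using is_tmorD(3,4)[OF \<sigma>] .
  define s where "s = last \<sigma>"
  have s: "length s = tips T" "set s \<subseteq> {..<tips S}"
    using last_tmor_range[OF \<sigma>] by (simp_all add: s_def)
  have trivial: "Idn V (tpow V x T) = reorder V (\<lambda>_. x) (grp s (tips S)) [0..<tips T]" if "sorted s"
    using grp_of_sorted[OF that s(2)] tpow_eq[OF T x] s x
    by (simp add: reorder_refl map_replicate_const image_subset_iff)
  show ?case
  proof (cases "S = U_tree n")
    case True
    then have "s = replicate (tips T) 0"
      using s tips_U[of n] by (intro replicate_eqI) auto
    then show ?thesis
      using True trivial \<sigma> by (subst chi.simps) (simp add: s_def length_U)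
  next
    case U: False
    then have lS: "susp S < n" using susp_less[OF S] by simp
    show ?thesis
    proof (cases "S = M_tree n (susp S) (tips S)")
      case True
      note M = True[symmetric]
      show ?thesis
      proof (cases "susp S \<le> susp T")
        case True
        have "sorted s"
          using sorted_last_tmor_M[of n T "susp S" "tips S" \<sigma>] \<sigma> True lS by (simp add: s_def M)
        then show ?thesis
          using True trivial M U \<sigma> by (subst chi.simps) (simp add: s_def)
      next
        case lT: False
        then have lT': "susp T < susp S" "susp T < n" using lS by auto
        define c j where "c = last (can_tmor T)" and "j = can_width T"
        have c: "set c \<subseteq> {..<j}" "length c = tips T" "grp c j = [0..<tips T]"
          using last_tmor_range[OF is_tmor_can[OF T lT'(2)]] tips_can_tree[OF T lT'(2)] grp_can_tmor[OF T lT'(2)]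
          by (simp_all add: c_def j_def)
        define G where "G q = concat (map (\<lambda>i. filter (\<lambda>v. s ! v = i) (fib c q)) [0..<tips S])" for q
        have G: "map ((!) (fib c q)) (grp (map ((!) s) (fib c q)) (tips S)) = G q" for q
          by (simp add: grp_relabel G_def)
        have v: "s ! v < tips S" if "v \<in> set (fib c q)" for v q
          using that s c(2) nth_mem[of v s] by (auto simp del: nth_mem)
        have rG: "reorderable (G q) (fib c q)" for q
        proof -
          have "G q = sort_key ((!) s) (fib c q)"
            using sort_key_by_value[of "fib c q" "(!) s" "tips S", OF v] by (simp add: G_def)
          then show ?thesis by (simp add: reorderable_def)
        qed
        have chiq: "chi V x (can_factor T q) S (can_restrict T \<sigma> q) = reorder V (\<lambda>_. x) (G q) (fib c q)"
          if q: "q < j" for q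
        proof -
          have "is_tmor n (can_factor T q) S (can_restrict T \<sigma> q)"
            using is_tmor_can_restrict[OF \<sigma> lT'(2)] q by (simp add: j_def)
          then have "chi V x (can_factor T q) S (can_restrict T \<sigma> q) =
              reorder V (\<lambda>_. x) (grp (map ((!) s) (fib c q)) (tips S)) [0..<arity c q]"
            using "1.IH"(1)[OF _ _ _ _ strict_closed_smc_axioms x, of q] \<sigma> U M lT q
              last_can_restrict[OF \<sigma> lT'(2), of q] tips_can_factor[OF T lT'(2), of q]
            by (simp add: j_def s_def c_def can_factor_def)
          also have "\<dots> = reorder V (\<lambda>_. x) (G q) (fib c q)"
          proof -
            have "set (map ((!) s) (fib c q)) \<subseteq> {..<tips S}" using v by auto
            from reorder_const_nth[OF this _ _ x, of "fib c q"] G[of q] show ?thesis by simp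
          qed
          finally show ?thesis .
        qed
        have "concat (map (\<lambda>T'. enumerate 0 (map (tpow V x) (can_factors T'))) (fibres T S \<sigma>)) =
            concat (map (\<lambda>i. map (\<lambda>q. (q, tensO V (replicate
              (length (filter (\<lambda>v. s ! v = i) (fib c q))) x))) [0..<j]) [0..<tips S])"
        proof -
          have "enumerate 0 (map (tpow V x) (can_factors (fibre T S \<sigma> i))) =
              map (\<lambda>q. (q, tensO V (replicate (length (filter (\<lambda>v. s ! v = i) (fib c q))) x))) [0..<j]"
            if i: "i < tips S" for i
          proof -
            note F = is_tree_fibre[OF \<sigma> i] and sF = susp_fibre[OF \<sigma> i lT'(1)]
            have "tpow V x (can_factor (fibre T S \<sigma> i) q) =
                tensO V (replicate (length (filter (\<lambda>v. s ! v = i) (fib c q))) x)" if "q < j" for q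
              using tpow_eq[OF is_tree_can_factor[OF F, of q] x] tips_can_factor_fibre[OF \<sigma> i lT'(1), of q] that sF lT'
              by (simp add: j_def s_def c_def)
            then show ?thesis
              using sF by (simp add: can_factors_def enumerate_map_upt comp_def j_def[symmetric])
          qed
          then show ?thesis by (auto simp: fibres_def intro!: arg_cong[where f = concat])
        qed
        then have sym: "sort_sym V (concat (map (\<lambda>T'. enumerate 0 (map (tpow V x) (can_factors T'))) (fibres T S \<sigma>))) =
            reorder V (\<lambda>_. x) (grp s (tips S)) (concat (map G [0..<j]))"
          using sort_sym_blocks[OF s(2) c(1) _ _ x] c s by (simp add: G_def[abs_def])
        have "concat (map (fib c) [0..<j]) = [0..<tips T]" using c(3) by (simp add: grp_def)
        moreover have dG: "reorderable (concat (map (fib c) [0..<j])) (concat (map G [0..<j]))"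
          using rG c by (intro reorderable_concat) (auto intro: reorderable_sym simp flip: grp_def)
        ultimately have dG': "reorderable (concat (map G [0..<j])) [0..<tips T]"
          by (simp add: reorderable_sym)
        have ten: "tensA V (map (\<lambda>q. chi V x (can_factor T q) S (can_restrict T \<sigma> q)) [0..<j]) =
            reorder V (\<lambda>_. x) (concat (map G [0..<j])) [0..<tips T]"
        proof -
          have "tensA V (map (\<lambda>q. chi V x (can_factor T q) S (can_restrict T \<sigma> q)) [0..<j]) =
              tensA V (map (\<lambda>q. reorder V (\<lambda>_. x) (G q) (fib c q)) [0..<j])"
            using chiq by (intro arg_cong[where f = "tensA V"]) auto
          also have "\<dots> = reorder V (\<lambda>_. x) (concat (map G [0..<j])) (concat (map (fib c) [0..<j]))"
            using rG dG' x by (intro reorder_concat[symmetric]) (auto simp: reorderable_def)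
          finally show ?thesis using c(3) by (simp add: grp_def)
        qed
        have "reorderable (grp s (tips S)) (concat (map G [0..<j]))"
          using reorderable_grp[OF s(2)] dG' s(1) by (auto simp: reorderable_def)
        then have "reorder V (\<lambda>_. x) (concat (map G [0..<j])) [0..<tips T] \<cdot>\<^bsub>V\<^esub>
            reorder V (\<lambda>_. x) (grp s (tips S)) (concat (map G [0..<j])) =
            reorder V (\<lambda>_. x) (grp s (tips S)) [0..<tips T]"
          using dG' x by (intro reorder_comp) auto
        then show ?thesis
          using U M lT \<sigma> sym ten by (subst chi.simps) (simp add: s_def j_def)
      qed
    next
      case M: False
      define R \<omega> w j where "R = can_tree S" and "\<omega> = can_tmor S" and "w = last \<omega>" and "j = can_width S"
      have \<omega>: "is_tmor n S R \<omega>"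
        using is_tmor_can[OF S lS] by (simp add: R_def \<omega>_def)
      note \<omega>\<sigma> = is_tmor_comp[OF \<sigma> \<omega>]
      have tR: "tips R = j" using tips_can_tree[OF S lS] by (simp add: R_def j_def)
      have w: "length w = tips S" "set w \<subseteq> {..<j}" "grp w j = [0..<tips S]"
        using last_tmor_range[OF \<omega>] tR grp_can_tmor[OF S lS] by (simp_all add: w_def j_def \<omega>_def)
      have last: "last (comp_tmor \<omega> \<sigma>) = map ((!) w) s"
        using last_comp_tmor[OF \<sigma> \<omega>] by (simp add: w_def s_def)
      have lw: "set (map ((!) w) s) \<subseteq> {..<j}"
        using last_tmor_range[OF \<omega>\<sigma>] tR last by simp
      have sw: "set s \<subseteq> {..<length w}" using s w by simp
      define G where "G i = fib (map ((!) w) s) i" for i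
      define H where "H i = concat (map (fib s) (fib w i))" for i
      have H: "concat (map H [0..<j]) = grp s (tips S)"
      proof -
        have "concat (map H [0..<j]) = concat (map (fib s) (grp w j))"
          by (simp add: H_def[abs_def] grp_def map_concat comp_def concat_of_concat)
        then show ?thesis using w(3) by (simp add: grp_def)
      qed
      have G: "concat (map G [0..<j]) = grp (map ((!) w) s) j"
        by (simp add: G_def[abs_def] grp_def)
      let ?ci = "\<lambda>i. chi V x (fibre T R (comp_tmor \<omega> \<sigma>) i) (can_factor S i) (fibre_tmor R \<omega> \<sigma> i)"
      have chii: "?ci i = reorder V (\<lambda>_. x) (H i) (G i) \<and> reorderable (H i) (G i)" if i: "i < j" for i
      proof -
        let ?s = "map (\<lambda>v. pos (fib w i) (s ! v)) (G i)"
        have i': "i < tips R" using i tR by simp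
        have m: "is_tmor n (fibre T R (comp_tmor \<omega> \<sigma>) i) (can_factor S i) (fibre_tmor R \<omega> \<sigma> i)"
          using is_tmor_fibre_tmor[OF \<sigma> \<omega> i'] by (simp add: can_factor_def R_def \<omega>_def)
        have l: "last (fibre_tmor R \<omega> \<sigma> i) = ?s"
          using last_fibre_tmor[OF \<sigma> \<omega>, of i] by (simp add: w_def s_def G_def last_comp_tmor[OF \<sigma> \<omega>])
        have t: "tips (can_factor S i) = arity w i"
          using tips_can_factor[OF S lS] i by (simp add: w_def \<omega>_def j_def)
        have r: "set ?s \<subseteq> {..<arity w i}" "length ?s = length (G i)"
          using last_tmor_range[OF m] l t by simp_all
        have tF: "tips (fibre T R (comp_tmor \<omega> \<sigma>) i) = length (G i)"
          using last_tmor_range(1)[OF m] l by simp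
        have "?ci i = reorder V (\<lambda>_. x) (grp ?s (arity w i)) [0..<length (G i)]"
          using "1.IH"(3)[OF _ _ _ strict_closed_smc_axioms x, of i] \<sigma> U M m i l t tF
          by (simp add: R_def \<omega>_def j_def)
        also have "\<dots> = reorder V (\<lambda>_. x) (map ((!) (G i)) (grp ?s (arity w i))) (G i)"
          using reorder_const_nth[OF r(1) _ _ x, of "G i"] by (simp add: G_def)
        finally have "?ci i = reorder V (\<lambda>_. x) (H i) (G i)"
          using grp_fibre_relabel[OF sw, of i] by (simp add: G_def H_def)
        moreover have "reorderable (map ((!) (G i)) (grp ?s (arity w i))) (map ((!) (G i)) [0..<length (G i)])"
          using reorderable_grp[OF r(1)] grp_simps(1)[OF r(1)]
          by (auto simp: reorderable_def distinct_map G_def inj_on_nth)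
        then have "reorderable (H i) (G i)"
          using grp_fibre_relabel[OF sw, of i] by (simp add: G_def H_def map_nth)
        ultimately show ?thesis by blast
      qed
      have "tensA V (map ?ci [0..<j]) = tensA V (map (\<lambda>i. reorder V (\<lambda>_. x) (H i) (G i)) [0..<j])"
        using chii by (intro arg_cong[where f = "tensA V"]) auto
      also have "\<dots> = reorder V (\<lambda>_. x) (concat (map H [0..<j])) (concat (map G [0..<j]))"
        using chii x grp_simps(2)[OF s(2)] by (intro reorder_concat[symmetric]) (auto simp: H)
      finally have ten: "tensA V (map ?ci [0..<j]) = reorder V (\<lambda>_. x) (grp s (tips S)) (grp (map ((!) w) s) j)"
        by (simp add: G H)
      have top: "chi V x T R (comp_tmor \<omega> \<sigma>) = reorder V (\<lambda>_. x) (grp (map ((!) w) s) j) [0..<tips T]"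
        using "1.IH"(2)[OF _ _ strict_closed_smc_axioms x] \<sigma> U M \<omega>\<sigma> tR last by (simp add: R_def \<omega>_def)
      have "reorderable (grp s (tips S)) (grp (map ((!) w) s) j)" "reorderable (grp (map ((!) w) s) j) [0..<tips T]"
        using reorderable_grp[OF s(2)] reorderable_grp[OF lw] s(1) by (auto simp: reorderable_def)
      then have "reorder V (\<lambda>_. x) (grp (map ((!) w) s) j) [0..<tips T] \<cdot>\<^bsub>V\<^esub>
          reorder V (\<lambda>_. x) (grp s (tips S)) (grp (map ((!) w) s) j) =
          reorder V (\<lambda>_. x) (grp s (tips S)) [0..<tips T]"
        using x by (intro reorder_comp) auto
      then show ?thesis
        using U M \<sigma> ten top by (subst chi.simps) (simp add: s_def j_def R_def \<omega>_def)
    qed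
  qed
qed

section \<open>The closed structure\<close>

context strict_closed_smc
begin

lemma ev_inject:
  assumes "g \<in> Arr V" "h \<in> Arr V" "Dom V g = c" "Dom V h = c" "Cod V g = IHom V a b" "Cod V h = IHom V a b"
    and "a \<in> Obj V" "b \<in> Obj V"
    and eq: "Ev V a b \<cdot> (g \<boxtimes> Idn V a) = Ev V a b \<cdot> (h \<boxtimes> Idn V a)"
  shows "g = h"
proof -
  have "Ev V a b \<cdot> (g \<boxtimes> Idn V a) \<in> homs V (c \<otimes> a) b" "c \<in> Obj V"
    using assms by (auto simp: homs_iff)
  from Ev_universal[OF assms(7,8) this(2,1)] show ?thesis
    using assms by (auto simp: homs_iff)
qed

lemma curry_arr_props:
  assumes "a \<in> Obj V" "b \<in> Obj V" "c \<in> Obj V" "f \<in> Arr V" "Dom V f = c \<otimes> a" "Cod V f = b"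
  shows "curry_arr V c a b f \<in> Arr V" "Dom V (curry_arr V c a b f) = c"
    "Cod V (curry_arr V c a b f) = IHom V a b"
    "Ev V a b \<cdot> (curry_arr V c a b f \<boxtimes> Idn V a) = f"
  using theI'[OF Ev_universal[OF assms(1-3), of f]] assms
  unfolding curry_arr_def[symmetric] by (auto simp: homs_iff)

lemma ihom_map_arr:
  assumes "h \<in> Arr V" "f \<in> Arr V"
  shows "ihom_map V h f \<in> Arr V" "Dom V (ihom_map V h f) = IHom V (Cod V h) (Dom V f)"
    "Cod V (ihom_map V h f) = IHom V (Dom V h) (Cod V f)"
    "Ev V (Dom V h) (Cod V f) \<cdot> (ihom_map V h f \<boxtimes> Idn V (Dom V h)) =
      f \<cdot> Ev V (Cod V h) (Dom V f) \<cdot> (Idn V (IHom V (Cod V h) (Dom V f)) \<boxtimes> h)"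
  using assms unfolding ihom_map_def Let_def by (simp_all add: curry_arr_props)

lemma ihom_map_comp:
  assumes "h \<in> Arr V" "f \<in> Arr V" "h' \<in> Arr V" "f' \<in> Arr V" "Dom V h = Cod V h'" "Dom V f' = Cod V f"
  shows "ihom_map V h' f' \<cdot> ihom_map V h f = ihom_map V (h \<cdot> h') (f' \<cdot> f)"
proof (rule ev_inject)
  let ?a = "Cod V h" and ?a' = "Dom V h" and ?a'' = "Dom V h'"
    and ?b = "Dom V f" and ?b' = "Cod V f" and ?b'' = "Cod V f'"
  note [simp] = ihom_map_arr(1-3)
  let ?m = "ihom_map V h f" and ?m' = "ihom_map V h' f'"
  have "Ev V ?a'' ?b'' \<cdot> ((?m' \<cdot> ?m) \<boxtimes> Idn V ?a'') = (Ev V ?a'' ?b'' \<cdot> (?m' \<boxtimes> Idn V ?a'')) \<cdot> (?m \<boxtimes> Idn V ?a'')"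
    using assms by (simp add: whisker comp_assoc)
  also have "\<dots> = f' \<cdot> Ev V ?a' ?b' \<cdot> ((Idn V (IHom V ?a' ?b') \<boxtimes> h') \<cdot> (?m \<boxtimes> Idn V ?a''))"
    using ihom_map_arr(4)[OF assms(3,4)] assms by (simp add: comp_assoc)
  also have "(Idn V (IHom V ?a' ?b') \<boxtimes> h') \<cdot> (?m \<boxtimes> Idn V ?a'') = (?m \<boxtimes> Idn V ?a') \<cdot> (Idn V (IHom V ?a ?b) \<boxtimes> h')"
    using assms by (simp add: interchange)
  also have "f' \<cdot> Ev V ?a' ?b' \<cdot> \<dots> = f' \<cdot> (Ev V ?a' ?b' \<cdot> (?m \<boxtimes> Idn V ?a')) \<cdot> (Idn V (IHom V ?a ?b) \<boxtimes> h')"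
    using assms by (simp add: comp_assoc)
  also have "\<dots> = (f' \<cdot> f) \<cdot> Ev V ?a ?b \<cdot> (Idn V (IHom V ?a ?b) \<boxtimes> (h \<cdot> h'))"
    using ihom_map_arr(4)[OF assms(1,2)] assms by (simp add: comp_assoc whisker)
  also have "\<dots> = Ev V ?a'' ?b'' \<cdot> (ihom_map V (h \<cdot> h') (f' \<cdot> f) \<boxtimes> Idn V ?a'')"
    using ihom_map_arr(4)[of "h \<cdot> h'" "f' \<cdot> f"] assms by simp
  finally show "Ev V ?a'' ?b'' \<cdot> ((?m' \<cdot> ?m) \<boxtimes> Idn V ?a'') =
      Ev V ?a'' ?b'' \<cdot> (ihom_map V (h \<cdot> h') (f' \<cdot> f) \<boxtimes> Idn V ?a'')" .
qed (use assms in \<open>simp_all add: ihom_map_arr(1-3)\<close>)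

lemma ihom_map_Idn:
  assumes "a \<in> Obj V" "b \<in> Obj V"
  shows "ihom_map V (Idn V a) (Idn V b) = Idn V (IHom V a b)"
proof (rule ev_inject)
  show "Ev V a b \<cdot> (ihom_map V (Idn V a) (Idn V b) \<boxtimes> Idn V a) = Ev V a b \<cdot> (Idn V (IHom V a b) \<boxtimes> Idn V a)"
    using ihom_map_arr(4)[of "Idn V a" "Idn V b"] assms by (simp add: ten_Idn)
qed (use assms in \<open>simp_all add: ihom_map_arr(1-3)\<close>)

lemma ihom_comp_arr:
  assumes "a \<in> Obj V" "b \<in> Obj V" "c \<in> Obj V"
  shows "ihom_comp V a b c \<in> Arr V" "Dom V (ihom_comp V a b c) = IHom V b c \<otimes> IHom V a b"
    "Cod V (ihom_comp V a b c) = IHom V a c"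
    "Ev V a c \<cdot> (ihom_comp V a b c \<boxtimes> Idn V a) = Ev V b c \<cdot> (Idn V (IHom V b c) \<boxtimes> Ev V a b)"
  using assms unfolding ihom_comp_def by (simp_all add: curry_arr_props)

text \<open>
  The adjunct of \<open>(f, g) \<mapsto> f \<circ> g \<circ> h\<close>.
\<close>

lemma ev_precompose:
  assumes "h \<in> Arr V" "a \<in> Obj V" "b \<in> Obj V" "c \<in> Obj V" "Cod V h = a" "Dom V h = a'"
  shows "Ev V a' c \<cdot> ((ihom_map V h (Idn V c) \<cdot> ihom_comp V a b c) \<boxtimes> Idn V a') =
    Ev V b c \<cdot> (Idn V (IHom V b c) \<boxtimes> (Ev V a b \<cdot> (Idn V (IHom V a b) \<boxtimes> h)))"
proof -
  have [simp]: "a' \<in> Obj V" using assms by auto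
  note [simp] = ihom_map_arr(1-3) ihom_comp_arr(1-3)
  have "Ev V a' c \<cdot> ((ihom_map V h (Idn V c) \<cdot> ihom_comp V a b c) \<boxtimes> Idn V a') =
      (Ev V a' c \<cdot> (ihom_map V h (Idn V c) \<boxtimes> Idn V a')) \<cdot> (ihom_comp V a b c \<boxtimes> Idn V a')"
    using assms by (simp add: comp_assoc whisker)
  also have "\<dots> = Ev V a c \<cdot> ((Idn V (IHom V a c) \<boxtimes> h) \<cdot> (ihom_comp V a b c \<boxtimes> Idn V a'))"
    using ihom_map_arr(4)[of h "Idn V c"] assms by (simp add: comp_assoc)
  also have "(Idn V (IHom V a c) \<boxtimes> h) \<cdot> (ihom_comp V a b c \<boxtimes> Idn V a') =
      (ihom_comp V a b c \<boxtimes> Idn V a) \<cdot> (Idn V (IHom V b c \<otimes> IHom V a b) \<boxtimes> h)"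
    using assms by (simp add: interchange)
  also have "Ev V a c \<cdot> \<dots> = (Ev V b c \<cdot> (Idn V (IHom V b c) \<boxtimes> Ev V a b)) \<cdot> (Idn V (IHom V b c \<otimes> IHom V a b) \<boxtimes> h)"
    using ihom_comp_arr(4)[of a b c] assms by (simp add: comp_assoc[symmetric])
  finally show ?thesis
    using assms by (simp add: comp_assoc whisker ten_Idn[symmetric])
qed

lemma ihom_comp_natural:
  assumes "h \<in> Arr V" "a \<in> Obj V" "b \<in> Obj V" "c \<in> Obj V" "Cod V h = a" "Dom V h = a'"
  shows "ihom_comp V a' b c \<cdot> (Idn V (IHom V b c) \<boxtimes> ihom_map V h (Idn V b)) =
    ihom_map V h (Idn V c) \<cdot> ihom_comp V a b c"
proof (rule ev_inject)
  have [simp]: "a' \<in> Obj V" using assms by auto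
  note [simp] = ihom_map_arr(1-3) ihom_comp_arr(1-3)
  have "Ev V a' c \<cdot> ((ihom_comp V a' b c \<cdot> (Idn V (IHom V b c) \<boxtimes> ihom_map V h (Idn V b))) \<boxtimes> Idn V a') =
      (Ev V a' c \<cdot> (ihom_comp V a' b c \<boxtimes> Idn V a')) \<cdot> (Idn V (IHom V b c) \<boxtimes> ihom_map V h (Idn V b) \<boxtimes> Idn V a')"
    using assms by (simp add: comp_assoc whisker)
  also have "\<dots> = Ev V b c \<cdot> (Idn V (IHom V b c) \<boxtimes> (Ev V a' b \<cdot> (ihom_map V h (Idn V b) \<boxtimes> Idn V a')))"
    using ihom_comp_arr(4)[of a' b c] assms by (simp add: comp_assoc whisker)
  also have "\<dots> = Ev V b c \<cdot> (Idn V (IHom V b c) \<boxtimes> (Ev V a b \<cdot> (Idn V (IHom V a b) \<boxtimes> h)))"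
    using ihom_map_arr(4)[of h "Idn V b"] assms by simp
  also have "\<dots> = Ev V a' c \<cdot> ((ihom_map V h (Idn V c) \<cdot> ihom_comp V a b c) \<boxtimes> Idn V a')"
    using ev_precompose[OF assms] by simp
  finally show "Ev V a' c \<cdot> ((ihom_comp V a' b c \<cdot> (Idn V (IHom V b c) \<boxtimes> ihom_map V h (Idn V b))) \<boxtimes> Idn V a') =
      Ev V a' c \<cdot> ((ihom_map V h (Idn V c) \<cdot> ihom_comp V a b c) \<boxtimes> Idn V a')" .
qed (use assms in \<open>auto simp add: ihom_map_arr(1-3) ihom_comp_arr(1-3)\<close>)

lemma inv_arrI:
  assumes "f \<in> Arr V" "g \<in> Arr V" "Dom V g = Cod V f" "Cod V g = Dom V f"
    "g \<cdot> f = Idn V (Dom V f)" "f \<cdot> g = Idn V (Cod V f)"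
  shows "inv_arr V f = g" "iso_arr V f"
proof -
  show "inv_arr V f = g"
    unfolding inv_arr_def
  proof (rule the_equality)
    fix g' assume g': "g' \<in> homs V (Cod V f) (Dom V f) \<and> g' \<cdot> f = Idn V (Dom V f) \<and> f \<cdot> g' = Idn V (Cod V f)"
    then have "g' = g' \<cdot> (f \<cdot> g)" using assms by (simp add: homs_iff)
    also have "\<dots> = (g' \<cdot> f) \<cdot> g" using g' assms by (intro comp_assoc[symmetric]) (auto simp: homs_iff)
    also have "\<dots> = g" using g' assms by simp
    finally show "g' = g" .
  qed (use assms in \<open>auto simp: homs_iff\<close>)
  show "iso_arr V f" using assms by (auto simp: iso_arr_def homs_iff)
qed

lemma iso_arrE:
  assumes "iso_arr V f"
  obtains g where "f \<in> Arr V" "g \<in> Arr V" "Dom V g = Cod V f" "Cod V g = Dom V f"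
    "g \<cdot> f = Idn V (Dom V f)" "f \<cdot> g = Idn V (Cod V f)"
  using assms by (auto simp: iso_arr_def homs_iff)

lemma tensA_replicate_iso:
  assumes "iso_arr V f"
  shows "iso_arr V (tensA V (replicate k f))"
    "inv_arr V (tensA V (replicate k f)) \<in> homs V (tensO V (replicate k (Cod V f))) (tensO V (replicate k (Dom V f)))"
proof -
  obtain g where g: "f \<in> Arr V" "g \<in> Arr V" "Dom V g = Cod V f" "Cod V g = Dom V f"
    "g \<cdot> f = Idn V (Dom V f)" "f \<cdot> g = Idn V (Cod V f)"
    using assms by (rule iso_arrE)
  have *: "set (replicate k f) \<subseteq> Arr V" "set (replicate k g) \<subseteq> Arr V" using g by auto
  have r: "replicate k h = map (\<lambda>_. h) [0..<k]" for h :: 'z by (simp add: map_replicate_const)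
  have c: "tensA V (replicate k g) \<cdot> tensA V (replicate k f) = Idn V (tensO V (replicate k (Dom V f)))"
    "tensA V (replicate k f) \<cdot> tensA V (replicate k g) = Idn V (tensO V (replicate k (Cod V f)))"
    unfolding r using g by (subst tensA_comp; simp add: tensA_Idn)+
  note inv = inv_arrI[of "tensA V (replicate k f)" "tensA V (replicate k g)"]
  show "iso_arr V (tensA V (replicate k f))" using inv c * g by simp
  show "inv_arr V (tensA V (replicate k f)) \<in> homs V (tensO V (replicate k (Cod V f))) (tensO V (replicate k (Dom V f)))"
    using inv c * g by (simp add: homs_iff)
qed

end

section \<open>The permutation part of a function\<close>

text \<open>The order in which \<open>\<pi>(s)\<close> arranges the domain of \<open>s\<close>.\<close>

definition lex_before :: "nat list \<Rightarrow> nat \<Rightarrow> nat \<Rightarrow> bool" where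
  "lex_before s i j \<longleftrightarrow> s ! i < s ! j \<or> s ! i = s ! j \<and> i < j"

lemma grp_lex_sorted: "sorted_wrt (lex_before s) (grp s k)"
proof (induction k)
  case (Suc k)
  have "sorted_wrt (lex_before s) (fib s k)"
    using fib_simps(3)[of s k] by (rule sorted_wrt_mono_rel[rotated]) (auto simp: lex_before_def)
  with Suc show ?case by (auto simp: grp_def sorted_wrt_append) (simp add: lex_before_def)
qed (simp add: grp_def)

text \<open>
  The conditions on \<open>\<pi>\<close> say exactly that \<open>\<pi> i < \<pi> j\<close> if and only if \<open>i\<close> comes before \<open>j\<close> in the
  lexicographic order by value and position. This determines \<open>\<pi> i\<close> as the number of predecessors
  of \<open>i\<close>, and the permutation that lists the domain as in \<open>grp s k\<close> has this property.
\<close>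

lemma perm_part_sorts:
  assumes s: "set s \<subseteq> {..<k}"
  shows "perm_part s permutes {..<length s}"
    "map (inv (perm_part s)) [0..<length s] = grp s k"
proof -
  define p L where "p = length s" and "L = grp s k"
  define q where "q t = (if t < p then L ! t else t)" for t
  have L: "set L = {..<p}" "distinct L" "length L = p" "sorted_wrt (lex_before s) L"
    using grp_simps[OF s] grp_lex_sorted by (simp_all add: p_def L_def)
  have "bij_betw ((!) L) {..<p} {..<p}"
    using bij_betw_nth[OF L(2)] L by auto
  then have "bij_betw q {..<p} {..<p}"
    by (rule bij_betw_cong[THEN iffD1, rotated]) (simp add: q_def)
  then have q: "q permutes {..<p}"
    by (rule bij_imp_permutes) (simp add: q_def)
  let ?P = "\<lambda>\<pi>. \<pi> permutes {..<length s} \<and>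
     (\<forall>i j. i < j \<and> j < length s \<and> s ! i = s ! j \<longrightarrow> \<pi> i < \<pi> j) \<and>
     (\<exists>\<nu>. mono_on {..<length s} \<nu> \<and> (\<forall>i<length s. s ! i = \<nu> (\<pi> i)))"
  have less: "\<pi> i < \<pi> j \<longleftrightarrow> lex_before s i j" if P: "?P \<pi>" and ij: "i < p" "j < p" for \<pi> i j
  proof -
    obtain \<nu> where \<nu>: "mono_on {..<p} \<nu>" and \<nu>s: "\<And>i. i < p \<Longrightarrow> \<nu> (\<pi> i) = s ! i"
      using P unfolding p_def by metis
    have perm: "\<pi> permutes {..<p}" and stable: "\<And>i j. \<lbrakk>i < j; j < p; s ! i = s ! j\<rbrakk> \<Longrightarrow> \<pi> i < \<pi> j"
      using P unfolding p_def by blast+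
    have "\<pi> i < \<pi> j" if "lex_before s i j" "i < p" "j < p" for i j
    proof (cases "s ! i = s ! j")
      case True
      then show ?thesis using stable that by (simp add: lex_before_def)
    next
      case False
      then have "\<nu> (\<pi> i) < \<nu> (\<pi> j)" using that \<nu>s by (simp add: lex_before_def)
      moreover have "\<pi> i < p" "\<pi> j < p" using permutes_in_image[OF perm] that by auto
      ultimately show ?thesis using \<nu>(1) by (meson lessThan_iff linorder_not_le mono_onD)
    qed
    from this[OF _ ij] this[OF _ ij(2,1)] show ?thesis
      using ij by (metis lex_before_def linorder_neqE_nat order_less_asym order_less_irrefl)
  qed
  have uniq: "\<pi> i = card {j. j < p \<and> lex_before s j i}" if P: "?P \<pi>" and i: "i < p" for \<pi> i
  proof -
    have perm: "\<pi> permutes {..<p}" using P unfolding p_def by blast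
    have "\<pi> ` {j. j < p \<and> \<pi> j < \<pi> i} = {..<\<pi> i}"
    proof (intro equalityI subsetI)
      fix t assume t: "t \<in> {..<\<pi> i}"
      have "\<pi> i < p" using permutes_in_image[OF perm] i by auto
      with t have "t \<in> \<pi> ` {..<p}" using permutes_image[OF perm] by auto
      with t show "t \<in> \<pi> ` {j. j < p \<and> \<pi> j < \<pi> i}" by auto
    qed auto
    moreover have "card (\<pi> ` {j. j < p \<and> \<pi> j < \<pi> i}) = card {j. j < p \<and> \<pi> j < \<pi> i}"
      by (intro card_image inj_on_subset[OF permutes_inj[OF perm]]) auto
    moreover have "{j. j < p \<and> \<pi> j < \<pi> i} = {j. j < p \<and> lex_before s j i}"
      using less[OF P _ i] by auto
    ultimately show ?thesis by simp
  qed
  have Lq: "L ! (inv q i) = i \<and> inv q i < p" if "i < p" for i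
  proof -
    have "inv q i < p" using permutes_in_image[OF permutes_inv[OF q], of i] that by simp
    with permutes_inverses(1)[OF q, of i] show ?thesis by (simp add: q_def)
  qed
  have inj_q: "inv q i = inv q j \<longleftrightarrow> i = j" for i j
    using permutes_inj[OF permutes_inv[OF q]] by (simp add: inj_eq)
  have ex: "?P (inv q)"
  proof (intro conjI allI impI exI)
    show "inv q permutes {..<length s}" using permutes_inv[OF q] by (simp add: p_def)
    fix i j assume ij: "i < j \<and> j < length s \<and> s ! i = s ! j"
    then have *: "i < p" "j < p" by (auto simp: p_def)
    show "inv q i < inv q j"
    proof (rule ccontr)
      assume "\<not> inv q i < inv q j"
      then have "inv q j < inv q i" using inj_q[of i j] ij by simp
      then have "lex_before s (L ! inv q j) (L ! inv q i)"
        using Lq[OF *(1)] L by (intro sorted_wrt_nth_less) auto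
      then show False using Lq[OF *(1)] Lq[OF *(2)] ij by (simp add: lex_before_def)
    qed
  next
    show "mono_on {..<length s} (\<lambda>t. s ! (L ! t))"
    proof (rule mono_onI)
      fix a b assume "a \<in> {..<length s}" "b \<in> {..<length s}" "a \<le> b"
      then show "s ! (L ! a) \<le> s ! (L ! b)"
        using sorted_wrt_nth_less[OF L(4), of a b] L(3) by (cases "a = b") (auto simp: lex_before_def p_def)
    qed
    show "s ! i = s ! (L ! inv q i)" if "i < length s" for i
      using Lq that by (simp add: p_def)
  qed
  have "perm_part s = inv q"
    unfolding perm_part_def
  proof (rule the_equality[where P = ?P, OF ex])
    fix \<pi> assume P: "?P \<pi>"
    show "\<pi> = inv q"
    proof
      fix i
      have perm: "\<pi> permutes {..<p}" using P unfolding p_def by blast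
      show "\<pi> i = inv q i"
        using uniq[OF P, of i] uniq[OF ex, of i] permutes_not_in[OF perm, of i]
          permutes_not_in[OF permutes_inv[OF q], of i]
        by (cases "i < p") auto
    qed
  qed
  moreover have "map (inv (inv q)) [0..<p] = L"
    using L(3) by (auto simp: q_def inv_inv_eq[OF permutes_bij[OF q]] intro!: nth_equalityI)
  ultimately show "perm_part s permutes {..<length s}"
    "map (inv (perm_part s)) [0..<length s] = grp s k"
    using permutes_inv[OF q] by (simp_all add: p_def L_def)
qed

context strict_closed_smc
begin

lemma perm_sym_eq_reorder:
  assumes \<theta>: "\<theta> permutes {..<p}" and x: "x \<in> Obj V"
  shows "perm_sym V x p \<theta> = reorder V (\<lambda>_. x) [0..<p] (map (inv \<theta>) [0..<p])"
    "perm_sym V x p (inv \<theta>) = reorder V (\<lambda>_. x) (map (inv \<theta>) [0..<p]) [0..<p]"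
proof -
  have r: "perm_sym V x p \<theta> = reorder V (\<lambda>_. x) [0..<p] (map (inv \<theta>) [0..<p]) \<and>
      reorderable [0..<p] (map (inv \<theta>) [0..<p])" if \<theta>: "\<theta> permutes {..<p}" for \<theta>
  proof -
    have i: "inv \<theta> ` {..<p} = {..<p}" "inj_on (inv \<theta>) {..<p}"
      using permutes_image[OF permutes_inv[OF \<theta>]] permutes_inj_on[OF permutes_inv[OF \<theta>]] by auto
    then have *: "reorderable [0..<p] (map (inv \<theta>) [0..<p])"
      by (auto simp: reorderable_def distinct_map atLeast0LessThan)
    have "sort_key \<theta> [0..<p] = map (inv \<theta>) [0..<p]"
    proof (rule sort_key_inj_key_eq)
      show "mset [0..<p] = mset (map (inv \<theta>) [0..<p])"
        using * by (simp only: reorderable_iff_mset)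
      show "inj_on \<theta> (set [0..<p])" using permutes_inj_on[OF \<theta>] .
      have "map \<theta> (map (inv \<theta>) [0..<p]) = [0..<p]"
        using permutes_inverses(1)[OF \<theta>] by (auto intro: nth_equalityI)
      then show "sorted (map \<theta> (map (inv \<theta>) [0..<p]))" by simp
    qed
    then show ?thesis
      using sort_sym_eq_reorder[of "[0..<p]" \<theta> "\<lambda>_. x"] * by (simp add: perm_sym_def)
  qed
  then show "perm_sym V x p \<theta> = reorder V (\<lambda>_. x) [0..<p] (map (inv \<theta>) [0..<p])"
    using \<theta> by blast
  have "map (inv \<theta>) (map \<theta> [0..<p]) = [0..<p]"
    using permutes_inverses(2)[OF \<theta>] by (auto intro: nth_equalityI)
  moreover have "reorderable [0..<p] (map \<theta> [0..<p])" "perm_sym V x p (inv \<theta>) = reorder V (\<lambda>_. x) [0..<p] (map \<theta> [0..<p])"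
    using r[OF permutes_inv[OF \<theta>]] by (simp_all add: inv_inv_eq[OF permutes_bij[OF \<theta>]])
  ultimately show "perm_sym V x p (inv \<theta>) = reorder V (\<lambda>_. x) (map (inv \<theta>) [0..<p]) [0..<p]"
    using reorder_relabel[of "[0..<p]" "map \<theta> [0..<p]" "inv \<theta>" "\<lambda>_. x" "\<lambda>_. x"]
      permutes_inj_on[OF permutes_inv[OF \<theta>]] x by (simp add: image_subset_iff)
qed

end

section \<open>The common multiplication\<close>

text \<open>
  Labels for the factors in a composite of operations: the homs containing the outer and the
  inner operations, and the copies of \<open>x\<close> that serve as inputs.
\<close>

datatype label = Outer nat | Inner nat | Input nat

lemma reorderable_mset_left: "reorderable xs ys \<Longrightarrow> mset xs = mset xs' \<Longrightarrow> reorderable xs' ys"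
  using mset_eq_imp_distinct_iff[of xs xs'] by (simp add: reorderable_iff_mset)

lemma reorderable_interleave:
  assumes s: "set s \<subseteq> {..<k}"
    and d: "inj_on \<alpha> {..<k}" "inj_on \<beta> {..<length s}" "\<alpha> ` {..<k} \<inter> \<beta> ` {..<length s} = {}"
  shows "reorderable (map \<alpha> [0..<k] @ map \<beta> [0..<length s]) (concat (map (\<lambda>i. \<alpha> i # map \<beta> (fib s i)) [0..<k]))"
proof -
  have "mset (concat (map (\<lambda>i. \<alpha> i # map \<beta> (fib s i)) [0..<j])) = mset (map \<alpha> [0..<j] @ map \<beta> (grp s j))" for j
    by (induction j) (auto simp: grp_def)
  moreover have "mset (map \<beta> (grp s k)) = mset (map \<beta> [0..<length s])"
    using reorderable_grp[OF s] by (simp only: reorderable_iff_mset mset_map)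
  ultimately have "mset (map \<alpha> [0..<k] @ map \<beta> [0..<length s]) =
      mset (concat (map (\<lambda>i. \<alpha> i # map \<beta> (fib s i)) [0..<k]))"
    by simp
  moreover have "distinct (map \<alpha> [0..<k] @ map \<beta> [0..<length s])"
    using d by (auto simp: distinct_map atLeast0LessThan)
  ultimately show ?thesis by (simp add: reorderable_iff_mset)
qed

context strict_closed_smc
begin

definition opow :: "'o \<Rightarrow> nat \<Rightarrow> 'o" where
  "opow x k = tensO V (replicate k x)"

definition ohom :: "'o \<Rightarrow> nat \<Rightarrow> 'o" where
  "ohom x k = IHom V (opow x k) x"

definition oev :: "'o \<Rightarrow> nat \<Rightarrow> 'a" where
  "oev x k = Ev V (opow x k) x"

abbreviation hom_list :: "'o \<Rightarrow> nat list \<Rightarrow> nat \<Rightarrow> 'o list" where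
  "hom_list x s k \<equiv> map (\<lambda>i. ohom x (arity s i)) [0..<k]"

abbreviation pow_list :: "'o \<Rightarrow> nat list \<Rightarrow> nat \<Rightarrow> 'o list" where
  "pow_list x s k \<equiv> map (\<lambda>i. opow x (arity s i)) [0..<k]"

abbreviation ev_list :: "'o \<Rightarrow> nat list \<Rightarrow> nat \<Rightarrow> 'a list" where
  "ev_list x s k \<equiv> map (\<lambda>i. oev x (arity s i)) [0..<k]"

text \<open>
  Evaluation of \<open>k\<close> operations at once on \<open>x\<^sup>\<otimes>\<^sup>p\<close>: the inputs are regrouped by the fibres of \<open>s\<close>, each
  hom is moved next to its inputs, and everything is evaluated.
\<close>

definition multi_ev :: "'o \<Rightarrow> nat list \<Rightarrow> nat \<Rightarrow> 'a" where
  "multi_ev x s k = tensA V (ev_list x s k) \<cdot>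
    sort_sym V (enumerate 0 (hom_list x s k) @
      enumerate 0 (pow_list x s k)) \<cdot>
    (Idn V (tensO V (hom_list x s k)) \<boxtimes>
      reorder V (\<lambda>_. x) [0..<length s] (grp s k))"

text \<open>
  The multiplication \<open>(f; g\<^sub>1, \<dots>, g\<^sub>k) \<mapsto> f \<circ> (g\<^sub>1 \<otimes> \<dots> \<otimes> g\<^sub>k) \<circ> \<pi>(s)\<^sub>*\<close>, for any function
  \<open>s : [p] \<rightarrow> [k]\<close>. For the map on tips of a morphism of trees it is the multiplication of both
  \<open>n\<close>-operads, see \<open>NMul_Des\<close> and \<open>NMul_End\<close>.
\<close>

definition op_mul :: "'o \<Rightarrow> nat list \<Rightarrow> nat \<Rightarrow> 'a" where
  "op_mul x s k = ihom_map V (reorder V (\<lambda>_. x) [0..<length s] (grp s k)) (Idn V x) \<cdot>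
    ihom_comp V (opow x (length s)) (opow x k) x \<cdot>
    (Idn V (ohom x k) \<boxtimes> ihom_tens V (pow_list x s k) (replicate k x))"

context
  fixes x :: 'o
  assumes x [simp]: "x \<in> Obj V"
begin

lemma opow_simps [simp]: "opow x k \<in> Obj V" "tensO V (replicate k x) = opow x k"
  "tensO V (map (\<lambda>_. x) xs) = opow x (length xs)"
proof -
  show "opow x k \<in> Obj V" unfolding opow_def by (rule tensO_obj) auto
qed (simp_all add: opow_def map_replicate_const)

lemma opow_1 [simp]: "opow x (Suc 0) = x"
  by (simp add: opow_def)

lemma ohom_obj [simp]: "ohom x k \<in> Obj V"
  by (simp add: ohom_def)

lemma oev_arr [simp]: "oev x k \<in> Arr V" "Dom V (oev x k) = ohom x k \<otimes> opow x k" "Cod V (oev x k) = x"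
  by (simp_all add: oev_def ohom_def)

lemma opow_concat:
  assumes "set s \<subseteq> {..<k}"
  shows "tensO V (pow_list x s k) = opow x (length s)"
proof -
  have "tensO V (pow_list x s k) = tensO V (map (\<lambda>i. tensO V (map (\<lambda>_. x) (fib s i))) [0..<k])"
    by simp
  also have "\<dots> = tensO V (concat (map (\<lambda>i. map (\<lambda>_. x) (fib s i)) [0..<k]))"
    by (rule tensO_concat[symmetric]) auto
  also have "\<dots> = tensO V (map (\<lambda>_. x) (grp s k))"
    by (simp add: grp_def map_concat comp_def)
  finally show ?thesis using grp_simps(3)[OF assms] by simp
qed

text \<open>
  The symmetry on the left treats each tensor power as one object, and sorts the homs and
  the powers by index; expanding the powers into blocks gives the reordering on the right.
\<close>

lemma interleave_eq:
  assumes s: "set s \<subseteq> {..<k}"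
    and ob: "\<And>i. i < k \<Longrightarrow> ob (Outer i) = ohom x (arity s i)"
      "\<And>t. t < length s \<Longrightarrow> ob (Input t) = x"
  shows "sort_sym V (enumerate 0 (hom_list x s k) @
      enumerate 0 (pow_list x s k)) =
    reorder V ob (map Outer [0..<k] @ map Input (grp s k))
      (concat (map (\<lambda>i. Outer i # map Input (fib s i)) [0..<k]))"
proof -
  let ?h = "\<lambda>i. ohom x (arity s i)" and ?p = "length s"
  let ?O = "map Outer [0..<k]" and ?I = "map Input [0..<?p]" and ?G = "map Input (grp s k)"
  let ?C = "concat (map (\<lambda>i. Outer i # map Input (fib s i)) [0..<k])"
  define ob0 where "ob0 l = (case l of Outer i \<Rightarrow> ?h i | Input i \<Rightarrow> opow x (arity s i) | Inner i \<Rightarrow> x)" for l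
  define key where "key l = (case l of Outer i \<Rightarrow> i | Input i \<Rightarrow> i | Inner i \<Rightarrow> i)" for l
  define blk where "blk l = (case l of Outer i \<Rightarrow> [Outer i] | Input i \<Rightarrow> map Input (fib s i) | Inner i \<Rightarrow> [])" for l
  let ?L = "?O @ map Input [0..<k]"
  have d: "distinct ?L" by (auto simp: distinct_map inj_on_def)
  have f: "filter (\<lambda>l. key l = i) ?L = [Outer i, Input i]" if "i < k" for i
    using that by (simp add: filter_map comp_def key_def filter_eq_upt)
  have "sort_key key ?L = concat (map (\<lambda>i. filter (\<lambda>l. key l = i) ?L) [0..<k])"
    by (rule sort_key_by_value) (auto simp: key_def)
  also have "\<dots> = concat (map (\<lambda>i. [Outer i, Input i]) [0..<k])"
    using f by (auto intro!: arg_cong[where f = concat])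
  finally have sk: "sort_key key ?L = concat (map (\<lambda>i. [Outer i, Input i]) [0..<k])" .
  have setG: "set (grp s k) = {..<?p}" "distinct (grp s k)" using grp_simps[OF s] by simp_all
  have b: "concat (map blk (map Outer xs)) = map Outer xs" "concat (map blk (map Input xs)) = map Input (concat (map (fib s) xs))" for xs
    by (induction xs) (auto simp: blk_def)
  have obI: "ob ` Input ` {..<?p} \<subseteq> Obj V" "ob ` Outer ` {..<k} \<subseteq> Obj V" using ob by auto
  have "sort_sym V (enumerate 0 (map ?h [0..<k]) @ enumerate 0 (pow_list x s k)) =
      sort_sym V (map (\<lambda>l. (key l, ob0 l)) ?L)"
    by (simp add: enumerate_map_upt key_def ob0_def comp_def)
  also have "\<dots> = reorder V ob0 ?L (concat (map (\<lambda>i. [Outer i, Input i]) [0..<k]))"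
    using sort_sym_eq_reorder[OF d, of key ob0] sk by simp
  also have "\<dots> = reorder V ob (concat (map blk ?L)) (concat (map blk (concat (map (\<lambda>i. [Outer i, Input i]) [0..<k]))))"
  proof (rule reorder_blocks)
    have cL: "concat (map blk ?L) = ?O @ ?G"
      using b[of "[0..<k]"] by (simp add: grp_def del: map_map)
    show "reorderable ?L (concat (map (\<lambda>i. [Outer i, Input i]) [0..<k]))"
      using d unfolding sk[symmetric] by (auto simp: reorderable_def)
    show "distinct (concat (map blk ?L))"
      unfolding cL using setG(2) by (auto simp: distinct_map inj_on_def)
    show "ob ` set (concat (map blk ?L)) \<subseteq> Obj V"
      unfolding cL using obI setG by (auto simp: image_subset_iff)
    fix l assume "l \<in> set ?L"
    then consider i where "i < k" "l = Outer i" | i where "i < k" "l = Input i" by auto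
    then show "ob0 l = tensO V (map ob (blk l))"
    proof cases
      case 2
      have "map ob (blk l) = map (\<lambda>_. x) (fib s i)" using 2 ob by (auto simp: blk_def)
      then show ?thesis using 2 by (simp add: ob0_def)
    qed (use ob in \<open>simp add: ob0_def blk_def\<close>)
  qed
  also have "concat (map blk ?L) = ?O @ ?G"
    using b[of "[0..<k]"] by (simp add: grp_def del: map_map)
  also have "concat (map blk (concat (map (\<lambda>i. [Outer i, Input i]) [0..<k]))) = ?C"
    by (simp add: map_concat concat_of_concat comp_def blk_def)
  finally show ?thesis .
qed

lemma multi_ev_eq_canonical:
  assumes s: "set s \<subseteq> {..<k}"
    and ob: "\<And>i. i < k \<Longrightarrow> ob (Outer i) = ohom x (arity s i)"
      "\<And>t. t < length s \<Longrightarrow> ob (Input t) = x"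
  shows "multi_ev x s k = tensA V (ev_list x s k) \<cdot>
    reorder V ob (map Outer [0..<k] @ map Input [0..<length s])
      (concat (map (\<lambda>i. Outer i # map Input (fib s i)) [0..<k]))"
proof -
  let ?h = "\<lambda>i. ohom x (arity s i)" and ?p = "length s"
  let ?O = "map Outer [0..<k]" and ?I = "map Input [0..<?p]" and ?G = "map Input (grp s k)"
  let ?C = "concat (map (\<lambda>i. Outer i # map Input (fib s i)) [0..<k])"
  have r1: "reorderable (?O @ ?I) ?C"
    using s by (intro reorderable_interleave) (auto simp: inj_on_def)
  have rG: "reorderable ?I ?G"
    using reorderable_sym[OF reorderable_grp[OF s]] by (auto simp: reorderable_iff_mset distinct_map inj_on_def)
  have rOG: "reorderable (?O @ ?I) (?O @ ?G)" "reorderable (?O @ ?G) ?C"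
    using r1 rG reorderable_mset_left[OF r1, of "?O @ ?G"] unfolding reorderable_iff_mset by (simp_all del: mset_map)
  have obL: "ob ` set (?O @ ?I) \<subseteq> Obj V" using ob by auto
  have obI: "ob ` Outer ` {..<k} \<subseteq> Obj V" using ob by auto
  have "reorder V (\<lambda>_. x) [0..<?p] (grp s k) = reorder V ob ?I ?G"
    using reorderable_sym[OF reorderable_grp[OF s]] ob
    by (intro reorder_relabel[symmetric]) (auto simp: inj_on_def)
  moreover have "Idn V (tensO V (map ?h [0..<k])) = reorder V ob ?O ?O"
  proof -
    have "map ob ?O = map ?h [0..<k]" using ob by simp
    then show ?thesis using reorder_refl[of ?O ob] obI by (simp add: distinct_map inj_on_def atLeast0LessThan del: map_map)
  qed
  moreover have "reorder V ob ?O ?O \<boxtimes> reorder V ob ?I ?G = reorder V ob (?O @ ?I) (?O @ ?G)"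
    using obL rG by (intro reorder_append[symmetric]) (auto simp: reorderable_def distinct_map inj_on_def)
  moreover have "reorder V ob (?O @ ?G) ?C \<cdot> reorder V ob (?O @ ?I) (?O @ ?G) = reorder V ob (?O @ ?I) ?C"
    by (rule reorder_comp[OF rOG obL])
  moreover have "sort_sym V (enumerate 0 (map ?h [0..<k]) @ enumerate 0 (pow_list x s k)) =
      reorder V ob (?O @ ?G) ?C"
    by (rule interleave_eq[OF s]) (use ob in auto)
  ultimately show ?thesis
    unfolding multi_ev_def by (simp only:)
qed

text \<open>
  Regrouping the inputs and interleaving them with the homs is one reordering. The labels are
  left arbitrary, so that the same formula applies to a restriction of a function with the labels
  inherited from the whole.
\<close>

lemma multi_ev_eq:
  assumes s: "set s \<subseteq> {..<k}"
    and d: "inj_on \<alpha> {..<k}" "inj_on \<beta> {..<length s}" "\<alpha> ` {..<k} \<inter> \<beta> ` {..<length s} = {}"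
    and ob: "\<And>i. i < k \<Longrightarrow> ob (\<alpha> i) = ohom x (arity s i)"
      "\<And>t. t < length s \<Longrightarrow> ob (\<beta> t) = x"
  shows "multi_ev x s k = tensA V (ev_list x s k) \<cdot>
    reorder V ob (map \<alpha> [0..<k] @ map \<beta> [0..<length s])
      (concat (map (\<lambda>i. \<alpha> i # map \<beta> (fib s i)) [0..<k]))"
proof -
  define h where "h l = (case l of Outer i \<Rightarrow> \<alpha> i | Input t \<Rightarrow> \<beta> t | Inner i \<Rightarrow> \<alpha> i)" for l
  let ?O = "map Outer [0..<k] @ map Input [0..<length s]"
  let ?C = "concat (map (\<lambda>i. Outer i # map Input (fib s i)) [0..<k])"
  have h: "map h ?O = map \<alpha> [0..<k] @ map \<beta> [0..<length s]"
    "map h ?C = concat (map (\<lambda>i. \<alpha> i # map \<beta> (fib s i)) [0..<k])"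
    by (simp_all add: h_def map_concat comp_def)
  have r: "reorderable ?O ?C"
    using s by (intro reorderable_interleave) (auto simp: inj_on_def)
  have inj: "inj_on h (set ?O)"
  proof -
    have "\<alpha> i \<noteq> \<beta> t" if "i < k" "t < length s" for i t
      using d(3) that by blast
    then have "l = m" if "l \<in> set ?O" "m \<in> set ?O" "h l = h m" for l m
      using that inj_onD[OF d(1)] inj_onD[OF d(2)] by (cases l; cases m) (force simp: h_def)+
    then show ?thesis unfolding inj_on_def by blast
  qed
  have "reorder V ob (map h ?O) (map h ?C) = reorder V (\<lambda>l. ob (h l)) ?O ?C"
    using ob by (intro reorder_relabel[OF r inj]) (auto simp: h_def)
  then show ?thesis
    using multi_ev_eq_canonical[OF s, of "\<lambda>l. ob (h l)"] ob unfolding h by (simp add: h_def)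
qed

lemma interleave_arr:
  assumes s: "set s \<subseteq> {..<k}"
  defines "SS \<equiv> sort_sym V (enumerate 0 (hom_list x s k) @
      enumerate 0 (pow_list x s k))"
  shows "SS \<in> Arr V"
    "Dom V SS = tensO V (hom_list x s k) \<otimes> opow x (length s)"
    "Cod V SS = tensO V (map (\<lambda>i. ohom x (arity s i) \<otimes> opow x (arity s i)) [0..<k])"
proof -
  define ob where "ob l = (case l of Outer i \<Rightarrow> ohom x (arity s i) | _ \<Rightarrow> x)" for l
  let ?O = "map Outer [0..<k] @ map Input (grp s k)"
  let ?C = "concat (map (\<lambda>i. Outer i # map Input (fib s i)) [0..<k])"
  have eq: "SS = reorder V ob ?O ?C"
    unfolding SS_def by (rule interleave_eq[OF s]) (auto simp: ob_def)
  have "reorderable (map Outer [0..<k] @ map Input [0..<length s]) ?C"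
    using s by (intro reorderable_interleave) (auto simp: inj_on_def)
  moreover have "mset ?O = mset (map Outer [0..<k] @ map Input [0..<length s])"
    using reorderable_grp[OF s] by (simp add: reorderable_iff_mset)
  ultimately have r: "reorderable ?O ?C"
    by (metis reorderable_mset_left)
  have ob: "ob ` set ?O \<subseteq> Obj V" by (auto simp: ob_def)
  have "map ob ?C = concat (map (\<lambda>i. ohom x (arity s i) # map (\<lambda>_. x) (fib s i)) [0..<k])"
    by (simp add: map_concat comp_def ob_def)
  then have C: "tensO V (map ob ?C) = tensO V (map (\<lambda>i. ohom x (arity s i) \<otimes> opow x (arity s i)) [0..<k])"
    by (simp only:) (subst tensO_concat; auto)
  have "map ob ?O = hom_list x s k @ map (\<lambda>_. x) (grp s k)"
    by (simp add: ob_def)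
  moreover have "tensO V (hom_list x s k @ map (\<lambda>_. x) (grp s k)) =
      tensO V (hom_list x s k) \<otimes> opow x (length s)"
    using grp_simps(3)[OF s] by (subst tensO_append) auto
  ultimately have "tensO V (map ob ?O) = tensO V (hom_list x s k) \<otimes> opow x (length s)"
    by (simp only:)
  then show "SS \<in> Arr V"
    "Dom V SS = tensO V (hom_list x s k) \<otimes> opow x (length s)"
    "Cod V SS = tensO V (map (\<lambda>i. ohom x (arity s i) \<otimes> opow x (arity s i)) [0..<k])"
    unfolding eq using reorder_arr[OF r ob] C by (simp_all only:)
qed

lemma multi_ev_arr:
  assumes s: "set s \<subseteq> {..<k}"
  shows "multi_ev x s k \<in> Arr V"
    "Dom V (multi_ev x s k) = tensO V (hom_list x s k) \<otimes> opow x (length s)"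
    "Cod V (multi_ev x s k) = opow x k"
proof -
  let ?H = "hom_list x s k"
  let ?r = "reorder V (\<lambda>_. x) [0..<length s] (grp s k)"
  let ?E = "ev_list x s k"
  have "set ?E \<subseteq> Arr V" "set ?H \<subseteq> Obj V" by auto
  then have [simp]: "tensA V ?E \<in> Arr V" "Cod V (tensA V ?E) = opow x k" "tensO V ?H \<in> Obj V"
    "Dom V (tensA V ?E) = tensO V (map (\<lambda>i. ohom x (arity s i) \<otimes> opow x (arity s i)) [0..<k])"
    by (simp_all add: comp_def)
  have "reorderable [0..<length s] (grp s k)" using reorderable_sym[OF reorderable_grp[OF s]] .
  from reorder_arr[OF this, of "\<lambda>_. x"] have [simp]: "?r \<in> Arr V" "Dom V ?r = opow x (length s)" "Cod V ?r = opow x (length s)"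
    using grp_simps(3)[OF s] by (auto simp: image_subset_iff)
  show "multi_ev x s k \<in> Arr V"
    "Dom V (multi_ev x s k) = tensO V (hom_list x s k) \<otimes> opow x (length s)"
    "Cod V (multi_ev x s k) = opow x k"
    unfolding multi_ev_def using interleave_arr[OF s] by simp_all
qed

lemma ihom_tens_arr:
  assumes s: "set s \<subseteq> {..<k}"
  defines "ps \<equiv> pow_list x s k"
  shows "ihom_tens V ps (replicate k x) \<in> Arr V"
    "Dom V (ihom_tens V ps (replicate k x)) = tensO V (hom_list x s k)"
    "Cod V (ihom_tens V ps (replicate k x)) = IHom V (opow x (length s)) (opow x k)"
    "Ev V (opow x (length s)) (opow x k) \<cdot> (ihom_tens V ps (replicate k x) \<boxtimes> Idn V (opow x (length s))) \<cdot>
      (Idn V (tensO V (hom_list x s k)) \<boxtimes> reorder V (\<lambda>_. x) [0..<length s] (grp s k)) =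
      multi_ev x s k"
proof -
  let ?H = "hom_list x s k"
  let ?E = "ev_list x s k"
  let ?S = "sort_sym V (enumerate 0 ?H @ enumerate 0 ps)"
  let ?r = "reorder V (\<lambda>_. x) [0..<length s] (grp s k)"
  have m: "map2 f ps (replicate k x) = map (\<lambda>i. f (opow x (arity s i)) x) [0..<k]" for f :: "'o \<Rightarrow> 'o \<Rightarrow> 'z"
    by (intro nth_equalityI) (auto simp: ps_def)
  have "set ?E \<subseteq> Arr V" "set ?H \<subseteq> Obj V" by auto
  then have [simp]: "tensA V ?E \<in> Arr V" "Cod V (tensA V ?E) = opow x k" "tensO V ?H \<in> Obj V"
    "Dom V (tensA V ?E) = tensO V (map (\<lambda>i. ohom x (arity s i) \<otimes> opow x (arity s i)) [0..<k])"
    by (simp_all add: comp_def)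
  have "reorderable [0..<length s] (grp s k)" using reorderable_sym[OF reorderable_grp[OF s]] .
  from reorder_arr[OF this, of "\<lambda>_. x"] have [simp]: "?r \<in> Arr V" "Dom V ?r = opow x (length s)" "Cod V ?r = opow x (length s)"
    using grp_simps(3)[OF s] by (auto simp: image_subset_iff)
  note S [simp] = interleave_arr[OF s, folded ps_def]
  have eq: "ihom_tens V ps (replicate k x) =
      curry_arr V (tensO V ?H) (opow x (length s)) (opow x k) (tensA V ?E \<cdot> ?S)"
    using opow_concat[OF s] by (simp add: ihom_tens_def Let_def m ohom_def[symmetric] oev_def[symmetric] ps_def[symmetric])
  note c = curry_arr_props[of "opow x (length s)" "opow x k" "tensO V ?H" "tensA V ?E \<cdot> ?S", folded eq]
  show "ihom_tens V ps (replicate k x) \<in> Arr V"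
    "Dom V (ihom_tens V ps (replicate k x)) = tensO V ?H"
    "Cod V (ihom_tens V ps (replicate k x)) = IHom V (opow x (length s)) (opow x k)"
    using c(1-3) by simp_all
  note [simp] = this
  have "Ev V (opow x (length s)) (opow x k) \<cdot> (ihom_tens V ps (replicate k x) \<boxtimes> Idn V (opow x (length s))) = tensA V ?E \<cdot> ?S"
    using c(4) by simp
  then have "(Ev V (opow x (length s)) (opow x k) \<cdot> (ihom_tens V ps (replicate k x) \<boxtimes> Idn V (opow x (length s)))) \<cdot>
      (Idn V (tensO V ?H) \<boxtimes> ?r) = multi_ev x s k"
    by (simp add: multi_ev_def ps_def[symmetric] comp_assoc)
  then show "Ev V (opow x (length s)) (opow x k) \<cdot> (ihom_tens V ps (replicate k x) \<boxtimes> Idn V (opow x (length s))) \<cdot>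
      (Idn V (tensO V ?H) \<boxtimes> ?r) = multi_ev x s k"
    by (simp add: comp_assoc)
qed

text \<open>
  The last equation is the adjunct of the multiplication: evaluate the inner operations on the
  inputs, and then the outer operation on the results.
\<close>

lemma op_mul_arr:
  assumes s: "set s \<subseteq> {..<k}"
  shows "op_mul x s k \<in> Arr V"
    "Dom V (op_mul x s k) = ohom x k \<otimes> tensO V (hom_list x s k)"
    "Cod V (op_mul x s k) = ohom x (length s)"
    "oev x (length s) \<cdot> (op_mul x s k \<boxtimes> Idn V (opow x (length s))) = oev x k \<cdot> (Idn V (ohom x k) \<boxtimes> multi_ev x s k)"
proof -
  let ?p = "length s" and ?H = "tensO V (hom_list x s k)"
  let ?r = "reorder V (\<lambda>_. x) [0..<?p] (grp s k)"
  let ?t = "ihom_tens V (pow_list x s k) (replicate k x)"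
  have "set (hom_list x s k) \<subseteq> Obj V" by auto
  then have [simp]: "?H \<in> Obj V" by simp
  have "reorderable [0..<?p] (grp s k)" using reorderable_sym[OF reorderable_grp[OF s]] .
  from reorder_arr[OF this, of "\<lambda>_. x"] have [simp]: "?r \<in> Arr V" "Dom V ?r = opow x ?p" "Cod V ?r = opow x ?p"
    using grp_simps(3)[OF s] by (auto simp: image_subset_iff)
  note t = ihom_tens_arr[OF s]
  note [simp] = t(1-3) ihom_map_arr(1-3) ihom_comp_arr(1-3)
  show "op_mul x s k \<in> Arr V" "Dom V (op_mul x s k) = ohom x k \<otimes> ?H" "Cod V (op_mul x s k) = ohom x ?p"
    by (simp_all add: op_mul_def ohom_def)
  have "oev x ?p \<cdot> (op_mul x s k \<boxtimes> Idn V (opow x ?p)) =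
      (Ev V (opow x ?p) x \<cdot> ((ihom_map V ?r (Idn V x) \<cdot> ihom_comp V (opow x ?p) (opow x k) x) \<boxtimes> Idn V (opow x ?p))) \<cdot>
      ((Idn V (ohom x k) \<boxtimes> ?t) \<boxtimes> Idn V (opow x ?p))"
    by (simp add: op_mul_def oev_def ohom_def whisker comp_assoc)
  also have "\<dots> = Ev V (opow x k) x \<cdot> (Idn V (ohom x k) \<boxtimes>
      (Ev V (opow x ?p) (opow x k) \<cdot> ((Idn V (IHom V (opow x ?p) (opow x k)) \<boxtimes> ?r) \<cdot> (?t \<boxtimes> Idn V (opow x ?p)))))"
    using ev_precompose[of ?r "opow x ?p" "opow x k" x "opow x ?p"] by (simp add: ohom_def whisker comp_assoc)
  also have "(Idn V (IHom V (opow x ?p) (opow x k)) \<boxtimes> ?r) \<cdot> (?t \<boxtimes> Idn V (opow x ?p)) =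
      (?t \<boxtimes> Idn V (opow x ?p)) \<cdot> (Idn V ?H \<boxtimes> ?r)"
    by (simp add: interchange)
  finally show "oev x ?p \<cdot> (op_mul x s k \<boxtimes> Idn V (opow x ?p)) = oev x k \<cdot> (Idn V (ohom x k) \<boxtimes> multi_ev x s k)"
    using t(4) by (simp add: oev_def)
qed

end

end

section \<open>Associativity\<close>

lemma map_nth_upt: "map (\<lambda>a. g (xs ! a)) [0..<length xs] = map g xs"
  by (rule nth_equalityI) auto

lemma reorderable_append:
  "\<lbrakk>reorderable xs ys; reorderable xs' ys'; set xs \<inter> set xs' = {}\<rbrakk> \<Longrightarrow> reorderable (xs @ xs') (ys @ ys')"
  by (auto simp: reorderable_def)

lemma reorderable_trans: "\<lbrakk>reorderable xs ys; reorderable ys zs\<rbrakk> \<Longrightarrow> reorderable xs zs"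
  by (auto simp: reorderable_def)

lemma fib_restriction:
  fixes w s :: "nat list" and i :: nat
  assumes s: "set s \<subseteq> {..<length w}"
  defines "G \<equiv> fib (map ((!) w) s) i" and "F \<equiv> fib w i"
  defines "s' \<equiv> map (\<lambda>v. pos F (s ! v)) G"
  shows "set s' \<subseteq> {..<length F}" "length s' = length G"
    "a < length F \<Longrightarrow> map ((!) G) (fib s' a) = fib s (F ! a)"
    "a < length F \<Longrightarrow> arity s' a = length (fib s (F ! a))"
proof -
  show *: "map ((!) G) (fib s' a) = fib s (F ! a)" if "a < length F"
    using fib_fibre_relabel[OF s, of a i] that by (simp add: G_def F_def s'_def)
  show "arity s' a = length (fib s (F ! a))" if "a < length F"
    using arg_cong[where f = length, OF *[OF that]] by simp
  have "pos F (s ! v) < length F" if "v \<in> set G" for v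
  proof -
    have v: "v < length s" "w ! (s ! v) = i" using that by (auto simp: G_def)
    then have "s ! v < length w" using s nth_mem[of v s] by (auto simp del: nth_mem)
    then show ?thesis
      using v by (intro pos_mem(1)) (auto simp: F_def)
  qed
  then show "set s' \<subseteq> {..<length F}" by (auto simp: s'_def)
qed (simp_all add: s'_def)

context strict_closed_smc
begin

context
  fixes x :: 'o
  assumes x [simp]: "x \<in> Obj V"
begin

lemma op_mul_eqI:
  assumes "g \<in> Arr V" "h \<in> Arr V" "Dom V g = Dom V h" "Cod V g = ohom x p" "Cod V h = ohom x p"
    and "oev x p \<cdot> (g \<boxtimes> Idn V (opow x p)) = oev x p \<cdot> (h \<boxtimes> Idn V (opow x p))"
  shows "g = h"
  using assms x by (intro ev_inject[of g h "Dom V h" "opow x p" x]) (auto simp: ohom_def oev_def)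

text \<open>
  Passing to adjuncts reduces the claim to the two equations called \<open>left\<close> and \<open>right\<close>: either way of
  evaluating twice is the composite \<open>F\<close> of one reordering of all factors, the evaluation of the
  inner operations, and that of the outer operations. On the left, naturality moves the inner
  evaluations behind the symmetry of the outer multiplication. On the right, the restricted
  multiplications are replaced by their adjuncts, whose symmetries act inside the fibres of \<open>ws\<close>
  and combine with the outer one.
\<close>

lemma op_mul_assoc:
  fixes s w :: "nat list" and r :: nat
  assumes s: "set s \<subseteq> {..<length w}" and w: "set w \<subseteq> {..<r}"
  defines "k \<equiv> length w" and "ws \<equiv> map ((!) w) s"
  defines "s' \<equiv> \<lambda>i. map (\<lambda>v. pos (fib w i) (s ! v)) (fib ws i)"
  shows "op_mul x s k \<cdot> (op_mul x w r \<boxtimes> Idn V (tensO V (map (\<lambda>t. ohom x (arity s t)) [0..<k]))) =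
    op_mul x ws r \<cdot> (Idn V (ohom x r) \<boxtimes> tensA V (map (\<lambda>i. op_mul x (s' i) (arity w i)) [0..<r])) \<cdot>
    sort_sym V ([(0, ohom x r)] @ map (\<lambda>i. (Suc i, ohom x (arity w i))) [0..<r] @
      map (\<lambda>t. (Suc (w ! t), ohom x (arity s t))) [0..<k])"
proof -
  define Hs Hw Hws where "Hs t = ohom x (arity s t)" and "Hw i = ohom x (arity w i)"
    and "Hws i = ohom x (arity ws i)" for t i
  define evs evw evws where "evs t = oev x (arity s t)" and "evw i = oev x (arity w i)"
    and "evws i = oev x (arity ws i)" for t i
  define m where "m i = op_mul x (s' i) (arity w i)" for i
  define p where "p = length s"
  define I S X where "I = map Outer [0..<r]" and "S = map Inner [0..<k]" and "X = map Input [0..<p]"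
  define ob where "ob l = (case l of Outer i \<Rightarrow> Hw i | Inner t \<Rightarrow> Hs t | Input _ \<Rightarrow> x)" for l
  define C where "C t = Inner t # map Input (fib s t)" for t
  \<comment> \<open>\<open>Z\<close> is the order in which everything is finally evaluated: each outer operation is followed
    by its inner operations, each of them followed by its inputs.\<close>
  define K where "K i = Outer i # concat (map C (fib w i))" for i
  define Z where "Z = concat (map K [0..<r])"
  define P where "P = concat (map (\<lambda>i. Outer i # map Inner (fib w i)) [0..<r])"
  define IC where "IC = I @ concat (map C [0..<k])"
  \<comment> \<open>The intermediate orders on the right-hand side: \<open>P\<close> arises from the symmetry in the
    associativity axiom, \<open>Q\<close> and \<open>Q'\<close> from the composite operations taken as units and as blocks.\<close>
  define J where "J i = Outer i # map Inner (fib w i) @ map Input (fib ws i)" for i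
  define Q where "Q = concat (map (\<lambda>i. Outer i # map Input (fib ws i)) [0..<r])"
  define Q' where "Q' = concat (map J [0..<r])"
  define EO where "EO = tensA V (map evw [0..<r])"
  define ei where "ei i = Idn V (Hw i) \<boxtimes> tensA V (map evs (fib w i))" for i
  define EI where "EI = tensA V (map ei [0..<r])"
  define sort' where "sort' = reorder V ob (I @ S) P"
  define F where "F = EO \<cdot> EI \<cdot> reorder V ob (I @ S @ X) Z"

  have ws: "set ws \<subseteq> {..<r}" "length ws = p"
  proof -
    have "w ! t < r" if "t \<in> set s" for t
      using that s w nth_mem[of t w] by (auto simp del: nth_mem)
    then show "set ws \<subseteq> {..<r}" "length ws = p" by (auto simp: ws_def p_def)
  qed
  have s_k: "set s \<subseteq> {..<k}" using s by (simp add: k_def)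
  have s': "set (s' i) \<subseteq> {..<arity w i}" "length (s' i) = arity ws i"
    "\<And>a. a < arity w i \<Longrightarrow> map ((!) (fib ws i)) (fib (s' i) a) = fib s (fib w i ! a)"
    "\<And>a. a < arity w i \<Longrightarrow> arity (s' i) a = arity s (fib w i ! a)" for i
    using fib_restriction[OF s, where i = i] unfolding s'_def ws_def by blast+
  have s'_map: "map (\<lambda>a. g (arity (s' i) a)) [0..<arity w i] = map (\<lambda>t. g (arity s t)) (fib w i)"
    for g :: "nat \<Rightarrow> 'z" and i
    using s'(4)[of _ i] by (intro nth_equalityI) auto

  have H [simp]: "Hs t \<in> Obj V" "Hw i \<in> Obj V" "Hws i \<in> Obj V" for t i
    by (simp_all add: Hs_def Hw_def Hws_def)
  have ev [simp]: "evs t \<in> Arr V" "Dom V (evs t) = Hs t \<otimes> opow x (arity s t)" "Cod V (evs t) = x"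
    "evw i \<in> Arr V" "Dom V (evw i) = Hw i \<otimes> opow x (arity w i)" "Cod V (evw i) = x"
    "evws i \<in> Arr V" "Dom V (evws i) = Hws i \<otimes> opow x (arity ws i)" "Cod V (evws i) = x" for t i
    by (simp_all add: evs_def evw_def evws_def Hs_def Hw_def Hws_def)
  have ob [simp]: "ob l \<in> Obj V" for l by (simp add: ob_def split: label.split)
  have obs: "ob ` A \<subseteq> Obj V" for A by auto
  have H': "tensO V (map Hs xs) \<in> Obj V" "tensO V (map Hw xs) \<in> Obj V" "tensO V (map Hws xs) \<in> Obj V" "tensO V (map ob ls) \<in> Obj V" for xs ls
    by (auto intro!: tensO_obj)
  note [simp] = H'
  have evs_ten [simp]: "tensA V (map evs xs) \<in> Arr V"
    "Dom V (tensA V (map evs xs)) = tensO V (map (\<lambda>t. Hs t \<otimes> opow x (arity s t)) xs)"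
    "Cod V (tensA V (map evs xs)) = opow x (length xs)" for xs
    using tensA_map[of xs evs "\<lambda>t. Hs t \<otimes> opow x (arity s t)" "\<lambda>_. x"] x by simp_all
  have ei [simp]: "ei i \<in> Arr V" "Dom V (ei i) = Hw i \<otimes> tensO V (map (\<lambda>t. Hs t \<otimes> opow x (arity s t)) (fib w i))"
    "Cod V (ei i) = Hw i \<otimes> opow x (arity w i)" for i
    by (simp_all add: ei_def)

  have C_ob: "tensO V (map ob (concat (map C ts))) = tensO V (map (\<lambda>t. Hs t \<otimes> opow x (arity s t)) ts)" for ts
  proof -
    have "map ob (concat (map C ts)) = concat (map (\<lambda>t. Hs t # map (\<lambda>_. x) (fib s t)) ts)"
      by (simp add: map_concat comp_def C_def ob_def)
    then show ?thesis using x by (simp only:) (subst tensO_concat; auto)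
  qed

  have r1: "reorderable (I @ S) P"
    unfolding I_def S_def P_def k_def using w by (intro reorderable_interleave) (auto simp: inj_on_def)
  have r2: "reorderable (S @ X) (concat (map C [0..<k]))"
    unfolding X_def S_def C_def[abs_def] p_def using s_k by (intro reorderable_interleave) (auto simp: inj_on_def)
  have rI: "reorderable I I" "reorderable X X"
    by (auto simp: reorderable_def I_def X_def distinct_map inj_on_def)
  have r3: "reorderable (I @ S @ X) IC"
    unfolding IC_def using r2 rI by (intro reorderable_append) (auto simp: I_def S_def X_def)
  define blk where "blk l = (case l of Inner t \<Rightarrow> C t | _ \<Rightarrow> [l])" for l
  have blkIS: "concat (map blk (I @ S)) = IC" "concat (map blk P) = Z"
    by (simp_all add: I_def S_def IC_def P_def Z_def K_def[abs_def] blk_def map_concat comp_def concat_of_concat)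
  have dIC: "distinct IC" using r3 by (simp add: reorderable_def)
  have r4: "reorderable IC Z"
    using reorderable_blocks[OF r1, of blk] dIC unfolding blkIS by blast
  have r5: "reorderable (I @ S @ X) Z" using r3 r4 by (rule reorderable_trans)
  have r6: "reorderable (I @ X) Q"
    unfolding I_def X_def Q_def ws(2)[symmetric] using ws by (intro reorderable_interleave) (auto simp: inj_on_def)
  have r7: "reorderable (I @ S @ X) (P @ X)"
    using reorderable_append[OF r1 rI(2)] by (auto simp: I_def S_def X_def)
  define blk' where "blk' l = (case l of Outer i \<Rightarrow> Outer i # map Inner (fib w i) | _ \<Rightarrow> [l])" for l
  have blkIX: "concat (map blk' (I @ X)) = P @ X" "concat (map blk' Q) = Q'"
    by (simp_all add: I_def X_def P_def Q_def Q'_def J_def[abs_def] blk'_def map_concat comp_def concat_of_concat)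
  have dPX: "distinct (P @ X)" using r7 by (simp add: reorderable_def)
  have r8: "reorderable (P @ X) Q'"
    using reorderable_blocks[OF r6, of blk'] dPX unfolding blkIX by blast
  have JK: "map (\<lambda>a. Inner (fib w i ! a)) [0..<arity w i] @ map (\<lambda>t. Input (fib ws i ! t)) [0..<length (s' i)] =
      map Inner (fib w i) @ map Input (fib ws i)"
    "concat (map (\<lambda>a. Inner (fib w i ! a) # map (\<lambda>t. Input (fib ws i ! t)) (fib (s' i) a)) [0..<arity w i]) =
      concat (map C (fib w i))" for i
  proof -
    have "map (\<lambda>t. Input (fib ws i ! t)) (fib (s' i) a) = map Input (fib s (fib w i ! a))" if "a < arity w i" for a
      using s'(3)[OF that] by (metis (no_types, lifting) comp_apply list.map_cong0 map_map)
    then have "map (\<lambda>a. Inner (fib w i ! a) # map (\<lambda>t. Input (fib ws i ! t)) (fib (s' i) a)) [0..<arity w i] =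
        map C (fib w i)"
      by (intro nth_equalityI) (auto simp: C_def)
    then show "concat (map (\<lambda>a. Inner (fib w i ! a) # map (\<lambda>t. Input (fib ws i ! t)) (fib (s' i) a)) [0..<arity w i]) =
      concat (map C (fib w i))" by simp
  qed (simp add: s'(2) map_nth_upt)
  have inj: "inj_on (\<lambda>a. Inner (fib w i ! a)) {..<arity w i}"
    "inj_on (\<lambda>t. Input (fib ws i ! t)) {..<length (s' i)}"
    "(\<lambda>a. Inner (fib w i ! a)) ` {..<arity w i} \<inter> (\<lambda>t. Input (fib ws i ! t)) ` {..<length (s' i)} = {}" for i
    by (auto simp: inj_on_def s'(2) nth_eq_iff_index_eq)
  have rJ: "reorderable (map Inner (fib w i) @ map Input (fib ws i)) (concat (map C (fib w i)))" for i
    using reorderable_interleave[OF s'(1) inj, of i] unfolding JK .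
  have r9: "reorderable (J i) (K i)" for i
  proof -
    have "reorderable [Outer i] [Outer i]" "set [Outer i] \<inter> set (map Inner (fib w i) @ map Input (fib ws i)) = {}"
      by (auto simp: reorderable_def)
    from reorderable_append[OF this(1) rJ this(2)] show ?thesis by (simp add: J_def K_def)
  qed
  have rQZ: "reorderable Q' Z"
    using r8 r7 r5 by (auto simp: reorderable_def)

  have mw: "multi_ev x w r = EO \<cdot> reorder V (case_label Hw (\<lambda>_. x) (\<lambda>_. x)) (I @ S) P"
    unfolding EO_def I_def S_def P_def k_def evw_def[abs_def] using w
    by (intro multi_ev_eq) (auto simp: inj_on_def Hw_def)
  have ms: "multi_ev x s k = tensA V (map evs [0..<k]) \<cdot> reorder V ob (S @ X) (concat (map C [0..<k]))"
    unfolding X_def S_def C_def[abs_def] p_def evs_def[abs_def] using s_k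
    by (intro multi_ev_eq) (auto simp: inj_on_def ob_def Hs_def)
  have mws: "multi_ev x ws r = tensA V (map evws [0..<r]) \<cdot> reorder V (case_label Hws (\<lambda>_. x) (\<lambda>_. x)) (I @ X) Q"
    unfolding I_def X_def Q_def evws_def[abs_def] ws(2)[symmetric] using ws
    by (intro multi_ev_eq) (auto simp: inj_on_def Hws_def)
  have ms': "multi_ev x (s' i) (arity w i) = tensA V (map evs (fib w i)) \<cdot>
      reorder V ob (map Inner (fib w i) @ map Input (fib ws i)) (concat (map C (fib w i)))" for i
  proof -
    have "multi_ev x (s' i) (arity w i) =
        tensA V (map (\<lambda>a. oev x (arity (s' i) a)) [0..<arity w i]) \<cdot>
        reorder V ob (map (\<lambda>a. Inner (fib w i ! a)) [0..<arity w i] @ map (\<lambda>t. Input (fib ws i ! t)) [0..<length (s' i)])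
        (concat (map (\<lambda>a. Inner (fib w i ! a) # map (\<lambda>t. Input (fib ws i ! t)) (fib (s' i) a)) [0..<arity w i]))"
      using s'(4)[of _ i] by (intro multi_ev_eq s'(1) inj) (auto simp: ob_def Hs_def)
    then show ?thesis unfolding JK s'_map evs_def[abs_def] .
  qed
  note ra = reorder_arr[OF _ obs]

  have EO [simp]: "EO \<in> Arr V" "Dom V EO = tensO V (map (\<lambda>i. Hw i \<otimes> opow x (arity w i)) [0..<r])"
    unfolding EO_def by (rule tensA_map[where b = "\<lambda>_. x"]; simp)+
  have EI [simp]: "EI \<in> Arr V"
    "Dom V EI = tensO V (map (\<lambda>i. Hw i \<otimes> tensO V (map (\<lambda>t. Hs t \<otimes> opow x (arity s t)) (fib w i))) [0..<r])"
    "Cod V EI = tensO V (map (\<lambda>i. Hw i \<otimes> opow x (arity w i)) [0..<r])"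
    unfolding EI_def
    by (rule tensA_map[where a = "\<lambda>i. Hw i \<otimes> tensO V (map (\<lambda>t. Hs t \<otimes> opow x (arity s t)) (fib w i))"
        and b = "\<lambda>i. Hw i \<otimes> opow x (arity w i)"]; simp)+

  have left: "multi_ev x w r \<cdot> (Idn V (tensO V (map Hw [0..<r])) \<boxtimes> multi_ev x s k) = F"
  proof -
    define Fn where "Fn l = (case l of Outer i \<Rightarrow> Idn V (Hw i) | Inner t \<Rightarrow> evs t | Input _ \<Rightarrow> Idn V x)" for l
    define ob1 where "ob1 = case_label Hw (\<lambda>_. x) (\<lambda>_. x)"
    define ob2 where "ob2 = case_label Hw (\<lambda>t. Hs t \<otimes> opow x (arity s t)) (\<lambda>_. x)"
    have Fn: "Fn l \<in> Arr V" "Dom V (Fn l) = ob2 l" "Cod V (Fn l) = ob1 l" for l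
      using x by (simp_all add: Fn_def ob1_def ob2_def split: label.split)
    have ob2: "ob2 ` A \<subseteq> Obj V" "ob1 ` A \<subseteq> Obj V" for A
      using x by (auto simp: ob1_def ob2_def split: label.splits)
    note tFn = tensA_map[of _ Fn ob2 ob1, OF conjI[OF Fn(1) conjI[OF Fn(2,3)]]]
    have FnS: "map Fn S = map evs [0..<k]" "map Fn I = map (\<lambda>i. Idn V (Hw i)) [0..<r]"
      by (simp_all add: S_def I_def Fn_def)
    have obI: "map ob I = map Hw [0..<r]" by (simp add: I_def ob_def)
    have "Idn V (tensO V (map Hw [0..<r])) \<boxtimes> multi_ev x s k =
        (Idn V (tensO V (map Hw [0..<r])) \<boxtimes> tensA V (map evs [0..<k])) \<cdot>
        (Idn V (tensO V (map Hw [0..<r])) \<boxtimes> reorder V ob (S @ X) (concat (map C [0..<k])))"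
    proof -
      have "Cod V (reorder V ob (S @ X) (concat (map C [0..<k]))) = Dom V (tensA V (map evs [0..<k]))"
        using ra[OF r2] C_ob by simp
      then show ?thesis unfolding ms using ra[OF r2] by (intro whisker) auto
    qed
    also have "Idn V (tensO V (map Hw [0..<r])) \<boxtimes> tensA V (map evs [0..<k]) = tensA V (map Fn (I @ S))"
    proof -
      have "set (map Fn I) \<subseteq> Arr V" "set (map Fn S) \<subseteq> Arr V" using Fn by auto
      then show ?thesis using tensA_append[of "map Fn I" "map Fn S"] tensA_Idn[of "[0..<r]" Hw] by (simp add: FnS)
    qed
    also have "Idn V (tensO V (map Hw [0..<r])) \<boxtimes> reorder V ob (S @ X) (concat (map C [0..<k])) =
        reorder V ob (I @ S @ X) IC"
      using reorder_append[OF rI(1) r2 obs] reorder_refl[of I ob] rI r3 obs obI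
      by (simp add: IC_def reorderable_def)
    finally have 1: "Idn V (tensO V (map Hw [0..<r])) \<boxtimes> multi_ev x s k =
        tensA V (map Fn (I @ S)) \<cdot> reorder V ob (I @ S @ X) IC" .
    have 2: "reorder V ob1 (I @ S) P \<cdot> tensA V (map Fn (I @ S)) = tensA V (map Fn P) \<cdot> reorder V ob2 (I @ S) P"
      using r1 Fn by (intro reorder_natural) auto
    have 3: "tensA V (map Fn P) = EI"
    proof -
      have "map Fn P = concat (map (\<lambda>i. Idn V (Hw i) # map evs (fib w i)) [0..<r])"
        by (simp add: P_def map_concat comp_def Fn_def)
      then show ?thesis
        by (simp only:) (subst tensA_concat; auto simp: EI_def ei_def[abs_def])
    qed
    have 4: "reorder V ob2 (I @ S) P = reorder V ob IC Z"
    proof -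
      have "ob2 l = tensO V (map ob (blk l))" for l
      proof (cases l)
        case (Inner t)
        have "map ob (blk l) = Hs t # map (\<lambda>_. x) (fib s t)"
          by (simp add: Inner blk_def C_def ob_def)
        then show ?thesis using x by (simp add: Inner ob2_def)
      qed (use x in \<open>simp_all add: ob2_def blk_def ob_def\<close>)
      then show ?thesis
        using reorder_blocks[OF r1, of blk ob ob2] dIC obs unfolding blkIS by blast
    qed
    note arr1 = reorder_arr[OF r1 ob2(2)] and arr2 = reorder_arr[OF r1 ob2(1)]
    have arr3: "reorder V ob (I @ S @ X) IC \<in> Arr V" "Cod V (reorder V ob (I @ S @ X) IC) = tensO V (map ob2 (I @ S))"
      using ra[OF r3] ra[OF r4] arr2 unfolding 4 by auto
    have EOc: "Dom V EO = tensO V (map ob1 P)"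
      using tFn(3)[of P] EI(3) unfolding 3 by simp
    have "multi_ev x w r \<cdot> (Idn V (tensO V (map Hw [0..<r])) \<boxtimes> multi_ev x s k) =
        EO \<cdot> (reorder V ob1 (I @ S) P \<cdot> tensA V (map Fn (I @ S))) \<cdot> reorder V ob (I @ S @ X) IC"
      unfolding 1 mw ob1_def[symmetric] using arr1 arr3 tFn[of "I @ S"] EO(1) EOc
      by (simp add: comp_assoc del: map_append)
    also have "\<dots> = EO \<cdot> EI \<cdot> (reorder V ob IC Z \<cdot> reorder V ob (I @ S @ X) IC)"
      unfolding 2 3[symmetric] 4[symmetric] using arr2 arr3 tFn[of P] EO(1) EOc
      by (simp add: comp_assoc del: map_append)
    also have "\<dots> = F"
      unfolding F_def reorder_comp[OF r3 r4 obs] ..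
    finally show ?thesis .
  qed

  have right: "multi_ev x ws r \<cdot> (tensA V (map m [0..<r]) \<boxtimes> Idn V (opow x p)) \<cdot> (sort' \<boxtimes> Idn V (opow x p)) = F"
  proof -
    define Gn where "Gn = case_label m (\<lambda>_. Idn V x) (\<lambda>_. Idn V x)"
    define ob3 where "ob3 = case_label Hws (\<lambda>_. x) (\<lambda>_. x)"
    define ob4 where "ob4 = case_label (\<lambda>i. Hw i \<otimes> tensO V (map Hs (fib w i))) (\<lambda>_. x) (\<lambda>_. x)"
    have m: "m i \<in> Arr V" "Dom V (m i) = Hw i \<otimes> tensO V (map Hs (fib w i))" "Cod V (m i) = Hws i"
      "evws i \<cdot> (m i \<boxtimes> Idn V (opow x (arity ws i))) =
        evw i \<cdot> (Idn V (Hw i) \<boxtimes> multi_ev x (s' i) (arity w i))" for i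
      using op_mul_arr[OF x s'(1), of i] s'_map[of "ohom x" i]
      by (simp_all add: m_def Hw_def Hws_def Hs_def[abs_def] evw_def evws_def s'(2))
    have Gn: "Gn l \<in> Arr V" "Dom V (Gn l) = ob4 l" "Cod V (Gn l) = ob3 l" for l
      using x m by (simp_all add: Gn_def ob3_def ob4_def split: label.split)
    have ob34: "ob4 ` A \<subseteq> Obj V" "ob3 ` A \<subseteq> Obj V" for A
      using x by (auto simp: ob3_def ob4_def split: label.splits)
    note tGn = tensA_map[of _ Gn ob4 ob3, OF conjI[OF Gn(1) conjI[OF Gn(2,3)]]]
    have 1: "tensA V (map m [0..<r]) \<boxtimes> Idn V (opow x p) = tensA V (map Gn (I @ X))"
    proof -
      have "set (map Gn I) \<subseteq> Arr V" "set (map Gn X) \<subseteq> Arr V" using Gn by auto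
      moreover have "map Gn I = map m [0..<r]" "map Gn X = map (\<lambda>_. Idn V x) [0..<p]"
        by (simp_all add: I_def X_def Gn_def)
      ultimately show ?thesis
        using tensA_append[of "map Gn I" "map Gn X"] tensA_Idn[of "[0..<p]" "\<lambda>_. x"] x by simp
    qed
    have 2: "reorder V ob3 (I @ X) Q \<cdot> tensA V (map Gn (I @ X)) = tensA V (map Gn Q) \<cdot> reorder V ob4 (I @ X) Q"
      using r6 Gn by (intro reorder_natural) auto
    have 3: "tensA V (map Gn Q) = tensA V (map (\<lambda>i. m i \<boxtimes> Idn V (opow x (arity ws i))) [0..<r])"
    proof -
      have "map Gn Q = concat (map (\<lambda>i. m i # map (\<lambda>_. Idn V x) (fib ws i)) [0..<r])"
        by (simp add: Q_def map_concat comp_def Gn_def)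
      then have "tensA V (map Gn Q) = tensA V (map (\<lambda>i. m i \<boxtimes> tensA V (map (\<lambda>_. Idn V x) (fib ws i))) [0..<r])"
        using x m by (simp only:) (subst tensA_concat; auto)
      moreover have "tensA V (map (\<lambda>_. Idn V x) (fib ws i)) = Idn V (opow x (arity ws i))" for i
        using tensA_Idn[of "fib ws i" "\<lambda>_. x"] x by simp
      ultimately show ?thesis by simp
    qed
    have J_ob: "reorder V ob (J i) (K i) = Idn V (Hw i) \<boxtimes>
        reorder V ob (map Inner (fib w i) @ map Input (fib ws i)) (concat (map C (fib w i)))" for i
    proof -
      have "reorder V ob [Outer i] [Outer i] = Idn V (Hw i)"
        using reorder_refl[of "[Outer i]" ob] obs by (simp add: ob_def)
      then show ?thesis
        using reorder_append[OF _ rJ obs, of "[Outer i]" "[Outer i]" i]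
        by (auto simp: J_def K_def reorderable_def)
    qed
    have K_dom: "tensO V (map ob (K i)) = Dom V (ei i)" for i
      using C_ob by (simp add: K_def ob_def)
    have 4: "evws i \<cdot> (m i \<boxtimes> Idn V (opow x (arity ws i))) = evw i \<cdot> ei i \<cdot> reorder V ob (J i) (K i)" for i
    proof -
      have "tensO V (map ob (concat (map C (fib w i)))) = Dom V (tensA V (map evs (fib w i)))"
        using C_ob by simp
      then have "Idn V (Hw i) \<boxtimes> multi_ev x (s' i) (arity w i) = ei i \<cdot> reorder V ob (J i) (K i)"
        unfolding ms' J_ob ei_def using ra[OF rJ] by (intro whisker) auto
      then show ?thesis using m(4) by simp
    qed
    have "tensA V (map evws [0..<r]) \<cdot> tensA V (map Gn Q) = tensA V (map (\<lambda>i. evw i \<cdot> (ei i \<cdot> reorder V ob (J i) (K i))) [0..<r])"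
      unfolding 3 4[symmetric] using m by (intro tensA_comp) auto
    also have "\<dots> = EO \<cdot> tensA V (map (\<lambda>i. ei i \<cdot> reorder V ob (J i) (K i)) [0..<r])"
      unfolding EO_def using ra[OF r9] K_dom by (intro tensA_comp[symmetric]) auto
    also have "tensA V (map (\<lambda>i. ei i \<cdot> reorder V ob (J i) (K i)) [0..<r]) =
        EI \<cdot> tensA V (map (\<lambda>i. reorder V ob (J i) (K i)) [0..<r])"
      unfolding EI_def using ra[OF r9] K_dom by (intro tensA_comp[symmetric]) auto
    also have "tensA V (map (\<lambda>i. reorder V ob (J i) (K i)) [0..<r]) = reorder V ob Q' Z"
      unfolding Q'_def Z_def using r9 r8 obs
      by (intro reorder_concat[symmetric]) (auto simp: reorderable_def Q'_def)
    finally have 5: "tensA V (map evws [0..<r]) \<cdot> tensA V (map Gn Q) = EO \<cdot> EI \<cdot> reorder V ob Q' Z" .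
    have 6: "reorder V ob4 (I @ X) Q = reorder V ob (P @ X) Q'"
    proof -
      have "ob4 l = tensO V (map ob (blk' l))" if "l \<in> set (I @ X)" for l
      proof (cases l)
        case (Inner t)
        then show ?thesis using that by (auto simp: I_def X_def)
      qed (use x in \<open>simp_all add: ob4_def blk'_def ob_def comp_def\<close>)
      then show ?thesis
        using reorder_blocks[OF r6, of blk' ob ob4] dPX obs unfolding blkIX by blast
    qed
    have 7: "sort' \<boxtimes> Idn V (opow x p) = reorder V ob (I @ S @ X) (P @ X)"
    proof -
      have "map ob X = map (\<lambda>_. x) [0..<p]" by (simp add: X_def ob_def)
      then have "reorder V ob X X = Idn V (opow x p)"
        using reorder_refl[of X ob] rI(2) obs x by (simp add: reorderable_def)
      moreover have "set (I @ S) \<inter> set X = {}" by (auto simp: I_def S_def X_def)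
      ultimately show ?thesis
        using reorder_append[OF r1 rI(2) obs] by (simp add: sort'_def)
    qed
    have EV: "tensA V (map evws [0..<r]) \<in> Arr V" "Dom V (tensA V (map evws [0..<r])) = tensO V (map ob3 Q)"
    proof -
      note a = tensA_map[of "[0..<r]" evws "\<lambda>i. Hws i \<otimes> opow x (arity ws i)" "\<lambda>_. x"]
      have "map ob3 Q = concat (map (\<lambda>i. Hws i # map (\<lambda>_. x) (fib ws i)) [0..<r])"
        by (simp add: Q_def map_concat comp_def ob3_def)
      then have "tensO V (map ob3 Q) = tensO V (map (\<lambda>i. Hws i \<otimes> opow x (arity ws i)) [0..<r])"
        using x by (simp only:) (subst tensO_concat; auto)
      with a show "tensA V (map evws [0..<r]) \<in> Arr V" "Dom V (tensA V (map evws [0..<r])) = tensO V (map ob3 Q)"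
        by simp_all
    qed
    note arr3 = reorder_arr[OF r6 ob34(2)] and arr4 = reorder_arr[OF r6 ob34(1)]
    have arr7: "reorder V ob (I @ S @ X) (P @ X) \<in> Arr V" "Cod V (reorder V ob (I @ S @ X) (P @ X)) = tensO V (map ob4 (I @ X))"
      using ra[OF r7] ra[OF r8] arr4 unfolding 6 by auto
    have "multi_ev x ws r \<cdot> (tensA V (map m [0..<r]) \<boxtimes> Idn V (opow x p)) \<cdot> (sort' \<boxtimes> Idn V (opow x p)) =
        tensA V (map evws [0..<r]) \<cdot> (reorder V ob3 (I @ X) Q \<cdot> tensA V (map Gn (I @ X))) \<cdot> reorder V ob (I @ S @ X) (P @ X)"
      unfolding 1 7 mws ob3_def[symmetric] using arr3 arr7 tGn[of "I @ X"] EV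
      by (simp add: comp_assoc del: map_append)
    also have "\<dots> = (tensA V (map evws [0..<r]) \<cdot> tensA V (map Gn Q)) \<cdot> (reorder V ob (P @ X) Q' \<cdot> reorder V ob (I @ S @ X) (P @ X))"
      unfolding 2 6[symmetric] using arr4 arr7 tGn[of Q] EV
      by (simp add: comp_assoc del: map_append)
    also have "\<dots> = EO \<cdot> EI \<cdot> (reorder V ob Q' Z \<cdot> reorder V ob (I @ S @ X) Q')"
    proof -
      have "tensO V (map ob Z) = Dom V EI"
      proof -
        have "tensO V (map ob Z) = tensO V (map (\<lambda>i. tensO V (map ob (K i))) [0..<r])"
          unfolding Z_def map_concat using obs by (simp only: map_map comp_def) (subst tensO_concat; auto)
        then show ?thesis by (simp add: K_dom)
      qed
      then show ?thesis
        unfolding 5 reorder_comp[OF r7 r8 obs] using ra[OF rQZ] ra[OF reorderable_trans[OF r7 r8]]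
        by (simp add: comp_assoc)
    qed
    also have "\<dots> = F"
      unfolding F_def reorder_comp[OF reorderable_trans[OF r7 r8] rQZ obs] ..
    finally show ?thesis .
  qed

  have sort: "sort_sym V ([(0, ohom x r)] @ map (\<lambda>i. (Suc i, ohom x (arity w i))) [0..<r] @
      map (\<lambda>t. (Suc (w ! t), ohom x (arity s t))) [0..<k]) = Idn V (ohom x r) \<boxtimes> sort'"
  proof -
    \<comment> \<open>\<open>None\<close> labels the hom of the outermost operation, whose key 0 keeps it in front.\<close>
    define \<kappa> where "\<kappa> z = (case z of None \<Rightarrow> 0 | Some l \<Rightarrow> Suc (case l of Outer i \<Rightarrow> i | Inner t \<Rightarrow> w ! t | Input t \<Rightarrow> t))" for z
    define ob' where "ob' z = (case z of None \<Rightarrow> ohom x r | Some l \<Rightarrow> ob l)" for z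
    let ?L = "None # map Some (I @ S)"
    have d: "distinct ?L" using r1 by (auto simp: reorderable_def distinct_map)
    have ob': "ob' ` A \<subseteq> Obj V" for A
      using x by (auto simp: ob'_def split: option.splits)
    have f: "filter (\<lambda>z. \<kappa> z = Suc i) ?L = map Some (Outer i # map Inner (fib w i))" if "i < r" for i
      using that by (simp add: filter_map comp_def \<kappa>_def I_def S_def fib_def k_def filter_eq_upt)
    have f0: "filter (\<lambda>z. \<kappa> z = 0) ?L = [None]"
      by (simp add: \<kappa>_def filter_map comp_def)
    have "\<kappa> z < Suc r" if "z \<in> set ?L" for z
    proof -
      have "w ! t < r" if "t < k" for t
        using that w nth_mem[of t w] by (auto simp: k_def simp del: nth_mem)
      then show ?thesis using that by (auto simp: \<kappa>_def I_def S_def)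
    qed
    then have "sort_key \<kappa> ?L = concat (map (\<lambda>c. filter (\<lambda>z. \<kappa> z = c) ?L) [0..<Suc r])"
      by (rule sort_key_by_value)
    also have "[0..<Suc r] = 0 # map Suc [0..<r]"
      by (simp only: upt_conv_Cons[OF zero_less_Suc] map_Suc_upt)
    also have "concat (map (\<lambda>c. filter (\<lambda>z. \<kappa> z = c) ?L) (0 # map Suc [0..<r])) =
        None # concat (map (\<lambda>i. map Some (Outer i # map Inner (fib w i))) [0..<r])"
      using f f0 by (auto simp del: filter.simps intro!: arg_cong[where f = concat])
    also have "\<dots> = None # map Some P" by (simp add: P_def map_concat comp_def)
    finally have sk: "sort_key \<kappa> ?L = None # map Some P" .
    have "[(0, ohom x r)] @ map (\<lambda>i. (Suc i, ohom x (arity w i))) [0..<r] @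
      map (\<lambda>t. (Suc (w ! t), ohom x (arity s t))) [0..<k] = map (\<lambda>z. (\<kappa> z, ob' z)) ?L"
      by (simp add: \<kappa>_def ob'_def I_def S_def ob_def Hw_def Hs_def comp_def)
    then have "sort_sym V ([(0, ohom x r)] @ map (\<lambda>i. (Suc i, ohom x (arity w i))) [0..<r] @
      map (\<lambda>t. (Suc (w ! t), ohom x (arity s t))) [0..<k]) = reorder V ob' ([None] @ map Some (I @ S)) ([None] @ map Some P)"
      using sort_sym_eq_reorder[OF d, of \<kappa> ob'] sk by simp
    also have "\<dots> = reorder V ob' [None] [None] \<boxtimes> reorder V ob' (map Some (I @ S)) (map Some P)"
      using r1 ob' by (intro reorder_append) (auto simp: reorderable_def distinct_map)
    also have "reorder V ob' [None] [None] = Idn V (ohom x r)"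
      using reorder_refl[of "[None]" ob'] ob' x by (simp add: ob'_def)
    also have "reorder V ob' (map Some (I @ S)) (map Some P) = sort'"
      unfolding sort'_def using ob' by (intro reorder_relabel[OF r1]) (auto simp: ob'_def)
    finally show ?thesis .
  qed

  have HsT: "tensO V (map (\<lambda>t. ohom x (arity s t)) [0..<k]) = tensO V (map Hs [0..<k])"
    by (simp add: Hs_def[abs_def])
  have A: "op_mul x s k \<in> Arr V" "Dom V (op_mul x s k) = ohom x k \<otimes> tensO V (map Hs [0..<k])"
    "Cod V (op_mul x s k) = ohom x p"
    "oev x p \<cdot> (op_mul x s k \<boxtimes> Idn V (opow x p)) = oev x k \<cdot> (Idn V (ohom x k) \<boxtimes> multi_ev x s k)"
    using op_mul_arr[OF x s_k] by (simp_all add: Hs_def[abs_def] p_def)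
  have B: "op_mul x w r \<in> Arr V" "Dom V (op_mul x w r) = ohom x r \<otimes> tensO V (map Hw [0..<r])"
    "Cod V (op_mul x w r) = ohom x k"
    "oev x k \<cdot> (op_mul x w r \<boxtimes> Idn V (opow x k)) = oev x r \<cdot> (Idn V (ohom x r) \<boxtimes> multi_ev x w r)"
    using op_mul_arr[OF x w] by (simp_all add: Hw_def[abs_def] k_def)
  have D: "op_mul x ws r \<in> Arr V" "Dom V (op_mul x ws r) = ohom x r \<otimes> tensO V (map Hws [0..<r])"
    "Cod V (op_mul x ws r) = ohom x p"
    "oev x p \<cdot> (op_mul x ws r \<boxtimes> Idn V (opow x p)) = oev x r \<cdot> (Idn V (ohom x r) \<boxtimes> multi_ev x ws r)"
    using op_mul_arr[OF x ws(1)] by (simp_all add: Hws_def[abs_def] ws(2))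
  have mS: "multi_ev x s k \<in> Arr V" "Dom V (multi_ev x s k) = tensO V (map Hs [0..<k]) \<otimes> opow x p"
    "Cod V (multi_ev x s k) = opow x k"
    using multi_ev_arr[OF x s_k] by (simp_all add: Hs_def[abs_def] p_def)
  have mW: "multi_ev x w r \<in> Arr V" "Dom V (multi_ev x w r) = tensO V (map Hw [0..<r]) \<otimes> opow x k"
    "Cod V (multi_ev x w r) = opow x r"
    using multi_ev_arr[OF x w] by (simp_all add: Hw_def[abs_def] k_def)
  have mWS: "multi_ev x ws r \<in> Arr V" "Dom V (multi_ev x ws r) = tensO V (map Hws [0..<r]) \<otimes> opow x p"
    "Cod V (multi_ev x ws r) = opow x r"
    using multi_ev_arr[OF x ws(1)] by (simp_all add: Hws_def[abs_def] ws(2))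
  have M: "tensA V (map m [0..<r]) \<in> Arr V" "Cod V (tensA V (map m [0..<r])) = tensO V (map Hws [0..<r])"
    "Dom V (tensA V (map m [0..<r])) = tensO V (map (\<lambda>i. Hw i \<otimes> tensO V (map Hs (fib w i))) [0..<r])"
  proof -
    have m: "m i \<in> Arr V" "Dom V (m i) = Hw i \<otimes> tensO V (map Hs (fib w i))" "Cod V (m i) = Hws i" for i
      using op_mul_arr[OF x s'(1), of i] s'_map[of "ohom x" i]
      by (simp_all add: m_def Hw_def Hws_def Hs_def[abs_def] s'(2))
    then show "tensA V (map m [0..<r]) \<in> Arr V" "Cod V (tensA V (map m [0..<r])) = tensO V (map Hws [0..<r])"
      "Dom V (tensA V (map m [0..<r])) = tensO V (map (\<lambda>i. Hw i \<otimes> tensO V (map Hs (fib w i))) [0..<r])"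
      using tensA_map[of "[0..<r]" m "\<lambda>i. Hw i \<otimes> tensO V (map Hs (fib w i))" Hws] by simp_all
  qed
  have S': "sort' \<in> Arr V" "Dom V sort' = tensO V (map Hw [0..<r]) \<otimes> tensO V (map Hs [0..<k])"
    "Cod V sort' = tensO V (map (\<lambda>i. Hw i \<otimes> tensO V (map Hs (fib w i))) [0..<r])"
  proof -
    have "map ob (I @ S) = map Hw [0..<r] @ map Hs [0..<k]" by (simp add: I_def S_def ob_def)
    moreover have "tensO V (map Hw [0..<r] @ map Hs [0..<k]) = tensO V (map Hw [0..<r]) \<otimes> tensO V (map Hs [0..<k])"
      by (rule tensO_append) auto
    moreover have "map ob P = concat (map (\<lambda>i. Hw i # map Hs (fib w i)) [0..<r])"
      by (simp add: P_def map_concat comp_def ob_def)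
    then have "tensO V (map ob P) = tensO V (map (\<lambda>i. Hw i \<otimes> tensO V (map Hs (fib w i))) [0..<r])"
      by (simp only:) (subst tensO_concat; auto)
    ultimately show "sort' \<in> Arr V" "Dom V sort' = tensO V (map Hw [0..<r]) \<otimes> tensO V (map Hs [0..<k])"
      "Cod V sort' = tensO V (map (\<lambda>i. Hw i \<otimes> tensO V (map Hs (fib w i))) [0..<r])"
      using ra[OF r1] unfolding sort'_def by (simp_all only:)
  qed
  note [simp] = A(1-3) B(1-3) D(1-3) mS mW mWS M S' opow_simps[OF x] oev_arr[OF x] ohom_obj[OF x]
  have "oev x p \<cdot> ((op_mul x s k \<cdot> (op_mul x w r \<boxtimes> Idn V (tensO V (map Hs [0..<k])))) \<boxtimes> Idn V (opow x p)) =
      (oev x p \<cdot> (op_mul x s k \<boxtimes> Idn V (opow x p))) \<cdot>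
      (op_mul x w r \<boxtimes> Idn V (tensO V (map Hs [0..<k]) \<otimes> opow x p))"
    by (simp add: whisker comp_assoc ten_Idn)
  also have "\<dots> = oev x k \<cdot> ((Idn V (ohom x k) \<boxtimes> multi_ev x s k) \<cdot>
      (op_mul x w r \<boxtimes> Idn V (tensO V (map Hs [0..<k]) \<otimes> opow x p)))"
    unfolding A(4) by (simp add: comp_assoc)
  also have "(Idn V (ohom x k) \<boxtimes> multi_ev x s k) \<cdot> (op_mul x w r \<boxtimes> Idn V (tensO V (map Hs [0..<k]) \<otimes> opow x p)) =
      (op_mul x w r \<boxtimes> Idn V (opow x k)) \<cdot> (Idn V (ohom x r \<otimes> tensO V (map Hw [0..<r])) \<boxtimes> multi_ev x s k)"
    by (simp add: interchange)
  also have "oev x k \<cdot> \<dots> = (oev x r \<cdot> (Idn V (ohom x r) \<boxtimes> multi_ev x w r)) \<cdot>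
      (Idn V (ohom x r \<otimes> tensO V (map Hw [0..<r])) \<boxtimes> multi_ev x s k)"
    unfolding B(4)[symmetric] by (simp add: comp_assoc)
  also have "\<dots> = oev x r \<cdot> (Idn V (ohom x r) \<boxtimes>
      (multi_ev x w r \<cdot> (Idn V (tensO V (map Hw [0..<r])) \<boxtimes> multi_ev x s k)))"
    by (simp add: whisker comp_assoc ten_Idn[symmetric])
  also have "\<dots> = oev x r \<cdot> (Idn V (ohom x r) \<boxtimes> (multi_ev x ws r \<cdot>
      (tensA V (map m [0..<r]) \<boxtimes> Idn V (opow x p)) \<cdot> (sort' \<boxtimes> Idn V (opow x p))))"
    unfolding left right ..
  also have "\<dots> = (oev x r \<cdot> (Idn V (ohom x r) \<boxtimes> multi_ev x ws r)) \<cdot>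
      ((Idn V (ohom x r) \<boxtimes> tensA V (map m [0..<r])) \<boxtimes> Idn V (opow x p)) \<cdot>
      ((Idn V (ohom x r) \<boxtimes> sort') \<boxtimes> Idn V (opow x p))"
    by (simp add: whisker comp_assoc)
  also have "\<dots> = oev x p \<cdot> ((op_mul x ws r \<cdot> (Idn V (ohom x r) \<boxtimes> tensA V (map m [0..<r])) \<cdot>
      (Idn V (ohom x r) \<boxtimes> sort')) \<boxtimes> Idn V (opow x p))"
    unfolding D(4)[symmetric] by (simp add: whisker comp_assoc)
  finally have eq: "oev x p \<cdot> ((op_mul x s k \<cdot> (op_mul x w r \<boxtimes> Idn V (tensO V (map Hs [0..<k])))) \<boxtimes> Idn V (opow x p)) =
      oev x p \<cdot> ((op_mul x ws r \<cdot> (Idn V (ohom x r) \<boxtimes> tensA V (map m [0..<r])) \<cdot>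
      (Idn V (ohom x r) \<boxtimes> sort')) \<boxtimes> Idn V (opow x p))" .
  have "op_mul x s k \<cdot> (op_mul x w r \<boxtimes> Idn V (tensO V (map Hs [0..<k]))) =
      op_mul x ws r \<cdot> (Idn V (ohom x r) \<boxtimes> tensA V (map m [0..<r])) \<cdot> (Idn V (ohom x r) \<boxtimes> sort')"
    by (rule op_mul_eqI[OF _ _ _ _ _ eq]) simp_all
  then show ?thesis unfolding sort HsT m_def .
qed

end

end

section \<open>Units and the isomorphism\<close>

lemma fib_upt: "i < p \<Longrightarrow> fib [0..<p] i = [i]"
proof -
  assume "i < p"
  moreover have "fib [0..<p] i = filter (\<lambda>v. v = i) [0..<p]"
    unfolding fib_def by (auto intro!: filter_cong)
  ultimately show ?thesis by (simp add: filter_eq_upt)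
qed

lemma fib_replicate: "fib (replicate p 0) 0 = [0..<p]"
  by (auto simp: fib_def filter_id_conv)

lemma Outer_Input_disjoint [simp]: "Outer ` A \<inter> Input ` B = {}"
  by auto

context strict_closed_smc
begin

definition unit_arr :: "'o \<Rightarrow> 'a" where
  "unit_arr x = curry_arr V (Unit V) x x (Idn V x)"

context
  fixes x :: 'o
  assumes x [simp]: "x \<in> Obj V"
begin

lemmas power_hom_simps [simp] = opow_simps[OF x] opow_1[OF x] oev_arr[OF x] ohom_obj[OF x]

lemma unit_arr [simp]:
  "unit_arr x \<in> Arr V" "Dom V (unit_arr x) = Unit V" "Cod V (unit_arr x) = ohom x (Suc 0)"
  "oev x (Suc 0) \<cdot> (unit_arr x \<boxtimes> Idn V x) = Idn V x"
  using curry_arr_props[of x x "Unit V" "Idn V x"]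
  by (simp_all add: unit_arr_def ohom_def oev_def)

text \<open>
  Evaluating identities amounts to inserting unit objects between the inputs, which by
  expanding their labels into empty blocks does nothing.
\<close>

lemma op_mul_unit_right:
  "op_mul x [0..<p] p \<cdot> (Idn V (ohom x p) \<boxtimes> tensA V (replicate p (unit_arr x))) = Idn V (ohom x p)"
proof -
  let ?s = "[0..<p]" and ?u = "unit_arr x"
  have s: "set ?s \<subseteq> {..<p}" by auto
  define Y X C where "Y = map Outer [0..<p]" and "X = map Input [0..<p]"
    and "C = concat (map (\<lambda>i. [Outer i, Input i]) [0..<p])"
  have C: "concat (map (\<lambda>i. Outer i # map Input (fib ?s i)) [0..<p]) = C"
    unfolding C_def by (intro arg_cong[where f = concat]) (auto simp: fib_upt)
  have len: "map (\<lambda>i. g (arity ?s i)) [0..<p] = map (\<lambda>i. g (Suc 0)) [0..<p]" for g :: "nat \<Rightarrow> 'z"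
    by (auto simp: fib_upt)
  have r: "reorderable (Y @ X) C"
    using reorderable_interleave[OF s, of Outer Input] unfolding C Y_def X_def by (simp add: inj_on_def image_iff)
  define ob where "ob l = (case l of Outer i \<Rightarrow> ohom x (Suc 0) | _ \<Rightarrow> x)" for l
  define ob' where "ob' l = (case l of Outer i \<Rightarrow> Unit V | _ \<Rightarrow> x)" for l
  define Gn where "Gn l = (case l of Outer i \<Rightarrow> ?u | _ \<Rightarrow> Idn V x)" for l
  have Gn: "Gn l \<in> Arr V" "Dom V (Gn l) = ob' l" "Cod V (Gn l) = ob l" for l
    by (simp_all add: Gn_def ob_def ob'_def split: label.split)
  have obs: "ob ` A \<subseteq> Obj V" "ob' ` A \<subseteq> Obj V" for A
    by (auto simp: ob_def ob'_def split: label.splits)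
  note tGn = tensA_map[of _ Gn ob' ob, OF conjI[OF Gn(1) conjI[OF Gn(2,3)]]]
  have m: "multi_ev x ?s p = tensA V (map (\<lambda>i. oev x (Suc 0)) [0..<p]) \<cdot> reorder V ob (Y @ X) C"
    using multi_ev_eq[OF x s, of Outer Input ob] fib_upt unfolding C Y_def X_def len
    by (simp add: inj_on_def image_iff ob_def)
  have 1: "tensA V (replicate p ?u) \<boxtimes> Idn V (opow x p) = tensA V (map Gn (Y @ X))"
  proof -
    have "set (map Gn Y) \<subseteq> Arr V" "set (map Gn X) \<subseteq> Arr V" using Gn by auto
    moreover have "map Gn Y = replicate p ?u" "map Gn X = map (\<lambda>_. Idn V x) [0..<p]"
      by (simp_all add: Y_def X_def Gn_def comp_def map_replicate_const)
    ultimately show ?thesis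
      using tensA_append[of "map Gn Y" "map Gn X"] tensA_Idn[of "[0..<p]" "\<lambda>_. x"] by simp
  qed
  have 2: "reorder V ob (Y @ X) C \<cdot> tensA V (map Gn (Y @ X)) = tensA V (map Gn C) \<cdot> reorder V ob' (Y @ X) C"
    using r Gn by (intro reorder_natural) auto
  have 3: "tensA V (map (\<lambda>i. oev x (Suc 0)) [0..<p]) \<cdot> tensA V (map Gn C) = Idn V (opow x p)"
  proof -
    have "map Gn C = concat (map (\<lambda>i. [?u, Idn V x]) [0..<p])"
      by (simp add: C_def map_concat comp_def Gn_def)
    then have "tensA V (map Gn C) = tensA V (map (\<lambda>i. ?u \<boxtimes> Idn V x) [0..<p])"
      by (simp only:) (subst tensA_concat; simp)
    then have "tensA V (map (\<lambda>i. oev x (Suc 0)) [0..<p]) \<cdot> tensA V (map Gn C) =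
        tensA V (map (\<lambda>i. oev x (Suc 0) \<cdot> (?u \<boxtimes> Idn V x)) [0..<p])"
      by (simp only:) (rule tensA_comp; simp)
    then show ?thesis using tensA_Idn[of "[0..<p]" "\<lambda>_. x"] by simp
  qed
  have 4: "reorder V ob' (Y @ X) C = Idn V (opow x p)"
  proof -
    define blk where "blk l = (case l of Outer i \<Rightarrow> [] | _ \<Rightarrow> [l])" for l
    have b: "concat (map blk (Y @ X)) = X" "concat (map blk C) = X"
      by (simp_all add: Y_def X_def C_def blk_def map_concat comp_def concat_of_concat concat_map_singleton)
    have d: "distinct X" by (auto simp: X_def distinct_map inj_on_def)
    have "ob' l = tensO V (map (\<lambda>_. x) (blk l))" for l
      by (cases l) (simp_all add: ob'_def blk_def opow_def)
    then have "reorder V ob' (Y @ X) C = reorder V (\<lambda>_. x) X X"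
      using reorder_blocks[OF r, of blk "\<lambda>_. x" ob'] d unfolding b by (auto simp: image_subset_iff)
    moreover have "reorder V (\<lambda>_. x) X X = Idn V (tensO V (map (\<lambda>_. x) X))"
      using d by (intro reorder_refl) auto
    ultimately show ?thesis by (simp add: X_def comp_def)
  qed
  note ra = reorder_arr[OF r obs(1)]
  have E: "tensA V (map (\<lambda>i. oev x (Suc 0)) [0..<p]) \<in> Arr V"
    "Dom V (tensA V (map (\<lambda>i. oev x (Suc 0)) [0..<p])) = tensO V (map ob C)"
  proof -
    note a = tensA_map[of "[0..<p]" "\<lambda>i. oev x (Suc 0)" "\<lambda>i. ohom x (Suc 0) \<otimes> x" "\<lambda>_. x"]
    have "map ob C = concat (map (\<lambda>i. [ohom x (Suc 0), x]) [0..<p])"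
      by (simp add: C_def map_concat comp_def ob_def)
    then have "tensO V (map ob C) = tensO V (map (\<lambda>i. ohom x (Suc 0) \<otimes> x) [0..<p])"
      by (simp only:) (subst tensO_concat; simp)
    with a show "tensA V (map (\<lambda>i. oev x (Suc 0)) [0..<p]) \<in> Arr V"
      "Dom V (tensA V (map (\<lambda>i. oev x (Suc 0)) [0..<p])) = tensO V (map ob C)" by simp_all
  qed
  have "tensO V (map ob' C) = Cod V (reorder V ob' (Y @ X) C)"
    using reorder_arr[OF r obs(2)] by simp
  then have C_ob': "tensO V (map ob' C) = opow x p"
    unfolding 4 by simp
  have key: "multi_ev x ?s p \<cdot> (tensA V (replicate p ?u) \<boxtimes> Idn V (opow x p)) = Idn V (opow x p)"
  proof -
    have "multi_ev x ?s p \<cdot> (tensA V (replicate p ?u) \<boxtimes> Idn V (opow x p)) =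
        tensA V (map (\<lambda>i. oev x (Suc 0)) [0..<p]) \<cdot> tensA V (map Gn C) \<cdot> reorder V ob' (Y @ X) C"
      unfolding m 1 2[symmetric] using ra E tGn[of "Y @ X"] by (simp add: comp_assoc del: map_append)
    also have "\<dots> = tensA V (map (\<lambda>i. oev x (Suc 0)) [0..<p]) \<cdot> tensA V (map Gn C)"
      unfolding 4 using tGn[of C] C_ob' by simp
    finally show ?thesis unfolding 3 .
  qed
  have D: "op_mul x ?s p \<in> Arr V" "Dom V (op_mul x ?s p) = ohom x p \<otimes> tensO V (replicate p (ohom x (Suc 0)))"
    "Cod V (op_mul x ?s p) = ohom x p"
    "oev x p \<cdot> (op_mul x ?s p \<boxtimes> Idn V (opow x p)) = oev x p \<cdot> (Idn V (ohom x p) \<boxtimes> multi_ev x ?s p)"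
    using op_mul_arr[OF x s] unfolding len by (simp_all add: map_replicate_const)
  have M: "multi_ev x ?s p \<in> Arr V" "Dom V (multi_ev x ?s p) = tensO V (replicate p (ohom x (Suc 0))) \<otimes> opow x p"
    "Cod V (multi_ev x ?s p) = opow x p"
    using multi_ev_arr[OF x s] unfolding len by (simp_all add: map_replicate_const)
  have U: "tensA V (replicate p ?u) \<in> Arr V" "Dom V (tensA V (replicate p ?u)) = Unit V"
    "Cod V (tensA V (replicate p ?u)) = tensO V (replicate p (ohom x (Suc 0)))"
    by (induction p) simp_all
  note [simp] = D(1-3) M U
  show ?thesis
  proof (rule op_mul_eqI[OF x, where p = p])
    have "oev x p \<cdot> ((op_mul x ?s p \<cdot> (Idn V (ohom x p) \<boxtimes> tensA V (replicate p ?u))) \<boxtimes> Idn V (opow x p)) =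
        (oev x p \<cdot> (op_mul x ?s p \<boxtimes> Idn V (opow x p))) \<cdot>
        (Idn V (ohom x p) \<boxtimes> tensA V (replicate p ?u) \<boxtimes> Idn V (opow x p))"
      by (simp add: whisker comp_assoc)
    also have "\<dots> = oev x p \<cdot> (Idn V (ohom x p) \<boxtimes>
        (multi_ev x ?s p \<cdot> (tensA V (replicate p ?u) \<boxtimes> Idn V (opow x p))))"
      unfolding D(4) by (simp add: whisker comp_assoc)
    finally show "oev x p \<cdot> ((op_mul x ?s p \<cdot> (Idn V (ohom x p) \<boxtimes> tensA V (replicate p ?u))) \<boxtimes> Idn V (opow x p)) =
      oev x p \<cdot> (Idn V (ohom x p) \<boxtimes> Idn V (opow x p))"
      unfolding key .
  qed simp_all
qed

text \<open>
  There is one hom, already in front of all inputs, so the reordering is trivial.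
\<close>

lemma op_mul_unit_left:
  "op_mul x (replicate p 0) (Suc 0) \<cdot> (unit_arr x \<boxtimes> Idn V (ohom x p)) = Idn V (ohom x p)"
proof -
  let ?s = "replicate p (0::nat)" and ?u = "unit_arr x"
  have s: "set ?s \<subseteq> {..<Suc 0}" by auto
  define ob where "ob l = (case l of Outer i \<Rightarrow> ohom x p | _ \<Rightarrow> x)" for l
  let ?L = "Outer 0 # map Input [0..<p]"
  have "multi_ev x ?s (Suc 0) = oev x p \<cdot> reorder V ob ?L ?L"
    using multi_ev_eq[OF x s, of Outer Input ob] by (simp add: fib_replicate inj_on_def ob_def image_iff)
  moreover have "reorder V ob ?L ?L = Idn V (tensO V (map ob ?L))"
    by (rule reorder_refl) (auto simp: ob_def distinct_map inj_on_def)
  moreover have "map ob ?L = ohom x p # map (\<lambda>_. x) [0..<p]" by (simp add: ob_def)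
  ultimately have "multi_ev x ?s (Suc 0) = oev x p \<cdot> Idn V (tensO V (ohom x p # map (\<lambda>_. x) [0..<p]))"
    by (simp only:)
  then have m: "multi_ev x ?s (Suc 0) = oev x p" by simp
  have D: "op_mul x ?s (Suc 0) \<in> Arr V" "Dom V (op_mul x ?s (Suc 0)) = ohom x (Suc 0) \<otimes> ohom x p"
    "Cod V (op_mul x ?s (Suc 0)) = ohom x p"
    "oev x p \<cdot> (op_mul x ?s (Suc 0) \<boxtimes> Idn V (opow x p)) = oev x (Suc 0) \<cdot> (Idn V (ohom x (Suc 0)) \<boxtimes> oev x p)"
    using op_mul_arr[OF x s] m by (simp_all add: fib_replicate)
  note [simp] = D(1-3)
  show ?thesis
  proof (rule op_mul_eqI[OF x, where p = p])
    have "oev x p \<cdot> ((op_mul x ?s (Suc 0) \<cdot> (?u \<boxtimes> Idn V (ohom x p))) \<boxtimes> Idn V (opow x p)) =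
        (oev x p \<cdot> (op_mul x ?s (Suc 0) \<boxtimes> Idn V (opow x p))) \<cdot> (?u \<boxtimes> Idn V (ohom x p \<otimes> opow x p))"
      by (simp add: whisker comp_assoc ten_Idn)
    also have "\<dots> = oev x (Suc 0) \<cdot> ((Idn V (ohom x (Suc 0)) \<boxtimes> oev x p) \<cdot> (?u \<boxtimes> Idn V (ohom x p \<otimes> opow x p)))"
      unfolding D(4) by (simp add: comp_assoc)
    also have "(Idn V (ohom x (Suc 0)) \<boxtimes> oev x p) \<cdot> (?u \<boxtimes> Idn V (ohom x p \<otimes> opow x p)) = (?u \<boxtimes> Idn V x) \<cdot> oev x p"
      using interchange[of "Idn V (Unit V)" ?u "oev x p" "Idn V x"] by (simp add: interchange)
    also have "oev x (Suc 0) \<cdot> \<dots> = oev x p"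
      using unit_arr(4) by (simp add: comp_assoc[symmetric])
    finally show "oev x p \<cdot> ((op_mul x ?s (Suc 0) \<cdot> (?u \<boxtimes> Idn V (ohom x p))) \<boxtimes> Idn V (opow x p)) =
        oev x p \<cdot> (Idn V (ohom x p) \<boxtimes> Idn V (opow x p))"
      by (simp add: ten_Idn)
  qed simp_all
qed

text \<open>
  The operad axioms for trees reduce to those for maps of tips, since the objects depend only on the
  numbers of tips and since a morphism restricted to fibres restricts the map on tips.
\<close>

lemma is_n_operadI:
  assumes ob: "\<And>T. is_tree n T \<Longrightarrow> NOb A T = ohom x (tips T)"
    and mul: "\<And>T S \<sigma>. is_tmor n T S \<sigma> \<Longrightarrow> NMul A T S \<sigma> = op_mul x (last \<sigma>) (tips S)"
    and unit: "NUnit A = unit_arr x"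
  shows "is_n_operad n V A"
proof -
  have fib: "map (NOb A) (fibres T S \<sigma>) = map (\<lambda>i. ohom x (arity (last \<sigma>) i)) [0..<tips S]"
    if "is_tmor n T S \<sigma>" for T S \<sigma>
    using that by (simp add: fibres_def ob is_tree_fibre tips_fibre)
  have assoc: "n_operad_assoc V A T S R \<sigma> \<omega>" if \<sigma>: "is_tmor n T S \<sigma>" and \<omega>: "is_tmor n S R \<omega>" for T S R \<sigma> \<omega>
  proof -
    let ?s = "last \<sigma>" and ?w = "last \<omega>"
    note \<omega>\<sigma> = is_tmor_comp[OF \<sigma> \<omega>]
    have s: "set ?s \<subseteq> {..<length ?w}" "length ?w = tips S" and w: "set ?w \<subseteq> {..<tips R}"
      using last_tmor_range[OF \<sigma>] last_tmor_range[OF \<omega>] by simp_all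
    note main = op_mul_assoc[OF x s(1) w, unfolded s(2)]
    have m1: "map (\<lambda>i. NMul A (fibre T R (comp_tmor \<omega> \<sigma>) i) (fibre S R \<omega> i) (fibre_tmor R \<omega> \<sigma> i)) [0..<tips R] =
      map (\<lambda>i. op_mul x (map (\<lambda>v. pos (fib ?w i) (?s ! v)) (fib (map ((!) ?w) ?s) i)) (arity ?w i)) [0..<tips R]"
      using mul[OF is_tmor_fibre_tmor[OF \<sigma> \<omega>]] tips_fibre[OF \<omega>]
      by (simp add: last_fibre_tmor[OF \<sigma> \<omega>] last_comp_tmor[OF \<sigma> \<omega>])
    have m2: "map (\<lambda>i. (Suc i, NOb A (fibre S R \<omega> i))) [0..<tips R] =
        map (\<lambda>i. (Suc i, ohom x (arity ?w i))) [0..<tips R]"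
      using \<omega> by (simp add: ob is_tree_fibre tips_fibre)
    have m3: "map (\<lambda>t. (Suc (?w ! t), NOb A (fibre T S \<sigma> t))) [0..<tips S] =
        map (\<lambda>t. (Suc (?w ! t), ohom x (arity ?s t))) [0..<tips S]"
      using \<sigma> by (simp add: ob is_tree_fibre tips_fibre)
    show ?thesis
      unfolding n_operad_assoc_def mul[OF \<sigma>] mul[OF \<omega>] mul[OF \<omega>\<sigma>] fib[OF \<sigma>]
        ob[OF is_tmorD(2)[OF \<omega>]] last_comp_tmor[OF \<sigma> \<omega>] m1 m2 m3 by (rule main)
  qed
  have "NMul A T T (id_tmor T) \<cdot> (Idn V (NOb A T) \<boxtimes> tensA V (replicate (tips T) (NUnit A))) = Idn V (NOb A T)"
    if T: "is_tree n T" for T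
  proof -
    have "last (id_tmor T) = [0..<tips T]"
      by (simp add: id_tmor_def tips_def)
    then show ?thesis
      using op_mul_unit_right[of "tips T"] mul[OF is_tmor_id[OF T]] ob[OF T] unit by simp
  qed
  moreover have "NMul A T (U_tree n) (to_U T) \<cdot> (NUnit A \<boxtimes> Idn V (NOb A T)) = Idn V (NOb A T)"
    if T: "is_tree n T" for T
  proof -
    have "last (to_U T) = replicate (tips T) 0"
      by (simp add: to_U_def tips_def)
    then show ?thesis
      using op_mul_unit_left[of "tips T"] mul[OF is_tmor_to_U[OF T]] ob[OF T] unit by (simp add: tips_U)
  qed
  moreover have "NMul A T S \<sigma> \<in> homs V (NOb A S \<otimes> tensO V (map (NOb A) (fibres T S \<sigma>))) (NOb A T)"
    if \<sigma>: "is_tmor n T S \<sigma>" for T S \<sigma>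
    using op_mul_arr[OF x last_tmor_range(2)[OF \<sigma>]] last_tmor_range(1)[OF \<sigma>]
    by (simp add: homs_iff mul[OF \<sigma>] fib[OF \<sigma>] ob is_tmorD(1,2)[OF \<sigma>])
  moreover have "NUnit A \<in> homs V (Unit V) (NOb A (U_tree n))"
    using ob[OF is_tree_U] unit by (simp add: homs_iff tips_U)
  ultimately show ?thesis
    unfolding is_n_operad_def using assoc ob by auto
qed

lemma reorder_grp_inverse:
  assumes s: "set s \<subseteq> {..<k}"
  defines "g \<equiv> reorder V (\<lambda>_. x) [0..<length s] (grp s k)" and "h \<equiv> reorder V (\<lambda>_. x) (grp s k) [0..<length s]"
  shows "g \<in> Arr V" "Dom V g = opow x (length s)" "Cod V g = opow x (length s)"
    "h \<in> Arr V" "Dom V h = opow x (length s)" "Cod V h = opow x (length s)"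
    "g \<cdot> h = Idn V (opow x (length s))" "h \<cdot> g = Idn V (opow x (length s))"
proof -
  have r: "reorderable (grp s k) [0..<length s]" by (rule reorderable_grp[OF s])
  note r' = reorderable_sym[OF r]
  have o: "(\<lambda>_. x) ` A \<subseteq> Obj V" for A :: "nat set" by auto
  have d: "distinct (grp s k)" "length (grp s k) = length s" using grp_simps[OF s] by auto
  show "g \<in> Arr V" "Dom V g = opow x (length s)" "Cod V g = opow x (length s)"
    "h \<in> Arr V" "Dom V h = opow x (length s)" "Cod V h = opow x (length s)"
    using reorder_arr[OF r o] reorder_arr[OF r' o] d by (simp_all add: g_def h_def)
  show "g \<cdot> h = Idn V (opow x (length s))" "h \<cdot> g = Idn V (opow x (length s))"
    using reorder_comp[OF r r' o] reorder_comp[OF r' r o] reorder_refl[OF d(1) o]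
      reorder_refl[of "[0..<length s]", OF _ o] d(2)
    by (simp_all add: g_def h_def)
qed

text \<open>
  \<open>Des\<^sub>n\<close> acts by \<open>\<pi>(\<sigma>)\<^sup>-\<^sup>1\<close>, and the action of \<open>\<theta>\<close> is the inverse of precomposition with \<open>\<theta>\<^sub>*\<close>; together
  this is precomposition with the symmetry of \<open>\<pi>(\<sigma>)\<close>.
\<close>

lemma NMul_Des:
  assumes \<sigma>: "is_tmor n T S \<sigma>"
  shows "NMul (Des V (End_sym V x)) T S \<sigma> = op_mul x (last \<sigma>) (tips S)"
proof -
  let ?s = "last \<sigma>" and ?k = "tips S"
  have s: "set ?s \<subseteq> {..<?k}" "length ?s = tips T" using last_tmor_range[OF \<sigma>] by simp_all
  note g = reorder_grp_inverse[OF s(1)]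
  let ?g = "reorder V (\<lambda>_. x) [0..<length ?s] (grp ?s ?k)" and ?h = "reorder V (\<lambda>_. x) (grp ?s ?k) [0..<length ?s]"
  have "perm_sym V x (tips T) (inv (perm_part ?s)) = ?h"
    using perm_sym_eq_reorder(2)[OF perm_part_sorts(1)[OF s(1)] x] perm_part_sorts(2)[OF s(1)] s(2) by simp
  moreover have "inv_arr V (ihom_map V ?h (Idn V x)) = ihom_map V ?g (Idn V x)"
    using g by (intro inv_arrI) (simp_all add: ihom_map_arr ihom_map_comp ihom_map_Idn)
  moreover have "map tips (fibres T S \<sigma>) = map (\<lambda>i. arity ?s i) [0..<?k]"
    "map (\<lambda>F. opow x (tips F)) (fibres T S \<sigma>) = map (\<lambda>i. opow x (arity ?s i)) [0..<?k]"
    "length (fibres T S \<sigma>) = ?k"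
    using tips_fibre[OF \<sigma>] by (simp_all add: fibres_def)
  ultimately show ?thesis
    using sum_length_fib[OF s(1)] s(2)
    by (simp add: Des_def End_sym_def op_mul_def Let_def comp_def ohom_def)
qed

text \<open>
  The internal hom is natural in its first argument, so precomposition with \<open>\<chi>\<^sub>\<sigma>\<^sup>-\<^sup>1\<close> may take place
  after the composition with the outer operation, as it does in \<open>op_mul\<close>.
\<close>

lemma NMul_End:
  assumes \<sigma>: "is_tmor n T S \<sigma>"
  shows "NMul (End_n V x) T S \<sigma> = op_mul x (last \<sigma>) (tips S)"
proof -
  let ?s = "last \<sigma>" and ?k = "tips S"
  have s: "set ?s \<subseteq> {..<?k}" "length ?s = tips T" using last_tmor_range[OF \<sigma>] by simp_all
  note g = reorder_grp_inverse[OF s(1)]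
  let ?g = "reorder V (\<lambda>_. x) [0..<length ?s] (grp ?s ?k)" and ?h = "reorder V (\<lambda>_. x) (grp ?s ?k) [0..<length ?s]"
  have "chi V x T S \<sigma> = ?h"
    using chi_eq_reorder[OF strict_closed_smc_axioms x, of T S \<sigma>] \<sigma> is_tmorD(3)[OF \<sigma>] s(2) by simp
  moreover have "inv_arr V ?h = ?g"
    using g by (intro inv_arrI) simp_all
  moreover have "map (tpow V x) (fibres T S \<sigma>) = map (\<lambda>i. opow x (arity ?s i)) [0..<?k]"
    using tips_fibre[OF \<sigma>] tpow_eq[OF is_tree_fibre[OF \<sigma>] x] by (simp add: fibres_def)
  moreover have "tpow V x T = opow x (length ?s)" "tpow V x S = opow x ?k"
    using tpow_eq[OF is_tmorD(1)[OF \<sigma>] x] tpow_eq[OF is_tmorD(2)[OF \<sigma>] x] s(2) by simp_all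
  ultimately have "NMul (End_n V x) T S \<sigma> = ihom_comp V (opow x (length ?s)) (opow x ?k) x \<cdot>
      (Idn V (ohom x ?k) \<boxtimes> ihom_map V ?g (Idn V (opow x ?k))) \<cdot>
      (Idn V (ohom x ?k) \<boxtimes> ihom_tens V (map (\<lambda>i. opow x (arity ?s i)) [0..<?k]) (replicate ?k x))"
    by (simp add: End_n_def Let_def ohom_def)
  also have "\<dots> = (ihom_comp V (opow x (length ?s)) (opow x ?k) x \<cdot>
      (Idn V (ohom x ?k) \<boxtimes> ihom_map V ?g (Idn V (opow x ?k)))) \<cdot>
      (Idn V (ohom x ?k) \<boxtimes> ihom_tens V (map (\<lambda>i. opow x (arity ?s i)) [0..<?k]) (replicate ?k x))"
    using g ihom_tens_arr[OF x s(1)] by (simp add: comp_assoc ihom_map_arr ihom_comp_arr ohom_def)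
  also have "ihom_comp V (opow x (length ?s)) (opow x ?k) x \<cdot> (Idn V (ohom x ?k) \<boxtimes> ihom_map V ?g (Idn V (opow x ?k))) =
      ihom_map V ?g (Idn V x) \<cdot> ihom_comp V (opow x (length ?s)) (opow x ?k) x"
    using g ihom_comp_natural[of ?g "opow x (length ?s)" "opow x ?k" x] by (simp add: ohom_def)
  finally show ?thesis
    using g ihom_tens_arr[OF x s(1)] by (simp add: op_mul_def comp_assoc ihom_map_arr ihom_comp_arr ohom_def)
qed

lemma End_n_iso_Des:
  "is_n_operad_iso n V (End_n V x) (Des V (End_sym V x)) (\<lambda>T. Idn V (ohom x (tips T)))"
proof -
  have ob: "NOb (End_n V x) T = ohom x (tips T)" "NOb (Des V (End_sym V x)) T = ohom x (tips T)"
    if "is_tree n T" for T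
    using tpow_eq[OF that x] by (simp_all add: End_n_def Des_def End_sym_def Let_def ohom_def)
  have unit: "NUnit (End_n V x) = unit_arr x" "NUnit (Des V (End_sym V x)) = unit_arr x"
    by (simp_all add: End_n_def Des_def End_sym_def Let_def unit_arr_def)
  have "is_n_operad n V (End_n V x)" "is_n_operad n V (Des V (End_sym V x))"
    using ob unit NMul_End NMul_Des by (auto intro: is_n_operadI)
  moreover have "iso_arr V (Idn V (ohom x k))" for k
    by (rule inv_arrI(2)[of _ "Idn V (ohom x k)"]) simp_all
  moreover have "op_mul x (last \<sigma>) (tips S) \<cdot>
      (Idn V (ohom x (tips S)) \<boxtimes> tensA V (map (\<lambda>T. Idn V (ohom x (tips T))) (fibres T S \<sigma>))) =
      Idn V (ohom x (tips T)) \<cdot> op_mul x (last \<sigma>) (tips S)" if \<sigma>: "is_tmor n T S \<sigma>" for T S \<sigma>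
  proof -
    let ?h = "\<lambda>i. ohom x (arity (last \<sigma>) i)"
    have "map (\<lambda>T. Idn V (ohom x (tips T))) (fibres T S \<sigma>) = map (\<lambda>i. Idn V (?h i)) [0..<tips S]"
      using tips_fibre[OF \<sigma>] by (simp add: fibres_def)
    moreover have "tensA V (map (\<lambda>i. Idn V (?h i)) [0..<tips S]) = Idn V (tensO V (map ?h [0..<tips S]))"
      by (rule tensA_Idn) simp
    moreover have "tensO V (map ?h [0..<tips S]) \<in> Obj V" by (rule tensO_obj) auto
    ultimately show ?thesis
      using op_mul_arr[OF x last_tmor_range(2)[OF \<sigma>]] last_tmor_range(1)[OF \<sigma>] by (simp add: ten_Idn)
  qed
  ultimately show ?thesis
    unfolding is_n_operad_iso_def
    by (auto simp: ob unit homs_iff NMul_End NMul_Des tips_U)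
qed

end

lemma End_n_iso_natural:
  assumes f: "f \<in> homs V x y" "iso_arr V f" and T: "is_tree n T"
  shows "Idn V (ohom y (tips T)) \<cdot> ihom_map V (inv_arr V (tpow_arr V f T)) f =
    ihom_map V (inv_arr V (tensA V (replicate (tips T) f))) f \<cdot> Idn V (ohom x (tips T))"
proof -
  have f': "f \<in> Arr V" "Dom V f = x" "Cod V f = y" using f(1) by (simp_all add: homs_iff)
  then have xy: "x \<in> Obj V" "y \<in> Obj V" using Dom_closed Cod_closed by auto
  let ?g = "inv_arr V (tensA V (replicate (tips T) f))"
  have "?g \<in> homs V (opow y (tips T)) (opow x (tips T))"
    using tensA_replicate_iso(2)[OF f(2), of "tips T"] f' by (simp add: opow_def)
  then show ?thesis
    using f' xy by (simp add: tpow_arr_eq[OF T f'(1)] homs_iff ihom_map_arr ohom_def)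
qed

end

theorem proposition6p1:
  fixes V :: "('o, 'a) smc" and n :: nat
  assumes "n \<ge> 1" and "strict_closed_smc V"
  shows "\<exists>\<Phi> :: 'o \<Rightarrow> tree \<Rightarrow> 'a.
    (\<forall>x \<in> Obj V. is_n_operad_iso n V (End_n V x) (Des V (End_sym V x)) (\<Phi> x)) \<and>
    (\<forall>x \<in> Obj V. \<forall>y \<in> Obj V. \<forall>f \<in> homs V x y. iso_arr V f \<longrightarrow>
      (\<forall>T. is_tree n T \<longrightarrow>
        \<Phi> y T \<cdot>\<^bsub>V\<^esub> ihom_map V (inv_arr V (tpow_arr V f T)) f =
        ihom_map V (inv_arr V (tensA V (replicate (tips T) f))) f \<cdot>\<^bsub>V\<^esub> \<Phi> x T))"
proof -
  interpret strict_closed_smc V by fact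
  show ?thesis
    by (intro exI[of _ "\<lambda>x T. Idn V (ohom x (tips T))"] conjI ballI allI impI End_n_iso_Des End_n_iso_natural)
qed

end
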